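(* The problem of finding a strong Nash equilibrium of a two-agent strategic-form game (i.e. returning a strong Nash equilibrium if one exists and reporting non-existence otherwise) is in smoothed-$\mathcal{P}$: it admits an algorithm with smoothed polynomial running time.
   Context: A two-agent game with $m$ actions per agent is given by utility matrices $U_1,U_2\in\mathbb{R}^{m\times m}$. Mixed strategies are probability distributions on actions, agents randomize independently, utilities extend by expectation. A strong Nash equilibrium (SNE) is a mixed profile $\mathbf{x}=(\mathbf{x}_1,\mathbf{x}_2)$ such that for no nonempty coalition $C\subseteq\{1,2\}$ are there mixed strategies for the members of $C$ such that, when they play these and the agents outside $C$ keep their strategies in $\mathbf{x}$, every member of $C$ obtains a strictly larger expected utility than in $\mathbf{x}$. Perturbations $\mathcal{D}_\sigma$ of magnitude $\sigma$: every entry of each $U_i$ is subjected to an independent additive perturbation, identically distributed across entries, which is either uniform on $[-\sigma,+\sigma]$ (uniform perturbation) or Gaussian with mean $0$ and standard deviation $\sigma$ (Gaussian perturbation); the perturbed matrices are denoted $\tilde U_1,\tilde U_2$. The smoothed running time of an algorithm $\mathcal{A}$ is \[ \textsf{smoothed-}t_{\mathcal{A}}=\mathbb{E}_{\tilde U_1,\tilde U_2\sim\mathcal{D}_\sigma}\bigl[t_{\mathcal{A}}(\tilde U_1,\tilde U_2)\mid U_1,U_2\bigr], \] where $t_{\mathcal{A}}(\tilde U_1,\tilde U_2)$ is the running time of $\mathcal{A}$ on the game $(\tilde U_1,\tilde U_2)$. $\mathcal{A}$ has smoothed polynomial time complexity if for all $0<\sigma<1$ there are positive constants $c,k_1,k_2$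 such that $\textsf{smoothed-}t_{\mathcal{A}}=O(c\cdot m^{k_1}\cdot\sigma^{-k_2})$. A problem is in smoothed-$\mathcal{P}$ if it admits an algorithm with smoothed polynomial time complexity (here for both the uniform and the Gaussian perturbation). *)

theory Defs
  imports "HOL-Probability.Probability"
begin

section \<open>Two-agent games and strong Nash equilibria\<close>

text \<open>The agents are \<open>1\<close> and \<open>2\<close>, the actions of each are \<open>0, \<dots>, m - 1\<close>, and \<open>U k i j\<close> is the
  utility of agent \<open>k\<close> when agent 1 plays \<open>i\<close> and agent 2 plays \<open>j\<close>.
  Entries outside these ranges never matter.\<close>

type_synonym game = "nat \<Rightarrow> nat \<Rightarrow> nat \<Rightarrow> real"
type_synonym profile = "nat \<Rightarrow> nat \<Rightarrow> real"

definition mixed_strategy :: "nat \<Rightarrow> (nat \<Rightarrow> real) \<Rightarrow> bool" where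
  "mixed_strategy m p \<longleftrightarrow> (\<forall>i<m. p i \<ge> 0) \<and> (\<Sum>i<m. p i) = 1"

definition expected_utility :: "nat \<Rightarrow> game \<Rightarrow> nat \<Rightarrow> profile \<Rightarrow> real" where
  "expected_utility m U k x = (\<Sum>i<m. \<Sum>j<m. x 1 i * x 2 j * U k i j)"

definition strong_Nash :: "nat \<Rightarrow> game \<Rightarrow> profile \<Rightarrow> bool" where
  "strong_Nash m U x \<longleftrightarrow>
     (\<forall>k\<in>{1, 2}. mixed_strategy m (x k)) \<and>
     (\<forall>C\<subseteq>{1, 2}. C \<noteq> {} \<longrightarrow>
        \<not> (\<exists>y. (\<forall>k\<in>C. mixed_strategy m (y k)) \<and>
               (\<forall>k\<in>C. expected_utility m U k (\<lambda>l. if l \<in> C then y l else x l)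
                        > expected_utility m U k x)))"


section \<open>A real RAM\<close>

text \<open>Utilities are real numbers, so running times are counted on a real RAM, presented as a
  while-language: one fixed program serves all \<open>m\<close>, and every constant, memory access, arithmetic
  operation, comparison, Boolean operation and assignment costs one unit. Memory consists of
  two-dimensional arrays of naturals and of reals. Real arithmetic is exact, but there is no
  rounding and no conversion between the two sorts; naturals (which serve as indices) can only be
  added, subtracted and compared, because unit-cost multiplication together with division would
  make the integer part of the machine unreasonably strong. Real constants are integers.\<close>

record state =
  nats :: "nat \<Rightarrow> nat \<Rightarrow> nat \<Rightarrow> nat"
  reals :: "nat \<Rightarrow> nat \<Rightarrow> nat \<Rightarrow> real"

datatype nexp = NConst nat | NElem nat nexp nexp | NPlus nexp nexp | NMinus nexp nexp

datatype rexp = RConst int | RElem nat nexp nexp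
  | RPlus rexp rexp | RMinus rexp rexp | RTimes rexp rexp | RDiv rexp rexp

datatype bexp = NLess nexp nexp | RLess rexp rexp | BNot bexp | BAnd bexp bexp

datatype com = Skip
  | NAssign nat nexp nexp nexp
  | RAssign nat nexp nexp rexp
  | Seq com com
  | Cond bexp com com
  | While bexp com

primrec nval :: "nexp \<Rightarrow> state \<Rightarrow> nat" where
  "nval (NConst n) s = n"
| "nval (NElem a i j) s = nats s a (nval i s) (nval j s)"
| "nval (NPlus d e) s = nval d s + nval e s"
| "nval (NMinus d e) s = nval d s - nval e s"

primrec rval :: "rexp \<Rightarrow> state \<Rightarrow> real" where
  "rval (RConst z) s = of_int z"
| "rval (RElem a i j) s = reals s a (nval i s) (nval j s)"
| "rval (RPlus d e) s = rval d s + rval e s"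
| "rval (RMinus d e) s = rval d s - rval e s"
| "rval (RTimes d e) s = rval d s * rval e s"
| "rval (RDiv d e) s = rval d s / rval e s"

primrec bval :: "bexp \<Rightarrow> state \<Rightarrow> bool" where
  "bval (NLess d e) s \<longleftrightarrow> nval d s < nval e s"
| "bval (RLess d e) s \<longleftrightarrow> rval d s < rval e s"
| "bval (BNot b) s \<longleftrightarrow> \<not> bval b s"
| "bval (BAnd b c) s \<longleftrightarrow> bval b s \<and> bval c s"

primrec ncost :: "nexp \<Rightarrow> nat" where
  "ncost (NConst n) = 1"
| "ncost (NElem a i j) = 1 + ncost i + ncost j"
| "ncost (NPlus d e) = 1 + ncost d + ncost e"
| "ncost (NMinus d e) = 1 + ncost d + ncost e"

primrec rcost :: "rexp \<Rightarrow> nat" where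
  "rcost (RConst z) = 1"
| "rcost (RElem a i j) = 1 + ncost i + ncost j"
| "rcost (RPlus d e) = 1 + rcost d + rcost e"
| "rcost (RMinus d e) = 1 + rcost d + rcost e"
| "rcost (RTimes d e) = 1 + rcost d + rcost e"
| "rcost (RDiv d e) = 1 + rcost d + rcost e"

primrec bcost :: "bexp \<Rightarrow> nat" where
  "bcost (NLess d e) = 1 + ncost d + ncost e"
| "bcost (RLess d e) = 1 + rcost d + rcost e"
| "bcost (BNot b) = 1 + bcost b"
| "bcost (BAnd b c) = 1 + bcost b + bcost c"

definition nats_upd :: "nat \<Rightarrow> nat \<Rightarrow> nat \<Rightarrow> nat \<Rightarrow> state \<Rightarrow> state" where
  "nats_upd a i j v s =
     s\<lparr>nats := (nats s)(a := (nats s a)(i := (nats s a i)(j := v)))\<rparr>"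

definition reals_upd :: "nat \<Rightarrow> nat \<Rightarrow> nat \<Rightarrow> real \<Rightarrow> state \<Rightarrow> state" where
  "reals_upd a i j v s =
     s\<lparr>reals := (reals s)(a := (reals s a)(i := (reals s a i)(j := v)))\<rparr>"

text \<open>\<open>exec c s n t\<close>: started in \<open>s\<close>, the program \<open>c\<close> halts in \<open>t\<close> after \<open>n\<close> units of time.\<close>

inductive exec :: "com \<Rightarrow> state \<Rightarrow> nat \<Rightarrow> state \<Rightarrow> bool" where
  Skip: "exec Skip s 1 s"
| NAssign: "exec (NAssign a i j e) s (1 + ncost i + ncost j + ncost e)
     (nats_upd a (nval i s) (nval j s) (nval e s) s)"
| RAssign: "exec (RAssign a i j e) s (1 + ncost i + ncost j + rcost e)
     (reals_upd a (nval i s) (nval j s) (rval e s) s)"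
| Seq: "exec c s n t \<Longrightarrow> exec d t n' u \<Longrightarrow> exec (Seq c d) s (n + n') u"
| CondTrue: "bval b s \<Longrightarrow> exec c s n t \<Longrightarrow> exec (Cond b c d) s (bcost b + n) t"
| CondFalse: "\<not> bval b s \<Longrightarrow> exec d s n t \<Longrightarrow> exec (Cond b c d) s (bcost b + n) t"
| WhileFalse: "\<not> bval b s \<Longrightarrow> exec (While b c) s (bcost b) s"
| WhileTrue: "bval b s \<Longrightarrow> exec c s n t \<Longrightarrow> exec (While b c) t n' u \<Longrightarrow>
     exec (While b c) s (bcost b + n + n') u"

text \<open>Execution is deterministic, so the infimum is over at most one number;
  the running time of a diverging program is \<open>\<infinity>\<close>.\<close>

definition running_time :: "com \<Rightarrow> state \<Rightarrow> ennreal" where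
  "running_time c s = (INF n\<in>{n. \<exists>t. exec c s n t}. of_nat n)"

text \<open>Input: \<open>m\<close> in entry \<open>(0, 0)\<close> of the natural array 0, and \<open>U k\<close> in the real array \<open>k\<close>
  for \<open>k = 1, 2\<close>. Output: entry \<open>(0, 0)\<close> of the natural array 0 is zero to report
  non-existence; otherwise rows 1 and 2 of the real array 0 contain the strategies of the two
  agents.\<close>

definition input_state :: "nat \<Rightarrow> game \<Rightarrow> state" where
  "input_state m U =
     \<lparr>nats = (\<lambda>a i j. if a = 0 \<and> i = 0 \<and> j = 0 then m else 0),
      reals = (\<lambda>k i j. if k \<in> {1, 2} \<and> i < m \<and> j < m then U k i j else 0)\<rparr>"

definition output_of :: "state \<Rightarrow> profile option" where
  "output_of t = (if nats t 0 0 0 = 0 then None else Some (reals t 0))"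


section \<open>Smoothed polynomial time\<close>

type_synonym problem = "nat \<Rightarrow> game \<Rightarrow> profile option \<Rightarrow> bool"

definition solves :: "com \<Rightarrow> problem \<Rightarrow> bool" where
  "solves c P \<longleftrightarrow>
     (\<forall>m>0. \<forall>U. \<exists>n t. exec c (input_state m U) n t \<and> P m U (output_of t))"

definition uniform_noise :: "real \<Rightarrow> real measure" where
  "uniform_noise \<sigma> = uniform_measure lborel {-\<sigma>..\<sigma>}"

definition gaussian_noise :: "real \<Rightarrow> real measure" where
  "gaussian_noise \<sigma> = density lborel (\<lambda>x. ennreal (normal_density 0 \<sigma> x))"

definition perturbation :: "real measure \<Rightarrow> nat \<Rightarrow> (nat \<times> nat \<times> nat \<Rightarrow> real) measure" where
  "perturbation D m = Pi\<^sub>M ({1, 2} \<times> {..<m} \<times> {..<m}) (\<lambda>_. D)"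

definition perturbed :: "game \<Rightarrow> (nat \<times> nat \<times> nat \<Rightarrow> real) \<Rightarrow> game" where
  "perturbed U \<omega> = (\<lambda>k i j. U k i j + \<omega> (k, i, j))"

text \<open>The integrand is Borel measurable for every program: there are countably many execution
  paths, and along each of them all real memory cells are Borel functions of the input.\<close>

definition smoothed_time :: "real measure \<Rightarrow> com \<Rightarrow> nat \<Rightarrow> game \<Rightarrow> ennreal" where
  "smoothed_time D c m U =
     (\<integral>\<^sup>+\<omega>. running_time c (input_state m (perturbed U \<omega>)) \<partial>perturbation D m)"

text \<open>The bound is for the worst case over all games with \<open>m\<close> actions, as a function of \<open>m\<close>.
  The constants may depend on \<open>\<sigma>\<close>.\<close>

definition smoothed_polynomial_time :: "(real \<Rightarrow> real measure) \<Rightarrow> com \<Rightarrow> bool" where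
  "smoothed_polynomial_time noise A \<longleftrightarrow>
     (\<forall>\<sigma>. 0 < \<sigma> \<and> \<sigma> < 1 \<longrightarrow>
       (\<exists>c>0. \<exists>k1>0. \<exists>k2>0. \<exists>f.
          (\<forall>m>0. \<forall>U. smoothed_time (noise \<sigma>) A m U \<le> ennreal (f m)) \<and>
          f \<in> O(\<lambda>m. c * real m powr k1 * \<sigma> powr (- k2))))"

definition in_smoothed_P :: "problem \<Rightarrow> bool" where
  "in_smoothed_P P \<longleftrightarrow>
     (\<exists>A. solves A P \<and> smoothed_polynomial_time uniform_noise A
                     \<and> smoothed_polynomial_time gaussian_noise A)"

definition find_strong_Nash :: problem where
  "find_strong_Nash m U r \<longleftrightarrow>
     (case r of None \<Rightarrow> \<not> (\<exists>x. strong_Nash m U x) | Some x \<Rightarrow> strong_Nash m U x)"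

end

theory Submission
  imports Defs
begin

text \<open>Generically only pure profiles can be strong equilibria. If a mixed profile is a Nash equilibrium,
  first- and second-order variations of both strategies inside the supports produce a joint
  improvement unless the payoffs on the support satisfy an algebraic equation (two equal entries in a
  row or column, or three collinear corners of a two-by-two block), which has probability zero under the
  perturbation. Hence almost surely it suffices to examine the \<open>m\<^sup>2\<close> pure profiles, and Pareto
  optimality is tested in polynomial time because a dominating pair of mixed strategies can be
  reduced to supports of size two.

  In the degenerate case the running time is irrelevant, but the answer must still be exact. Fix the
  supports of a strong equilibrium: the Nash equilibria with these supports form a product of two
  polytopes, on which the two equilibrium values can be maximised separately without losing
  Pareto optimality. By Fourier-Motzkin elimination the maxima are attained at points whose coordinates
  arise from the utilities by quadratically many rounds of arithmetic, so it is enough to search the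
  finite set of all vectors generated in this way.\<close>

section \<open>Domination on two-by-two blocks\<close>

text \<open>Two demands pull apart. \<open>solves\<close> asks for halting and an exact answer on
  every real game, whereas the expectation sees only almost all games. The program therefore tests
  degeneracy explicitly and pays for an enormous search only when that test succeeds; for this
  search only finiteness and completeness matter, so it neither enumerates supports nor solves
  linear programs. The machine has field operations and comparisons but no roots, and this shapes
  the Pareto test. On a two-by-two block a joint improvement is governed by the sign of a quadratic;
  instead of its roots its vertex is examined, which is a rational function of the payoffs. Likewise
  the optima of the linear programs must be reachable by field operations from the utilities, which
  elimination makes explicit. Programs are written with bounded loops only, so that halting is
  structural and the cost can be computed along with the result. The cost bound obtained does not
  depend on \<sigma>: the noise serves only to make degeneracy a null event.\<close>

definition seg_pos :: "real \<Rightarrow> real \<Rightarrow> real \<Rightarrow> real \<Rightarrow> bool" where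
  "seg_pos a b a' b' \<longleftrightarrow> (0 < a \<and> 0 < a') \<or> (0 < b \<and> 0 < b')
     \<or> (0 < a \<and> 0 < b' \<and> b * a' < a * b') \<or> (0 < b \<and> 0 < a' \<and> a * b' < b * a')"

lemma seg_pos_mixed:
  assumes "0 < a" "0 < b'" "b * a' < a * b'"
  shows "\<exists>t::real. 0 \<le> t \<and> t \<le> 1 \<and> 0 < (1-t)*a + t*b \<and> 0 < (1-t)*a' + t*b'"
proof (cases "0 < b \<or> 0 < a'")
  case True
  then show ?thesis
  proof
    assume "0 < b" then show ?thesis using assms by (intro exI[of _ 1]) auto
  next
    assume "0 < a'" then show ?thesis using assms by (intro exI[of _ 0]) auto
  qed
next
  case False
  \<comment> \<open>The crossing point of the two affine functions, where both have the value
    \<open>(a * b' - b * a') / d\<close>.\<close>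
  define d where "d = a - a' + b' - b"
  define t where "t = (a - a') / d"
  have d: "d > 0" "a - a' > 0" "b' - b > 0" using False assms by (auto simp: d_def)
  have t1: "1 - t = (b' - b) / d" using d by (simp add: t_def d_def field_simps)
  have "(1-t)*a + t*b = (a * b' - b * a') / d" "(1-t)*a' + t*b' = (a * b' - b * a') / d"
    unfolding t1 using d by (simp_all add: t_def field_simps)
  moreover have "0 \<le> t" "t \<le> 1" using d t1 by (auto simp: t_def d_def field_simps)
  ultimately show ?thesis using assms d by (intro exI[of _ t]) auto
qed

lemma seg_pos_cross:
  assumes t: "0 \<le> t" "t \<le> (1::real)" and f: "0 < (1-t)*a + t*b" and g: "0 < (1-t)*a' + t*b'"
    and s: "0 < a" "a' \<le> 0"
  shows "0 < b'" "0 < b \<or> b * a' < a * b'"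
proof -
  have *: "(1-t)*a' \<le> 0" using t s by (simp add: mult_nonneg_nonpos)
  then have tb: "t * b' > 0" using g by linarith
  then show b': "0 < b'" using t by (simp add: zero_less_mult_iff)
  have t0: "t > 0" using tb t by (cases "t = 0") auto
  show "0 < b \<or> b * a' < a * b'"
  proof (rule ccontr)
    assume n: "\<not> ?thesis"
    have t1: "t < 1" using f n t by (cases "t = 1") auto
    \<comment> \<open>The two positivity conditions are inequalities between nonnegative quantities
      and may be multiplied; the factor \<open>t*(1-t)\<close> then cancels.\<close>
    have "(t*(-b)) * ((1-t)*(-a')) < ((1-t)*a) * (t*b')"
    proof (rule mult_strict_mono')
      show "t*(-b) < (1-t)*a" "(1-t)*(-a') < t*b'" using f g by linarith+
      show "0 \<le> t*(-b)" "0 \<le> (1-t)*(-a')" using n s t by (intro mult_nonneg_nonneg; linarith)+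
    qed
    then have "(t*(1-t)) * (b * a') < (t*(1-t)) * (a*b')" by (simp add: algebra_simps)
    then have "b * a' < a * b'" using t0 t1 by (simp add: mult_less_cancel_left_pos)
    then show False using n by simp
  qed
qed

text \<open>\<open>a\<close>, \<open>b\<close> and \<open>a'\<close>, \<open>b'\<close> are the end
  values of two affine functions on the unit interval. If a common positive point exists but neither
  end point is one, then one function is positive at the left end only and the other at the right
  end only, and their common value at the crossing has the sign of the determinant in
  \<open>seg_pos\<close>. This eliminates the quantifier in favour of tests that the machine can
  evaluate.\<close>

lemma seg_pos_iff:
  "seg_pos a b a' b' \<longleftrightarrow> (\<exists>t. 0 \<le> t \<and> t \<le> 1 \<and> 0 < (1-t)*a + t*b \<and> 0 < (1-t)*a' + t*b')"
    (is "_ \<longleftrightarrow> ?R")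
proof
  assume "seg_pos a b a' b'"
  then consider "0 < a \<and> 0 < a'" | "0 < b \<and> 0 < b'" | "0 < a" "0 < b'" "b * a' < a * b'"
    | "0 < b" "0 < a'" "a * b' < b * a'" by (auto simp: seg_pos_def)
  then show ?R
  proof cases
    case 1 then show ?thesis by (intro exI[of _ 0]) auto
  next
    case 2 then show ?thesis by (intro exI[of _ 1]) auto
  next
    case 3 then show ?thesis by (rule seg_pos_mixed)
  next
    case 4
    then have "a * b' < a' * b" by (simp add: mult.commute)
    from seg_pos_mixed[of a' b b' a] 4 obtain t where "0 \<le> t" "t \<le> 1" "0 < (1-t)*a' + t*b'" "0 < (1-t)*a + t*b"
      by (auto simp: mult.commute)
    then show ?thesis by blast
  qed
next
  assume ?R
  then obtain t where t: "0 \<le> t" "t \<le> 1" and f: "0 < (1-t)*a + t*b" and g: "0 < (1-t)*a' + t*b'" by auto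
  show "seg_pos a b a' b'"
  proof (cases "0 < a")
    case True
    show ?thesis
    proof (cases "0 < a'")
      case False
      then have "a' \<le> 0" by simp
      from seg_pos_cross[OF t f g True this] True show ?thesis unfolding seg_pos_def by blast
    qed (use True in \<open>auto simp: seg_pos_def\<close>)
  next
    case False
    then have a: "a \<le> 0" by simp
    then have "t * b > 0" using f t mult_nonneg_nonpos[of "1-t" a] by linarith
    then have b: "b > 0" using t by (simp add: zero_less_mult_iff)
    show ?thesis
    proof (cases "0 < a'")
      case True
      from seg_pos_cross[OF t g f True a] True b show ?thesis unfolding seg_pos_def
        by (auto simp: mult.commute)
    next
      case False
      then have "t * b' > 0" using g t mult_nonneg_nonpos[of "1-t" a'] by linarith
      then have "b' > 0" using t by (simp add: zero_less_mult_iff)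
      then show ?thesis using b by (simp add: seg_pos_def)
    qed
  qed
qed

text \<open>The secants from \<open>a\<close> to \<open>s\<close> and from \<open>s\<close> to
  \<open>b\<close> have slopes of opposite sign; this forces strict concavity and puts the vertex
  strictly between \<open>a\<close> and \<open>b\<close>. The vertex is thus a witness of positivity
  that needs no square root.\<close>

lemma quadratic_vertex:
  fixes d0 d1 d2 :: real
  assumes "a \<le> s" "s \<le> b"
    and "d0 + d1*a + d2*a^2 \<le> 0" "d0 + d1*b + d2*b^2 \<le> 0" "0 < d0 + d1 * s + d2 * s^2"
  shows "d2 < 0" "a < - d1 / (2*d2)" "- d1 / (2*d2) < b"
    "d0 + d1 * s + d2 * s^2 \<le> d0 + d1*(- d1 / (2*d2)) + d2*(- d1 / (2*d2))^2"
proof -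
  have as: "a < s" using assms by (cases "a = s") auto
  have sb: "s < b" using assms by (cases "s = b") auto
  have 1: "(s - a) * (d1 + d2 * (s + a)) > 0" using assms by (simp add: algebra_simps power2_eq_square)
  then have 1: "d1 + d2 * (s + a) > 0" using as by (simp add: zero_less_mult_iff)
  have 2: "(b - s) * (d1 + d2 * (s + b)) < 0" using assms by (simp add: algebra_simps power2_eq_square)
  then have 2: "d1 + d2 * (s + b) < 0" using sb by (simp add: mult_less_0_iff)
  have "d2 * (b - a) < 0" using 1 2 by (simp add: algebra_simps)
  then show d2: "d2 < 0" using as sb by (simp add: mult_less_0_iff)
  have "d2 * (s + a) \<le> d2 * (2 * a)" "d2 * (2 * b) \<le> d2 * (s + b)"
    using d2 as sb by (auto intro!: mult_left_mono_neg)
  then have "d1 + 2 * d2 * b < 0"  using 2 by (simp add: algebra_simps)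
  then show "- d1 / (2*d2) < b" using d2 by (simp add: field_simps)
  have "d2 * (s + a) < d2 * (2 * a)" using d2 as by simp
  then have "0 < d1 + 2 * d2 * a" using 1 by (simp add: algebra_simps)
  then show "a < - d1 / (2*d2)" using d2 by (simp add: field_simps)
  have "d0 + d1*(- d1 / (2*d2)) + d2*(- d1 / (2*d2))^2 - (d0 + d1 * s + d2 * s^2) = - d2 * (s + d1/(2*d2))^2"
    using d2 by (simp add: field_simps power2_eq_square)
  also have "\<dots> \<ge> 0" using d2 by (simp add: mult_nonpos_nonneg)
  finally show "d0 + d1 * s + d2 * s^2 \<le> d0 + d1*(- d1 / (2*d2)) + d2*(- d1 / (2*d2))^2" by simp
qed


text \<open>A joint improvement at position \<open>s\<close> between the rows depends on the sign of a quadratic in \<open>s\<close>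
  (the \<open>b * a' < a * b'\<close> of \<open>seg_pos\<close>). This is its vertex, which is needed only for a strictly concave
  quadratic; an affine one gives the junk value 0, which \<open>block_pos\<close> discards.\<close>

definition block_vertex :: "(nat \<Rightarrow> nat \<Rightarrow> real) \<Rightarrow> (nat \<Rightarrow> nat \<Rightarrow> real) \<Rightarrow> real" where
  "block_vertex f g =
     (let x = f 0 0 * g 1 1 + f 1 0 * g 0 1 - f 0 1 * g 1 0 - f 1 1 * g 0 0;
          y = f 0 0 * g 0 1 - f 0 1 * g 0 0; z = f 1 0 * g 1 1 - f 1 1 * g 1 0
      in (2 * y - x) / (2 * (y - x + z)))"

text \<open>The weights of the second row and of the second column range over a unit square. The
  first four disjuncts treat its edges; the last one treats a single line across it, which by
  \<open>block_pos_vertex\<close> suffices once the edges have failed.\<close>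

definition block_pos :: "(nat \<Rightarrow> nat \<Rightarrow> real) \<Rightarrow> (nat \<Rightarrow> nat \<Rightarrow> real) \<Rightarrow> bool" where
  "block_pos f g \<longleftrightarrow>
     seg_pos (f 0 0) (f 0 1) (g 0 0) (g 0 1) \<or> seg_pos (f 1 0) (f 1 1) (g 1 0) (g 1 1) \<or>
     seg_pos (f 0 0) (f 1 0) (g 0 0) (g 1 0) \<or> seg_pos (f 0 1) (f 1 1) (g 0 1) (g 1 1) \<or>
     (let c = block_vertex f g in 0 < c \<and> c < 1 \<and>
        seg_pos ((1-c) * f 0 0 + c * f 1 0) ((1-c) * f 0 1 + c * f 1 1)
                ((1-c) * g 0 0 + c * g 1 0) ((1-c) * g 0 1 + c * g 1 1))"

definition bilin :: "(nat \<Rightarrow> nat \<Rightarrow> real) \<Rightarrow> real \<Rightarrow> real \<Rightarrow> real" where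
  "bilin f s t = (1-t) * ((1-s) * f 0 0 + s * f 1 0) + t * ((1-s) * f 0 1 + s * f 1 1)"

text \<open>\<open>a\<close> is the largest point of the compact set where \<open>h \<le> 0\<close>,
  if there is one; a negative value there would give a later zero by the intermediate value
  theorem.\<close>

lemma last_root:
  fixes h :: "real \<Rightarrow> real"
  assumes c: "continuous_on UNIV h" and s: "0 \<le> s" "0 < h s"
  obtains a where "0 \<le> a" "a \<le> s" "\<And>x. a < x \<Longrightarrow> x \<le> s \<Longrightarrow> 0 < h x" "a = 0 \<and> 0 < h a \<or> h a = 0"
proof (cases "\<forall>x\<in>{0..s}. 0 < h x")
  case True
  then show ?thesis using that[of 0] s by auto
next
  case False
  define Z where "Z = {x \<in> {0..s}. h x \<le> 0}"
  have "Z \<noteq> {}" using False by (auto simp: Z_def not_less)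
  moreover have "compact Z"
  proof -
    have "closed {x. h x \<le> 0}" by (intro closed_Collect_le c continuous_on_const)
    then have "compact ({0..s} \<inter> {x. h x \<le> 0})" by (intro compact_Int_closed) auto
    then show ?thesis by (simp add: Z_def Int_def)
  qed
  ultimately obtain a where a: "a \<in> Z" "\<And>x. x \<in> Z \<Longrightarrow> x \<le> a"
    using compact_attains_sup by metis
  have pos: "0 < h x" if "a < x" "x \<le> s" for x
    using a(2)[of x] a(1) that by (fastforce simp: Z_def)
  have "h a = 0"
  proof (rule ccontr)
    assume "h a \<noteq> 0"
    then have "h a < 0" using a(1) by (simp add: Z_def)
    moreover have "a \<le> s" using a(1) by (simp add: Z_def)
    moreover have "continuous_on {a..s} h" by (rule continuous_on_subset[OF c]) simp
    ultimately obtain x where x: "a \<le> x" "x \<le> s" "h x = 0" using IVT'[of h a 0 s] s by force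
    then show False using pos[of x] \<open>h a < 0\<close> by (cases "x = a") auto
  qed
  then show ?thesis using that[of a] a(1) pos by (auto simp: Z_def)
qed

lemma interval_ends:
  fixes h :: "real \<Rightarrow> real"
  assumes c: "continuous_on UNIV h" and s: "0 \<le> s" "s \<le> 1" "0 < h s"
  obtains a b where "0 \<le> a" "a \<le> s" "s \<le> b" "b \<le> 1" "\<And>x. a < x \<Longrightarrow> x < b \<Longrightarrow> 0 < h x"
    "a = 0 \<and> 0 < h 0 \<or> h a = 0" "b = 1 \<and> 0 < h 1 \<or> h b = 0"
proof -
  obtain a where a: "0 \<le> a" "a \<le> s" "\<And>x. a < x \<Longrightarrow> x \<le> s \<Longrightarrow> 0 < h x" "a = 0 \<and> 0 < h a \<or> h a = 0"
    using last_root[OF c s(1) s(3)] by metis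
  have "continuous_on UNIV (\<lambda>x. h (1 - x))"
    by (rule continuous_on_compose2[OF c]) (auto intro!: continuous_intros)
  then obtain b where b: "0 \<le> b" "b \<le> 1 - s" "\<And>x. b < x \<Longrightarrow> x \<le> 1 - s \<Longrightarrow> 0 < h (1 - x)"
      "b = 0 \<and> 0 < h (1 - b) \<or> h (1 - b) = 0"
    using last_root[of "\<lambda>x. h (1 - x)" "1 - s"] s by auto
  have "0 < h x" if "a < x" "x < 1 - b" for x
    using a(3)[of x] b(3)[of "1 - x"] that by (cases "x \<le> s") auto
  then show ?thesis using that[of a "1 - b"] a b by auto
qed

text \<open>Consider the maximal interval around \<open>s\<close> on which \<open>f0\<close> and
  \<open>g1\<close> are positive. Since the edges admit no improvement, \<open>f1\<close> and
  \<open>g0\<close> are nonpositive there, so an improvement at a point of this interval amounts to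
  positivity of the determinant \<open>D\<close>, a quadratic. At both ends \<open>D\<close> is
  nonpositive: either the end is a side of the square, excluded by \<open>ends\<close>, or
  \<open>f0\<close> or \<open>g1\<close> vanishes. Hence \<open>quadratic_vertex\<close> puts the
  vertex inside the interval, with \<open>D\<close> positive there.\<close>

lemma block_pos_vertex:
  fixes f00 f01 f10 f11 g00 g01 g10 g11 :: real
  defines "f0 \<equiv> \<lambda>s. (1-s)*f00 + s*f10" and "f1 \<equiv> \<lambda>s. (1-s)*f01 + s*f11"
    and "g0 \<equiv> \<lambda>s. (1-s)*g00 + s*g10" and "g1 \<equiv> \<lambda>s. (1-s)*g01 + s*g11"
  defines "x \<equiv> f00*g11 + f10*g01 - f01*g10 - f11*g00" and "y \<equiv> f00*g01 - f01*g00"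
    and "z \<equiv> f10*g11 - f11*g10"
  defines "c \<equiv> (2*y - x) / (2*(y - x + z))"
  assumes edge: "\<And>s. 0 \<le> s \<Longrightarrow> s \<le> 1 \<Longrightarrow> \<not> (0 < f0 s \<and> 0 < g0 s) \<and> \<not> (0 < f1 s \<and> 0 < g1 s)"
    and ends: "\<not> seg_pos (f0 0) (f1 0) (g0 0) (g1 0)" "\<not> seg_pos (f0 1) (f1 1) (g0 1) (g1 1)"
    and s: "0 \<le> s" "s \<le> 1" "0 < f0 s" "0 < g1 s" "f1 s * g0 s < f0 s * g1 s"
  shows "0 < c \<and> c < 1 \<and> seg_pos (f0 c) (f1 c) (g0 c) (g1 c)"
proof -
  define D where "D = (\<lambda>s. f0 s * g1 s - f1 s * g0 s)"
  have D: "D s = y + (x - 2*y) * s + (y - x + z) * s^2" for s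
    by (simp add: D_def f0_def f1_def g0_def g1_def x_def y_def z_def algebra_simps power2_eq_square)
  define h where "h = (\<lambda>s. min (f0 s) (g1 s))"
  have "continuous_on UNIV h" unfolding h_def f0_def g1_def by (intro continuous_intros)
  moreover have "0 < h s" using s by (simp add: h_def)
  ultimately obtain a b where ab: "0 \<le> a" "a \<le> s" "s \<le> b" "b \<le> 1"
      "\<And>x. a < x \<Longrightarrow> x < b \<Longrightarrow> 0 < h x"
      "a = 0 \<and> 0 < h 0 \<or> h a = 0" "b = 1 \<and> 0 < h 1 \<or> h b = 0"
    using interval_ends[of h s] s by metis
  have Ds: "0 < D s" using s by (simp add: D_def)
  have signs: "f1 w \<le> 0 \<and> g0 w \<le> 0" if "0 < h w" "0 \<le> w" "w \<le> 1" for w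
    using edge[of w] that by (auto simp: h_def)
  have lim: "f1 w \<le> 0 \<and> g0 w \<le> 0" if w: "a \<le> w" "w \<le> b" "a < b" for w
  proof -
    have cl: "closure {a<..<b} = {a..b}" using that by simp
    have "closed {w. f1 w \<le> 0 \<and> g0 w \<le> 0}"
      unfolding f1_def g0_def by (intro closed_Collect_conj closed_Collect_le continuous_intros)
    moreover have "{a<..<b} \<subseteq> {w. f1 w \<le> 0 \<and> g0 w \<le> 0}"
      using signs ab by force
    ultimately have "{a..b} \<subseteq> {w. f1 w \<le> 0 \<and> g0 w \<le> 0}" using cl closure_minimal by metis
    then show ?thesis using w by auto
  qed
  \<comment> \<open>One factor of \<open>f0 w * g1 w\<close> is zero, and \<open>f1 w * g0 w\<close>
    is a product of two nonpositive numbers.\<close>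
  have nb: "D w \<le> 0" if "h w = 0" "f1 w \<le> 0" "g0 w \<le> 0" for w
    using that by (auto simp: D_def h_def min_def mult_nonpos_nonpos split: if_splits)
  have Da: "D a \<le> 0"
    using ab(6)
  proof
    assume "a = 0 \<and> 0 < h 0"
    then show ?thesis using ends(1) by (auto simp: seg_pos_def h_def D_def)
  next
    assume h: "h a = 0"
    then have "a \<noteq> s" using s by (auto simp: h_def min_def split: if_splits)
    then show ?thesis using nb[OF h] lim[of a] ab by auto
  qed
  have Db: "D b \<le> 0"
    using ab(7)
  proof
    assume "b = 1 \<and> 0 < h 1"
    then show ?thesis using ends(2) by (auto simp: seg_pos_def h_def D_def)
  next
    assume h: "h b = 0"
    then have "b \<noteq> s" using s by (auto simp: h_def min_def split: if_splits)
    then show ?thesis using nb[OF h] lim[of b] ab by auto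
  qed
  have ceq: "- (x - 2*y) / (2 * (y - x + z)) = c" by (simp add: c_def)
  note q = quadratic_vertex[OF ab(2,3), of y "x - 2*y" "y - x + z", folded D, OF Da Db Ds, unfolded ceq, folded D]
  have c: "a < c" "c < b" "0 < D c" using q Ds by auto
  then have "0 < h c" using ab(5) by simp
  then show ?thesis using c ab by (auto simp: seg_pos_def h_def D_def)
qed

lemma block_pos_iff:
  "block_pos f g \<longleftrightarrow> (\<exists>s t. 0 \<le> s \<and> s \<le> 1 \<and> 0 \<le> t \<and> t \<le> 1 \<and> 0 < bilin f s t \<and> 0 < bilin g s t)"
    (is "_ \<longleftrightarrow> ?R")
proof
  assume "block_pos f g"
  then consider s where "0 \<le> s" "s \<le> 1" "seg_pos ((1-s) * f 0 0 + s * f 1 0) ((1-s) * f 0 1 + s * f 1 1)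
                ((1-s) * g 0 0 + s * g 1 0) ((1-s) * g 0 1 + s * g 1 1)"
    | "seg_pos (f 0 0) (f 1 0) (g 0 0) (g 1 0)" | "seg_pos (f 0 1) (f 1 1) (g 0 1) (g 1 1)"
    unfolding block_pos_def Let_def
  proof (elim disjE conjE, goal_cases)
    case 1 show ?case by (rule 1(1)[of 0]) (use 1 in auto)
  next
    case 2 show ?case by (rule 2(1)[of 1]) (use 2 in auto)
  next
    case 5 show ?case by (rule 5(1)[of "block_vertex f g"]) (use 5 in auto)
  qed blast+
  then show ?R
  proof cases
    case (1 s)
    then show ?thesis unfolding seg_pos_iff bilin_def by blast
  next
    case 2
    then obtain s where "0 \<le> s" "s \<le> 1" "0 < (1-s) * f 0 0 + s * f 1 0" "0 < (1-s) * g 0 0 + s * g 1 0"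
      unfolding seg_pos_iff by blast
    then show ?thesis by (intro exI[of _ s] exI[of _ 0]) (auto simp: bilin_def)
  next
    case 3
    then obtain s where "0 \<le> s" "s \<le> 1" "0 < (1-s) * f 0 1 + s * f 1 1" "0 < (1-s) * g 0 1 + s * g 1 1"
      unfolding seg_pos_iff by blast
    then show ?thesis by (intro exI[of _ s] exI[of _ 1]) (auto simp: bilin_def)
  qed
next
  assume ?R
  then obtain s t where st: "0 \<le> s" "s \<le> 1" "0 \<le> t" "t \<le> 1" "0 < bilin f s t" "0 < bilin g s t" by auto
  show "block_pos f g"
  proof (rule ccontr)
    assume n: "\<not> block_pos f g"
    have e: "\<not> (0 < (1-s) * f 0 0 + s * f 1 0 \<and> 0 < (1-s) * g 0 0 + s * g 1 0) \<and>
        \<not> (0 < (1-s) * f 0 1 + s * f 1 1 \<and> 0 < (1-s) * g 0 1 + s * g 1 1)" if "0 \<le> s" "s \<le> 1" for s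
      using n that unfolding block_pos_def seg_pos_iff[of "f 0 0" "f 1 0"] seg_pos_iff[of "f 0 1" "f 1 1"] by blast
    have "seg_pos ((1-s) * f 0 0 + s * f 1 0) ((1-s) * f 0 1 + s * f 1 1)
                ((1-s) * g 0 0 + s * g 1 0) ((1-s) * g 0 1 + s * g 1 1)"
      using st unfolding seg_pos_iff bilin_def by blast
    then consider "0 < (1-s) * f 0 0 + s * f 1 0" "0 < (1-s) * g 0 1 + s * g 1 1"
        "((1-s) * f 0 1 + s * f 1 1) * ((1-s) * g 0 0 + s * g 1 0) < ((1-s) * f 0 0 + s * f 1 0) * ((1-s) * g 0 1 + s * g 1 1)"
      | "0 < (1-s) * f 0 1 + s * f 1 1" "0 < (1-s) * g 0 0 + s * g 1 0"
        "((1-s) * f 0 0 + s * f 1 0) * ((1-s) * g 0 1 + s * g 1 1) < ((1-s) * f 0 1 + s * f 1 1) * ((1-s) * g 0 0 + s * g 1 0)"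
      using e[OF st(1,2)] unfolding seg_pos_def by blast
    then show False
    proof cases
      case 1
      have "0 < block_vertex f g \<and> block_vertex f g < 1 \<and> (let c = block_vertex f g in seg_pos ((1-c) * f 0 0 + c * f 1 0) ((1-c) * f 0 1 + c * f 1 1)
                ((1-c) * g 0 0 + c * g 1 0) ((1-c) * g 0 1 + c * g 1 1))"
        unfolding Let_def
        unfolding block_vertex_def Let_def
        by (rule block_pos_vertex[OF _ _ _ st(1,2) 1]) (use e n in \<open>auto simp: block_pos_def\<close>)
      then show False using n by (auto simp: block_pos_def Let_def)
    next
      case 2
      let ?f = "\<lambda>i j. f i (1 - j)" and ?g = "\<lambda>i j. g i (1 - j)"
      have flip: "seg_pos b a b' a' \<longleftrightarrow> seg_pos a b a' b'" for a b a' b' unfolding seg_pos_def by auto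
      \<comment> \<open>The second case is the first one with the columns swapped. The swap negates
        numerator and denominator of the vertex, so the vertex itself is unchanged.\<close>
      have bv: "(2 * (f 0 1 * g 0 0 - f 0 0 * g 0 1) - (f 0 1 * g 1 0 + f 1 1 * g 0 0 - f 0 0 * g 1 1 - f 1 0 * g 0 1)) /
          (2 * (f 0 1 * g 0 0 - f 0 0 * g 0 1 - (f 0 1 * g 1 0 + f 1 1 * g 0 0 - f 0 0 * g 1 1 - f 1 0 * g 0 1) +
            (f 1 1 * g 1 0 - f 1 0 * g 1 1))) = block_vertex f g" (is "?n / ?d = _")
      proof -
        have "?n / ?d = (- ?n) / (- ?d)" by (rule minus_divide_divide[symmetric])
        also have "\<dots> = block_vertex f g" unfolding block_vertex_def Let_def by (rule arg_cong2[of _ _ _ _ "(/)"]) simp_all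
        finally show ?thesis .
      qed
      have "0 < block_vertex f g \<and> block_vertex f g < 1 \<and> (let c = block_vertex f g in seg_pos ((1-c) * f 0 1 + c * f 1 1) ((1-c) * f 0 0 + c * f 1 0)
                ((1-c) * g 0 1 + c * g 1 1) ((1-c) * g 0 0 + c * g 1 0))"
        unfolding Let_def
        unfolding bv[symmetric]
        by (rule block_pos_vertex[OF _ _ _ st(1,2) 2]) (use e n in \<open>auto simp: block_pos_def flip\<close>)
      then show False using n by (auto simp: block_pos_def Let_def flip)
    qed
  qed
qed

text \<open>If a convex combination of points of the plane lies in the open positive quadrant, so
  does a point on a segment between two of them. Otherwise the indices \<open>P\<close> with
  positive \<open>a\<close> and \<open>N\<close> with positive \<open>b\<close> are disjoint, and
  \<open>a i * b k \<le> a k * b i\<close> across them. Summing this with weights bounds the product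
  of the two positive parts by the product of the two negative parts, contrary to both totals being
  positive.\<close>

lemma dominating_pair:
  fixes a b p :: "'i \<Rightarrow> real"
  assumes fin: "finite I" and p: "\<And>i. i \<in> I \<Longrightarrow> 0 \<le> p i"
    and a: "0 < (\<Sum>i\<in>I. p i * a i)" and b: "0 < (\<Sum>i\<in>I. p i * b i)"
  shows "\<exists>i\<in>I. \<exists>k\<in>I. seg_pos (a i) (a k) (b i) (b k)"
proof (rule ccontr)
  assume n: "\<not> ?thesis"
  then have n1: "\<not> (0 < a i \<and> 0 < b i)" if "i \<in> I" for i using that unfolding seg_pos_def by blast
  have n2: "a i * b k \<le> a k * b i" if "i \<in> I" "k \<in> I" "0 < a i" "0 < b k" for i k
    using n that unfolding seg_pos_def by (meson not_less)
  define P where "P = {i\<in>I. 0 < a i}"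
  define N where "N = {i\<in>I. 0 < b i}"
  have sub: "P \<subseteq> I" "N \<subseteq> I" "P \<inter> N = {}" "finite P" "finite N"
    using n1 fin by (auto simp: P_def N_def)
  have le: "(\<Sum>i\<in>I. p i * c i) \<le> (\<Sum>i\<in>P. p i * c i) + (\<Sum>i\<in>N. p i * c i)"
    if c: "\<And>i. i \<in> I \<Longrightarrow> i \<notin> P \<Longrightarrow> i \<notin> N \<Longrightarrow> c i \<le> 0" for c :: "'i \<Rightarrow> real"
  proof -
    have "(\<Sum>i\<in>I. p i * c i) = (\<Sum>i\<in>P \<union> N. p i * c i) + (\<Sum>i\<in>I - (P \<union> N). p i * c i)"
      using sub fin by (simp add: sum.subset_diff[of "P \<union> N" I] add.commute)
    moreover have "(\<Sum>i\<in>I - (P \<union> N). p i * c i) \<le> 0"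
      by (intro sum_nonpos mult_nonneg_nonpos p c) auto
    ultimately show ?thesis using sub by (simp add: sum.union_disjoint)
  qed
  let ?Pa = "\<Sum>i\<in>P. p i * a i" and ?Na = "\<Sum>i\<in>N. p i * a i"
  let ?Pb = "\<Sum>i\<in>P. p i * b i" and ?Nb = "\<Sum>i\<in>N. p i * b i"
  have "?Na \<le> 0" by (intro sum_nonpos mult_nonneg_nonpos p) (use n1 in \<open>force simp: N_def not_less\<close>)+
  moreover have "?Pb \<le> 0" by (intro sum_nonpos mult_nonneg_nonpos p) (use n1 in \<open>force simp: P_def not_less\<close>)+
  moreover have "- ?Na < ?Pa" using le[of a] a by (auto simp: P_def)
  moreover have "- ?Pb < ?Nb" using le[of b] b by (auto simp: N_def)
  ultimately have "(- ?Na) * (- ?Pb) < ?Pa * ?Nb" by (intro mult_strict_mono') auto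
  also have "?Pa * ?Nb = (\<Sum>i\<in>P. \<Sum>k\<in>N. (p i * p k) * (a i * b k))"
    by (simp add: sum_product algebra_simps)
  also have "\<dots> \<le> (\<Sum>i\<in>P. \<Sum>k\<in>N. (p i * p k) * (a k * b i))"
    by (intro sum_mono mult_left_mono n2 mult_nonneg_nonneg p) (auto simp: P_def N_def)
  also have "\<dots> = (\<Sum>k\<in>N. \<Sum>i\<in>P. (p i * p k) * (a k * b i))" by (rule sum.swap)
  also have "\<dots> = ?Na * ?Pb"
    by (simp add: sum_product algebra_simps)
  finally show False by simp
qed

section \<open>Payoffs, and domination by strategies with two-point supports\<close>

definition payoff :: "nat \<Rightarrow> (nat \<Rightarrow> nat \<Rightarrow> real) \<Rightarrow> (nat \<Rightarrow> real) \<Rightarrow> (nat \<Rightarrow> real) \<Rightarrow> real" where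
  "payoff m A p q = (\<Sum>i<m. \<Sum>j<m. p i * q j * A i j)"

definition sub_block :: "(nat \<Rightarrow> nat \<Rightarrow> real) \<Rightarrow> real \<Rightarrow> nat \<Rightarrow> nat \<Rightarrow> nat \<Rightarrow> nat \<Rightarrow> nat \<Rightarrow> nat \<Rightarrow> real" where
  "sub_block A v i i' j j' = (\<lambda>k l. A (if k = 0 then i else i') (if l = 0 then j else j') - v)"

lemma payoff_row: "payoff m A p q = (\<Sum>i<m. p i * (\<Sum>j<m. q j * A i j))"
  by (simp add: payoff_def sum_distrib_left mult.assoc)

lemma payoff_col: "payoff m A p q = (\<Sum>j<m. q j * (\<Sum>i<m. p i * A i j))"
  unfolding payoff_def by (subst sum.swap) (simp add: sum_distrib_left mult_ac)

lemma payoff_minus: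
  assumes "mixed_strategy m p" "mixed_strategy m q"
  shows "payoff m (\<lambda>i j. A i j - v) p q = payoff m A p q - v"
proof -
  have "payoff m (\<lambda>i j. A i j - v) p q = payoff m A p q - (\<Sum>i<m. p i * (\<Sum>j<m. q j)) * v"
    by (simp add: payoff_def right_diff_distrib sum_subtractf sum_distrib_left sum_distrib_right mult_ac)
  then show ?thesis using assms by (simp add: mixed_strategy_def)
qed

definition pair_strategy :: "nat \<Rightarrow> nat \<Rightarrow> real \<Rightarrow> nat \<Rightarrow> real" where
  "pair_strategy i i' s = (\<lambda>k. (1-s) * of_bool (k = i) + s * of_bool (k = i'))"

lemma sum_pair_strategy:
  assumes "i < m" "i' < m"
  shows "(\<Sum>k<m. pair_strategy i i' s k * f k) = (1-s) * f i + s * f i'"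
proof -
  have "pair_strategy i i' s k * f k = (if k = i then (1-s) * f k else 0) + (if k = i' then s * f k else 0)" for k
    by (simp add: pair_strategy_def algebra_simps)
  then show ?thesis using assms by (simp add: sum.distrib)
qed

lemma mixed_pair_strategy:
  assumes "i < m" "i' < m" "0 \<le> s" "s \<le> 1"
  shows "mixed_strategy m (pair_strategy i i' s)"
  using sum_pair_strategy[OF assms(1,2), of s "\<lambda>_. 1"] assms by (auto simp: mixed_strategy_def pair_strategy_def)

text \<open>By bilinearity \<open>dominating_pair\<close> applies twice: for fixed \<open>q\<close>
  it leaves a mixture of two rows, and for this mixture it leaves two columns. Domination therefore
  needs only the fourfold choice of indices of a block.\<close>

lemma dominated_iff:
  "(\<exists>p q. mixed_strategy m p \<and> mixed_strategy m q \<and> v < payoff m A p q \<and> w < payoff m B p q) \<longleftrightarrow>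
   (\<exists>i<m. \<exists>i'<m. \<exists>j<m. \<exists>j'<m. block_pos (sub_block A v i i' j j') (sub_block B w i i' j j'))"
    (is "?L \<longleftrightarrow> ?R")
proof
  assume ?L
  then obtain p q where pq: "mixed_strategy m p" "mixed_strategy m q" "v < payoff m A p q" "w < payoff m B p q"
    by blast
  let ?A = "\<lambda>i j. A i j - v" and ?B = "\<lambda>i j. B i j - w"
  have "0 < (\<Sum>i<m. p i * (\<Sum>j<m. q j * ?A i j))" "0 < (\<Sum>i<m. p i * (\<Sum>j<m. q j * ?B i j))"
    using pq payoff_minus[OF pq(1,2)] by (simp_all add: payoff_row[symmetric])
  with dominating_pair[of "{..<m}" p "\<lambda>i. \<Sum>j<m. q j * ?A i j" "\<lambda>i. \<Sum>j<m. q j * ?B i j"]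
  obtain i i' where i: "i < m" "i' < m" "seg_pos (\<Sum>j<m. q j * ?A i j) (\<Sum>j<m. q j * ?A i' j)
      (\<Sum>j<m. q j * ?B i j) (\<Sum>j<m. q j * ?B i' j)"
    using pq by (auto simp: mixed_strategy_def)
  then obtain s where s: "0 \<le> s" "s \<le> 1"
      "0 < (1-s) * (\<Sum>j<m. q j * ?A i j) + s * (\<Sum>j<m. q j * ?A i' j)"
      "0 < (1-s) * (\<Sum>j<m. q j * ?B i j) + s * (\<Sum>j<m. q j * ?B i' j)"
    unfolding seg_pos_iff by blast
  then have "0 < (\<Sum>j<m. q j * ((1-s) * ?A i j + s * ?A i' j))" "0 < (\<Sum>j<m. q j * ((1-s) * ?B i j + s * ?B i' j))"
    unfolding distrib_left sum.distrib sum_distrib_left by (simp_all only: mult.left_commute)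
  with dominating_pair[of "{..<m}" q "\<lambda>j. (1-s) * ?A i j + s * ?A i' j" "\<lambda>j. (1-s) * ?B i j + s * ?B i' j"]
  obtain j j' where j: "j < m" "j' < m" "seg_pos ((1-s) * ?A i j + s * ?A i' j) ((1-s) * ?A i j' + s * ?A i' j')
      ((1-s) * ?B i j + s * ?B i' j) ((1-s) * ?B i j' + s * ?B i' j')"
    using pq by (auto simp: mixed_strategy_def)
  have "block_pos (sub_block A v i i' j j') (sub_block B w i i' j j')"
    unfolding block_pos_iff bilin_def sub_block_def using j(3) s(1,2) unfolding seg_pos_iff by auto
  then show ?R using i j by blast
next
  assume ?R
  then obtain i i' j j' where ij: "i < m" "i' < m" "j < m" "j' < m"
    and "block_pos (sub_block A v i i' j j') (sub_block B w i i' j j')" by blast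
  then obtain s t where st: "0 \<le> s" "s \<le> 1" "0 \<le> t" "t \<le> 1"
      "0 < bilin (sub_block A v i i' j j') s t" "0 < bilin (sub_block B w i i' j j') s t"
    unfolding block_pos_iff by blast
  have mp: "mixed_strategy m (pair_strategy i i' s)" "mixed_strategy m (pair_strategy j j' t)"
    using ij st by (auto intro: mixed_pair_strategy)
  have eq: "bilin (sub_block A v i i' j j') s t = payoff m A (pair_strategy i i' s) (pair_strategy j j' t) - v" for A v
    unfolding payoff_minus[OF mp, symmetric]
    unfolding payoff_col sum_pair_strategy[OF ij(1,2)] sum_pair_strategy[OF ij(3,4)] bilin_def sub_block_def
    by simp
  have "v < payoff m A (pair_strategy i i' s) (pair_strategy j j' t)"
    "w < payoff m B (pair_strategy i i' s) (pair_strategy j j' t)"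
    using st(5,6) unfolding eq by auto
  with mp show ?L by blast
qed

section \<open>Strong equilibria in terms of payoffs\<close>

lemma expected_utility_payoff: "expected_utility m U k x = payoff m (U k) (x 1) (x 2)"
  by (simp add: expected_utility_def payoff_def)

lemma sum_le_max:
  assumes "mixed_strategy m p" "\<And>i. i < m \<Longrightarrow> f i \<le> v"
  shows "(\<Sum>i<m. p i * f i) \<le> v"
proof -
  have "(\<Sum>i<m. p i * f i) \<le> (\<Sum>i<m. p i * v)"
    using assms by (intro sum_mono mult_left_mono) (auto simp: mixed_strategy_def)
  then show ?thesis using assms by (simp add: sum_distrib_right[symmetric] mixed_strategy_def)
qed

definition undominated :: "nat \<Rightarrow> game \<Rightarrow> real \<Rightarrow> real \<Rightarrow> bool" where
  "undominated m U v w \<longleftrightarrow> \<not> (\<exists>p q. mixed_strategy m p \<and> mixed_strategy m q \<and>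
     v < payoff m (U 1) p q \<and> w < payoff m (U 2) p q)"

lemma subset_12: "C \<subseteq> {1, 2::nat} \<and> C \<noteq> {} \<longleftrightarrow> C = {1} \<or> C = {2} \<or> C = {1,2}"
  by auto

text \<open>There are only three coalitions. For a single agent pure deviations suffice, because the
  payoff of a mixed deviation is an average of pure ones; the coalition of both agents yields
  \<open>undominated\<close>.\<close>

lemma strong_Nash_iff:
  "strong_Nash m U x \<longleftrightarrow> mixed_strategy m (x 1) \<and> mixed_strategy m (x 2) \<and>
     (\<forall>i<m. (\<Sum>j<m. x 2 j * U 1 i j) \<le> payoff m (U 1) (x 1) (x 2)) \<and>
     (\<forall>j<m. (\<Sum>i<m. x 1 i * U 2 i j) \<le> payoff m (U 2) (x 1) (x 2)) \<and>
     undominated m U (payoff m (U 1) (x 1) (x 2)) (payoff m (U 2) (x 1) (x 2))"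
proof -
  define dev where "dev C \<longleftrightarrow> (\<exists>y. (\<forall>k\<in>C. mixed_strategy m (y k)) \<and>
      (\<forall>k\<in>C. expected_utility m U k (\<lambda>l. if l \<in> C then y l else x l) > expected_utility m U k x))" for C
  have A: "strong_Nash m U x \<longleftrightarrow> mixed_strategy m (x 1) \<and> mixed_strategy m (x 2) \<and>
      \<not> dev {1} \<and> \<not> dev {2} \<and> \<not> dev {1,2}"
  proof -
    have "(\<forall>C. C \<subseteq> {1, 2} \<and> C \<noteq> {} \<longrightarrow> \<not> dev C) \<longleftrightarrow> \<not> dev {1} \<and> \<not> dev {2} \<and> \<not> dev {1,2}"
      unfolding subset_12 by auto
    moreover have "strong_Nash m U x \<longleftrightarrow> (\<forall>k\<in>{1, 2}. mixed_strategy m (x k)) \<and>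
        (\<forall>C. C \<subseteq> {1, 2} \<and> C \<noteq> {} \<longrightarrow> \<not> dev C)"
      unfolding strong_Nash_def dev_def by (simp only: imp_conjL)
    ultimately show ?thesis by simp
  qed
  have ex1: "dev {1} \<longleftrightarrow> (\<exists>p. mixed_strategy m p \<and> payoff m (U 1) (x 1) (x 2) < payoff m (U 1) p (x 2))" (is "_ \<longleftrightarrow> ?R")
  proof
    assume ?R
    then obtain p where p: "mixed_strategy m p" "payoff m (U 1) (x 1) (x 2) < payoff m (U 1) p (x 2)" by blast
    then show "dev {1}" unfolding dev_def expected_utility_payoff by (intro exI[of _ "\<lambda>_. p"]) simp
  qed (auto simp: dev_def expected_utility_payoff)
  have ex2: "dev {2} \<longleftrightarrow> (\<exists>q. mixed_strategy m q \<and> payoff m (U 2) (x 1) (x 2) < payoff m (U 2) (x 1) q)" (is "_ \<longleftrightarrow> ?R")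
  proof
    assume ?R
    then obtain q where q: "mixed_strategy m q" "payoff m (U 2) (x 1) (x 2) < payoff m (U 2) (x 1) q" by blast
    then show "dev {2}" unfolding dev_def expected_utility_payoff by (intro exI[of _ "\<lambda>_. q"]) simp
  qed (auto simp: dev_def expected_utility_payoff)
  have ex3: "dev {1,2} \<longleftrightarrow> \<not> undominated m U (payoff m (U 1) (x 1) (x 2)) (payoff m (U 2) (x 1) (x 2))" (is "_ \<longleftrightarrow> ?R")
  proof
    assume ?R
    then obtain p q where "mixed_strategy m p" "mixed_strategy m q"
      "payoff m (U 1) (x 1) (x 2) < payoff m (U 1) p q" "payoff m (U 2) (x 1) (x 2) < payoff m (U 2) p q"
      unfolding undominated_def by blast
    then show "dev {1,2}" unfolding dev_def expected_utility_payoff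
      by (intro exI[of _ "\<lambda>k. if k = 1 then p else q"]) simp
  next
    assume "dev {1,2}"
    then obtain y :: profile where "mixed_strategy m (y 1)" "mixed_strategy m (y 2)"
      "payoff m (U 1) (x 1) (x 2) < payoff m (U 1) (y 1) (y 2)" "payoff m (U 2) (x 1) (x 2) < payoff m (U 2) (y 1) (y 2)"
      unfolding dev_def expected_utility_payoff by auto
    then show ?R unfolding undominated_def by blast
  qed
  have "strong_Nash m U x \<longleftrightarrow> mixed_strategy m (x 1) \<and> mixed_strategy m (x 2) \<and>
     \<not> (\<exists>p. mixed_strategy m p \<and> payoff m (U 1) (x 1) (x 2) < payoff m (U 1) p (x 2)) \<and>
     \<not> (\<exists>q. mixed_strategy m q \<and> payoff m (U 2) (x 1) (x 2) < payoff m (U 2) (x 1) q) \<and>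
     undominated m U (payoff m (U 1) (x 1) (x 2)) (payoff m (U 2) (x 1) (x 2))"
    unfolding A ex1 ex2 ex3 by simp
  also have "\<not> (\<exists>p. mixed_strategy m p \<and> v < payoff m (U 1) p (x 2)) \<longleftrightarrow>
      (\<forall>i<m. (\<Sum>j<m. x 2 j * U 1 i j) \<le> v)" for v
  proof (intro iffI allI impI notI)
    fix i assume n: "\<not> (\<exists>p. mixed_strategy m p \<and> v < payoff m (U 1) p (x 2))" and i: "i < m"
    have "mixed_strategy m (pair_strategy i i 0)" using i by (intro mixed_pair_strategy) auto
    with n have "payoff m (U 1) (pair_strategy i i 0) (x 2) \<le> v" by (meson not_less)
    then show "(\<Sum>j<m. x 2 j * U 1 i j) \<le> v" using i by (simp add: payoff_row sum_pair_strategy)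
  next
    assume *: "\<forall>i<m. (\<Sum>j<m. x 2 j * U 1 i j) \<le> v" and "\<exists>p. mixed_strategy m p \<and> v < payoff m (U 1) p (x 2)"
    then obtain p where p: "mixed_strategy m p" "v < payoff m (U 1) p (x 2)" by blast
    have "payoff m (U 1) p (x 2) \<le> v" unfolding payoff_row
      by (rule sum_le_max[OF p(1)]) (use * in auto)
    then show False using p by simp
  qed
  also have "\<not> (\<exists>q. mixed_strategy m q \<and> v < payoff m (U 2) (x 1) q) \<longleftrightarrow>
      (\<forall>j<m. (\<Sum>i<m. x 1 i * U 2 i j) \<le> v)" for v
  proof (intro iffI allI impI notI)
    fix i assume n: "\<not> (\<exists>q. mixed_strategy m q \<and> v < payoff m (U 2) (x 1) q)" and i: "i < m"
    have "mixed_strategy m (pair_strategy i i 0)" using i by (intro mixed_pair_strategy) auto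
    with n have "payoff m (U 2) (x 1) (pair_strategy i i 0) \<le> v" by (meson not_less)
    then show "(\<Sum>j<m. x 1 j * U 2 j i) \<le> v" using i by (simp add: payoff_col sum_pair_strategy)
  next
    assume *: "\<forall>j<m. (\<Sum>i<m. x 1 i * U 2 i j) \<le> v" and "\<exists>p. mixed_strategy m p \<and> v < payoff m (U 2) (x 1) p"
    then obtain p where p: "mixed_strategy m p" "v < payoff m (U 2) (x 1) p" by blast
    have "payoff m (U 2) (x 1) p \<le> v" unfolding payoff_col
      by (rule sum_le_max[OF p(1)]) (use * in auto)
    then show False using p by simp
  qed
  finally show ?thesis .
qed

section \<open>Nondegenerate games\<close>

definition degenerate_at :: "(nat \<Rightarrow> nat \<Rightarrow> real) \<Rightarrow> (nat \<Rightarrow> nat \<Rightarrow> real) \<Rightarrow> nat \<Rightarrow> nat \<Rightarrow> nat \<Rightarrow> nat \<Rightarrow> bool" where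
  "degenerate_at A B i i' j j' \<longleftrightarrow>
     (i \<noteq> i' \<and> (A i j = A i' j \<or> B i j = B i' j)) \<or>
     (j \<noteq> j' \<and> (A i j = A i j' \<or> B i j = B i j')) \<or>
     (i \<noteq> i' \<and> j \<noteq> j' \<and>
        (A i' j - A i j) * (B i j' - B i j) = (A i j' - A i j) * (B i' j - B i j))"

definition degenerate :: "nat \<Rightarrow> game \<Rightarrow> bool" where
  "degenerate m U \<longleftrightarrow> (\<exists>i<m. \<exists>i'<m. \<exists>j<m. \<exists>j'<m. degenerate_at (U 1) (U 2) i i' j j')"

lemma eventually_pos_at_right:
  fixes h :: "real \<Rightarrow> real"
  assumes "isCont h 0" "0 < h 0"
  shows "\<forall>\<^sub>F e in at_right 0. 0 < h e"
proof -
  have "(h \<longlongrightarrow> h 0) (at_right 0)"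
    using assms(1) unfolding isCont_def by (rule filterlim_at_split[THEN iffD1, THEN conjunct2])
  then show ?thesis using assms(2) by (rule order_tendstoD)
qed

text \<open>First- and second-order analysis of a joint deviation: \<open>s\<close> is the displacement of the first
  agent, \<open>c\<close> and \<open>c'\<close> those of the second one in two directions, and the two expressions are the
  gains of the agents.\<close>

lemma no_small_joint_gain:
  fixes a :: real
  assumes eps: "0 < eps"
    and no: "\<And>s c c'. \<bar>s\<bar> \<le> eps \<Longrightarrow> \<bar>c\<bar> \<le> eps \<Longrightarrow> \<bar>c'\<bar> \<le> eps \<Longrightarrow>
      \<not> (0 < (1-s) * (c*a + c'*a') + s * (c*x + c'*x') \<and> 0 < s * ((1-c-c')*b + c*y + c'*y'))"
  shows "a \<noteq> 0 \<Longrightarrow> b = 0" "a \<noteq> 0 \<Longrightarrow> b = 0 \<Longrightarrow> y = 0" "a = 0 \<Longrightarrow> b \<noteq> 0 \<Longrightarrow> x = 0"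
    "a = 0 \<Longrightarrow> a' = 0 \<Longrightarrow> b = 0 \<Longrightarrow> x * y' = x' * y"
proof -
  have small: "\<forall>\<^sub>F e in at_right 0. \<bar>e * k\<bar> \<le> eps" for k
  proof -
    have "\<forall>\<^sub>F e in at_right 0. 0 < eps - \<bar>e * k\<bar>"
      using eps by (intro eventually_pos_at_right continuous_intros) auto
    then show ?thesis by eventually_elim auto
  qed
  have pos: "\<forall>\<^sub>F e in at_right (0::real). 0 < e" by (simp add: eventually_at_right_less)
  have key: "\<not> (\<forall>\<^sub>F e in at_right (0::real).
     0 < (1-e * s) * (e*c*a + e*c'*a') + e * s * (e*c*x + e*c'*x') \<and> 0 < e * s * ((1-e*c-e*c')*b + e*c*y + e*c'*y'))"
     for s c c'
  proof
    assume "\<forall>\<^sub>F e in at_right (0::real).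
     0 < (1-e * s) * (e*c*a + e*c'*a') + e * s * (e*c*x + e*c'*x') \<and> 0 < e * s * ((1-e*c-e*c')*b + e*c*y + e*c'*y')"
    then have "\<forall>\<^sub>F e in at_right (0::real). False"
      using small[of s] small[of c] small[of c'] by eventually_elim (use no in blast)
    then show False by simp
  qed
  show b0: "b = 0" if "a \<noteq> 0"
  proof (rule ccontr)
    assume "b \<noteq> 0"
    \<comment> \<open>With \<open>s = e*b\<close> and \<open>c = e*a\<close> the first-order terms
      of the two gains are \<open>e*a^2\<close> and \<open>e*b^2\<close>, both positive.\<close>
    have "\<forall>\<^sub>F e in at_right 0. 0 < (1-e*b)*a^2 + e*b*a*x" "\<forall>\<^sub>F e in at_right 0. 0 < (1-e*a)*b^2 + e*a*b*y"
      using \<open>a \<noteq> 0\<close> \<open>b \<noteq> 0\<close> by (auto intro!: eventually_pos_at_right continuous_intros)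
    with pos have "\<forall>\<^sub>F e in at_right (0::real).
     0 < (1-e*b) * (e*a*a + e*0*a') + e*b * (e*a*x + e*0*x') \<and> 0 < e*b * ((1-e*a-e*0)*b + e*a*y + e*0*y')"
    proof eventually_elim
      case (elim e)
      then have "0 < e * ((1-e*b)*a^2 + e*b*a*x)" "0 < e * ((1-e*a)*b^2 + e*a*b*y)" by simp_all
      then show ?case by (simp add: algebra_simps power2_eq_square)
    qed
    then show False using key by blast
  qed
  show "y = 0" if "a \<noteq> 0" "b = 0"
  proof (rule ccontr)
    assume "y \<noteq> 0"
    \<comment> \<open>For \<open>b = 0\<close> the second gain is the product \<open>s*c*y\<close>;
      choosing \<open>s = e*a*y\<close> and \<open>c = e*a\<close> turns it into a square while the
      first gain keeps the leading term \<open>e*a^2\<close>.\<close>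
    have "\<forall>\<^sub>F e in at_right 0. 0 < (1-e*(a*y))*a^2 + e*a*y*a*x"
      using \<open>a \<noteq> 0\<close> by (intro eventually_pos_at_right continuous_intros) auto
    with pos have "\<forall>\<^sub>F e in at_right (0::real).
     0 < (1-e*(a*y)) * (e*a*a + e*0*a') + e*(a*y) * (e*a*x + e*0*x') \<and> 0 < e*(a*y) * ((1-e*a-e*0)*b + e*a*y + e*0*y')"
    proof eventually_elim
      case (elim e)
      then have "0 < e * ((1-e*(a*y))*a^2 + e*a*y*a*x)" "0 < e^2 * (a^2 * y^2)"
        using \<open>y \<noteq> 0\<close> \<open>a \<noteq> 0\<close> by simp_all
      then show ?case by (simp add: algebra_simps power2_eq_square \<open>b = 0\<close>)
    qed
    then show False using key by blast
  qed
  show "x = 0" if "a = 0" "b \<noteq> 0"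
  proof (rule ccontr)
    assume "x \<noteq> 0"
    have "\<forall>\<^sub>F e in at_right 0. 0 < (1-e*(b*x))*b^2 + e*b*x*b*y"
      using \<open>b \<noteq> 0\<close> by (intro eventually_pos_at_right continuous_intros) auto
    with pos have "\<forall>\<^sub>F e in at_right (0::real).
     0 < (1-e*b) * (e*(b*x)*a + e*0*a') + e*b * (e*(b*x)*x + e*0*x') \<and> 0 < e*b * ((1-e*(b*x)-e*0)*b + e*(b*x)*y + e*0*y')"
    proof eventually_elim
      case (elim e)
      then have "0 < e * ((1-e*(b*x))*b^2 + e*b*x*b*y)" "0 < e^2 * (b^2 * x^2)"
        using \<open>x \<noteq> 0\<close> \<open>b \<noteq> 0\<close> by simp_all
      then show ?case by (simp add: algebra_simps power2_eq_square \<open>a = 0\<close>)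
    qed
    then show False using key by blast
  qed
  show "x * y' = x' * y" if "a = 0" "a' = 0" "b = 0"
  proof (rule ccontr)
    assume d: "x * y' \<noteq> x' * y"
    \<comment> \<open>All first-order terms vanish, leaving two linear forms in \<open>c\<close>,
      \<open>c'\<close> times \<open>s\<close>. If they are independent, Cramer's rule makes both
      equal to 1.\<close>
    define c where "c = (y' - x') / (x * y' - x' * y)"
    define c' where "c' = (x - y) / (x * y' - x' * y)"
    have "c * x + c' * x' = 1" "c * y + c' * y' = 1"
      using d by (simp_all add: c_def c'_def add_divide_distrib[symmetric] divide_simps) (simp_all add: algebra_simps)
    then have eqs: "e * c * x + e * c' * x' = e" "e * c * y + e * c' * y' = e" for e
      by (simp_all add: mult.assoc distrib_left[symmetric])
    have "\<forall>\<^sub>F e in at_right (0::real).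
     0 < (1-e*1) * (e*c*a + e*c'*a') + e*1 * (e*c*x + e*c'*x') \<and> 0 < e*1 * ((1-e*c-e*c')*b + e*c*y + e*c'*y')"
      using pos by eventually_elim (simp add: that eqs)
    then show False using key by blast
  qed
qed

section \<open>Variations inside the supports\<close>

definition perturb :: "(nat \<Rightarrow> real) \<Rightarrow> nat \<Rightarrow> nat \<Rightarrow> real \<Rightarrow> real \<Rightarrow> nat \<Rightarrow> real" where
  "perturb p i i' c c' = (\<lambda>k. (1-c-c') * p k + c * of_bool (k = i) + c' * of_bool (k = i'))"

lemma sum_perturb:
  assumes "i < m" "i' < m"
  shows "(\<Sum>k<m. perturb p i i' c c' k * f k) = (1-c-c') * (\<Sum>k<m. p k * f k) + c * f i + c' * f i'"
proof -
  have "perturb p i i' c c' k * f k = (1-c-c') * (p k * f k) + (if k = i then c * f k else 0) + (if k = i' then c' * f k else 0)" for k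
    by (simp add: perturb_def algebra_simps)
  then show ?thesis using assms by (simp add: sum.distrib sum_distrib_left)
qed

text \<open>The total weight is preserved for \<open>c\<close> and \<open>c'\<close> of either sign.
  The factor \<open>1-c-c'\<close> keeps at least half of each weight, and each of the two added
  terms removes at most a quarter of it.\<close>

lemma mixed_perturb:
  assumes p: "mixed_strategy m p" and i: "i < m" "i' < m"
    and c: "\<bar>c\<bar> \<le> e" "\<bar>c'\<bar> \<le> e" "e \<le> p i / 4" "e \<le> p i' / 4" "e \<le> 1/4"
  shows "mixed_strategy m (perturb p i i' c c')"
  unfolding mixed_strategy_def
proof (intro conjI allI impI)
  show "(\<Sum>k<m. perturb p i i' c c' k) = 1"
    using sum_perturb[OF i, of p c c' "\<lambda>_. 1"] p by (simp add: mixed_strategy_def)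
next
  fix k assume k: "k < m"
  have "1/2 * p k \<le> (1-c-c') * p k" using c p k by (intro mult_right_mono) (auto simp: mixed_strategy_def)
  moreover have "- (1/4 * p k) \<le> c * of_bool (k = i)" "- (1/4 * p k) \<le> c' * of_bool (k = i')"
    using c p k by (auto simp: mixed_strategy_def)
  ultimately show "0 \<le> perturb p i i' c c' k" unfolding perturb_def by linarith
qed

definition equilibrium :: "nat \<Rightarrow> (nat \<Rightarrow> nat \<Rightarrow> real) \<Rightarrow> (nat \<Rightarrow> nat \<Rightarrow> real) \<Rightarrow> (nat \<Rightarrow> real) \<Rightarrow> (nat \<Rightarrow> real) \<Rightarrow> bool" where
  "equilibrium m A B p q \<longleftrightarrow> mixed_strategy m p \<and> mixed_strategy m q \<and>
     (\<forall>i<m. (\<Sum>j<m. q j * A i j) \<le> payoff m A p q) \<and> (\<forall>j<m. (\<Sum>i<m. p i * B i j) \<le> payoff m B p q) \<and>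
     \<not> (\<exists>p' q'. mixed_strategy m p' \<and> mixed_strategy m q' \<and>
          payoff m A p q < payoff m A p' q' \<and> payoff m B p q < payoff m B p' q')"

lemma strong_Nash_equilibrium: "strong_Nash m U x \<longleftrightarrow> equilibrium m (U 1) (U 2) (x 1) (x 2)"
  unfolding strong_Nash_iff equilibrium_def undominated_def by simp

lemma payoff_transpose: "payoff m (\<lambda>i j. A j i) q p = payoff m A p q"
  unfolding payoff_def by (subst sum.swap) (simp add: mult_ac)

lemma equilibrium_transpose: "equilibrium m A B p q \<Longrightarrow> equilibrium m (\<lambda>i j. B j i) (\<lambda>i j. A j i) q p"
  unfolding equilibrium_def payoff_transpose[where A = A] payoff_transpose[where A = B] by blast

lemma support_value:
  assumes p: "mixed_strategy m p" and f: "\<And>i. i < m \<Longrightarrow> f i \<le> v" and v: "(\<Sum>i<m. p i * f i) = v"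
    and i: "i < m" "0 < p i"
  shows "f i = v"
proof -
  have "(\<Sum>i<m. p i * (v - f i)) = v * (\<Sum>i<m. p i) - (\<Sum>i<m. p i * f i)"
    by (simp add: right_diff_distrib sum_subtractf sum_distrib_left mult_ac)
  also have "\<dots> = 0" using p v by (simp add: mixed_strategy_def)
  finally have "\<forall>i\<in>{..<m}. p i * (v - f i) = 0"
    using p f by (subst (asm) sum_nonneg_eq_0_iff) (auto simp: mixed_strategy_def)
  then show ?thesis using i by force
qed

lemma equilibrium_values:
  assumes "equilibrium m A B p q"
  shows "i < m \<Longrightarrow> 0 < p i \<Longrightarrow> (\<Sum>j<m. q j * A i j) = payoff m A p q"
    "j < m \<Longrightarrow> 0 < q j \<Longrightarrow> (\<Sum>i<m. p i * B i j) = payoff m B p q"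
proof -
  have eq: "mixed_strategy m p" "mixed_strategy m q" "\<And>i. i < m \<Longrightarrow> (\<Sum>j<m. q j * A i j) \<le> payoff m A p q"
    "\<And>j. j < m \<Longrightarrow> (\<Sum>i<m. p i * B i j) \<le> payoff m B p q"
    using assms by (simp_all add: equilibrium_def)
  show "i < m \<Longrightarrow> 0 < p i \<Longrightarrow> (\<Sum>j<m. q j * A i j) = payoff m A p q"
    using support_value[OF eq(1,3) payoff_row[symmetric]] .
  show "j < m \<Longrightarrow> 0 < q j \<Longrightarrow> (\<Sum>i<m. p i * B i j) = payoff m B p q"
    using support_value[OF eq(2,4) payoff_col[symmetric]] .
qed

text \<open>Each agent is indifferent among the actions of its own support, so to first order a
  shift inside the support affects only the other agent: \<open>a j\<close> is the effect on agent 1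
  of a shift towards \<open>j\<close>, and \<open>b\<close> the effect on agent 2 of a shift towards
  \<open>i\<close>. The expansions of both payoffs have exactly the form treated in
  \<open>no_small_joint_gain\<close>, and undomination forbids a joint gain.\<close>

lemma equilibrium_local:
  assumes eq: "equilibrium m A B p q"
    and i: "i < m" "0 < p i" and j: "j < m" "0 < q j" "j' < m" "0 < q j'"
  defines "v \<equiv> payoff m A p q" and "w \<equiv> payoff m B p q"
  defines "a \<equiv> \<lambda>j. (\<Sum>i<m. p i * A i j) - v" and "b \<equiv> (\<Sum>j<m. q j * B i j) - w"
  shows "a j \<noteq> 0 \<Longrightarrow> b = 0" "a j \<noteq> 0 \<Longrightarrow> B i j = w" "a j = 0 \<Longrightarrow> b \<noteq> 0 \<Longrightarrow> A i j = v"
    "a j = 0 \<Longrightarrow> a j' = 0 \<Longrightarrow> b = 0 \<Longrightarrow> (A i j - v) * (B i j' - w) = (A i j' - v) * (B i j - w)"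
proof -
  have mixed: "mixed_strategy m p" "mixed_strategy m q" using eq by (auto simp: equilibrium_def)
  define e where "e = min (min (p i) (1::real)) (min (q j) (q j')) / 4"
  have e: "0 < e" "e \<le> p i / 4" "e \<le> q j / 4" "e \<le> q j' / 4" "e \<le> 1/4" using i j by (auto simp: e_def)
  have A: "payoff m A (perturb p i i s 0) (perturb q j j' c c') - v =
      (1-s) * (c * a j + c' * a j') + s * (c * (A i j - v) + c' * (A i j' - v))" for s c c'
  proof -
    have "payoff m A (perturb p i i s 0) (perturb q j j' c c') =
       (\<Sum>k<m. perturb p i i s 0 k * ((1-c-c') * (\<Sum>l<m. q l * A k l) + c * A k j + c' * A k j'))"
      unfolding payoff_row by (simp add: sum_perturb[OF j(1,3)])
    also have "\<dots> = (1-s) * ((1-c-c') * v + c * (a j + v) + c' * (a j' + v)) + s * ((1-c-c') * v + c * A i j + c' * A i j')"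
      unfolding sum_perturb[OF i(1) i(1)] equilibrium_values(1)[OF eq i]
      by (simp add: distrib_left sum.distrib a_def v_def payoff_row sum_distrib_left mult_ac)
    finally show ?thesis by (simp add: algebra_simps)
  qed
  have B: "payoff m B (perturb p i i s 0) (perturb q j j' c c') - w =
      s * ((1-c-c') * b + c * (B i j - w) + c' * (B i j' - w))" for s c c'
  proof -
    have "payoff m B (perturb p i i s 0) (perturb q j j' c c') =
       (\<Sum>k<m. perturb p i i s 0 k * ((1-c-c') * (\<Sum>l<m. q l * B k l) + c * B k j + c' * B k j'))"
      unfolding payoff_row by (simp add: sum_perturb[OF j(1,3)])
    also have "\<dots> = (1-s) * ((1-c-c') * w + c * (\<Sum>i<m. p i * B i j) + c' * (\<Sum>i<m. p i * B i j')) + s * ((1-c-c') * (b + w) + c * B i j + c' * B i j')"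
      unfolding sum_perturb[OF i(1) i(1)]
      by (simp add: distrib_left sum.distrib b_def w_def payoff_row sum_distrib_left mult_ac)
    finally show ?thesis
      unfolding equilibrium_values(2)[OF eq j(1,2)] equilibrium_values(2)[OF eq j(3,4)] w_def[symmetric]
      by (simp add: algebra_simps)
  qed
  have no: "\<not> (0 < (1-s) * (c*a j + c'*a j') + s * (c*(A i j - v) + c'*(A i j' - v)) \<and>
      0 < s * ((1-c-c')*b + c*(B i j - w) + c'*(B i j' - w)))"
    if "\<bar>s\<bar> \<le> e" "\<bar>c\<bar> \<le> e" "\<bar>c'\<bar> \<le> e" for s c c'
  proof -
    have "mixed_strategy m (perturb p i i s 0)" "mixed_strategy m (perturb q j j' c c')"
      using that e i j mixed by (auto intro!: mixed_perturb[of _ _ _ _ _ e])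
    then have "\<not> (v < payoff m A (perturb p i i s 0) (perturb q j j' c c') \<and>
       w < payoff m B (perturb p i i s 0) (perturb q j j' c c'))"
      using eq unfolding equilibrium_def v_def w_def by blast
    then show ?thesis unfolding A[symmetric] B[symmetric] by simp
  qed
  note gain = no_small_joint_gain[OF e(1) no]
  from gain(1) show "a j \<noteq> 0 \<Longrightarrow> b = 0" .
  from gain(1,2) show "a j \<noteq> 0 \<Longrightarrow> B i j = w" by simp
  from gain(3) show "a j = 0 \<Longrightarrow> b \<noteq> 0 \<Longrightarrow> A i j = v" by simp
  from gain(4) show "a j = 0 \<Longrightarrow> a j' = 0 \<Longrightarrow> b = 0 \<Longrightarrow> (A i j - v) * (B i j' - w) = (A i j' - v) * (B i j - w)" .
qed

text \<open>With payoffs measured from the equilibrium values, the first two assumptions put both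
  neighbours of the corner on the line through the origin and that corner; a line is determined
  because the corner is not the origin.\<close>

lemma collinear_corner:
  fixes x y :: "'i \<Rightarrow> 'j \<Rightarrow> real"
  assumes "x i j * y i j' = x i j' * y i j" "x i j * y i' j = x i' j * y i j" "(x i j, y i j) \<noteq> (0, 0)"
  shows "(x i' j - x i j) * (y i j' - y i j) = (x i j' - x i j) * (y i' j - y i j)"
proof (cases "x i j = 0")
  case True
  then have "x i j' = 0" "x i' j = 0" using assms by auto
  then show ?thesis using True by simp
next
  case False
  define t where "t = y i j / x i j"
  have "y i j = t * x i j" using False by (simp add: t_def)
  moreover from this have "y i j' = t * x i j'" "y i' j = t * x i' j" using False assms(1,2) by simp_all
  ultimately show ?thesis by (simp add: algebra_simps)
qed

text \<open>If some shift has a nonzero first-order effect, \<open>equilibrium_local\<close> fixes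
  the other agent's payoffs in that row or column at the equilibrium value, giving two equal
  entries. If all these effects vanish, its second-order conclusion supplies collinearity in rows
  and columns.\<close>

lemma degenerate_if_large_supports:
  assumes eq: "equilibrium m A B p q"
    and i: "i < m" "0 < p i" "i' < m" "0 < p i'" "i \<noteq> i'"
    and j: "j < m" "0 < q j" "j' < m" "0 < q j'" "j \<noteq> j'"
  shows "\<exists>i<m. \<exists>i'<m. \<exists>j<m. \<exists>j'<m. degenerate_at A B i i' j j'"
proof -
  define v where "v = payoff m A p q"
  define w where "w = payoff m B p q"
  define a where "a = (\<lambda>j. (\<Sum>i<m. p i * A i j) - v)"
  define b where "b = (\<lambda>i. (\<Sum>j<m. q j * B i j) - w)"
  note L = equilibrium_local[OF eq, folded v_def w_def]
  note R = equilibrium_local[OF equilibrium_transpose[OF eq], unfolded payoff_transpose[where A = A] payoff_transpose[where A = B], folded v_def w_def]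
  consider (a) j0 where "j0 < m" "0 < q j0" "a j0 \<noteq> 0" | (b) i0 where "i0 < m" "0 < p i0" "b i0 \<noteq> 0"
    | (z) "a j = 0" "a j' = 0" "b i = 0" "b i' = 0"
    using i j by blast
  then show ?thesis
  proof cases
    case a
    then have "B i j0 = w" "B i' j0 = w" using L(2)[OF i(1,2) a(1,2) a(1,2)] L(2)[OF i(3,4) a(1,2) a(1,2)] a(3)
      by (auto simp: a_def)
    then have "degenerate_at A B i i' j0 j0" using i by (simp add: degenerate_at_def)
    then show ?thesis using i a by blast
  next
    case b
    then have "A i0 j = v" "A i0 j' = v" using R(2)[OF j(1,2) b(1,2) b(1,2)] R(2)[OF j(3,4) b(1,2) b(1,2)] b(3)
      by (auto simp: b_def)
    then have "degenerate_at A B i0 i0 j j'" using j by (simp add: degenerate_at_def)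
    then show ?thesis using j b by blast
  next
    case z
    let ?x = "\<lambda>i j. A i j - v" and ?y = "\<lambda>i j. B i j - w"
    have row: "?x k j * ?y k j' = ?x k j' * ?y k j" if "k = i \<or> k = i'" for k
      using L(4)[of k j j'] i j z that by (auto simp: a_def b_def)
    have col: "?x i j * ?y i' j = ?x i' j * ?y i j" "?x i' j * ?y i j = ?x i j * ?y i' j"
      using R(4)[of j i i'] i j z by (auto simp: a_def b_def mult_ac)
    show ?thesis
    \<comment> \<open>A corner at the origin does not determine a line, so the corner in the other
      row is tried; if that one is at the origin as well, column \<open>j\<close> has two equal
      entries.\<close>
    proof (cases "(?x i j, ?y i j) = (0, 0)")
      case False
      have "degenerate_at A B i i' j j'"
        using collinear_corner[of ?x i j ?y j' i', OF row col(1) False] i j by (simp add: degenerate_at_def)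
      then show ?thesis using i j by blast
    next
      case T: True
      show ?thesis
      proof (cases "(?x i' j, ?y i' j) = (0, 0)")
        case False
        have "degenerate_at A B i' i j j'"
          using collinear_corner[of ?x i' j ?y j' i, OF row col(2) False] i j by (simp add: degenerate_at_def)
        then show ?thesis using i j by blast
      next
        case True
        then have "degenerate_at A B i i' j j'" using T i by (simp add: degenerate_at_def)
        then show ?thesis using i j by blast
      qed
    qed
  qed
qed

lemma mixed_singleton_support:
  assumes "mixed_strategy m p" "\<And>i i'. i < m \<Longrightarrow> i' < m \<Longrightarrow> 0 < p i \<Longrightarrow> 0 < p i' \<Longrightarrow> i = i'"
  obtains i where "i < m" "\<And>k. k < m \<Longrightarrow> p k = of_bool (k = i)"
proof -
  have "\<exists>i<m. 0 < p i"
  proof (rule ccontr)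
    assume "\<not> ?thesis"
    then have "\<forall>i\<in>{..<m}. p i = 0" using assms(1) by (force simp: mixed_strategy_def)
    then show False using assms(1) by (simp add: mixed_strategy_def)
  qed
  then obtain i where i: "i < m" "0 < p i" by blast
  have z: "p k = 0" if "k < m" "k \<noteq> i" for k
    using assms(2)[of k i] i that assms(1) by (force simp: mixed_strategy_def)
  have "(\<Sum>k<m. p k) = p i" using i z by (subst sum.remove[of _ i]) auto
  then have "p i = 1" using assms(1) by (simp add: mixed_strategy_def)
  then show ?thesis using that[of i] i z by force
qed

lemma degenerate_if_mixed_against_pure:
  assumes eq: "equilibrium m A B p q" and i: "i < m" "\<And>k. k < m \<Longrightarrow> p k = of_bool (k = i)"
    and j: "j < m" "0 < q j" "j' < m" "0 < q j'" "j \<noteq> j'"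
  shows "B i j = B i j'"
proof -
  have "(\<Sum>k<m. p k * B k l) = B i l" for l
    using i by (subst sum.remove[of _ i]) auto
  then show ?thesis using equilibrium_values(2)[OF eq j(1,2)] equilibrium_values(2)[OF eq j(3,4)] by simp
qed

text \<open>Two large supports are excluded by \<open>degenerate_if_large_supports\<close>. A large
  support against a pure strategy makes the mixing agent indifferent between two single entries,
  which are then equal.\<close>

lemma equilibrium_pure:
  assumes eq: "equilibrium m A B p q"
    and nd: "\<not> (\<exists>i<m. \<exists>i'<m. \<exists>j<m. \<exists>j'<m. degenerate_at A B i i' j j')"
  obtains i j where "i < m" "j < m" "\<And>k. k < m \<Longrightarrow> p k = of_bool (k = i)" "\<And>k. k < m \<Longrightarrow> q k = of_bool (k = j)"
proof -
  have mixed: "mixed_strategy m p" "mixed_strategy m q" using eq by (auto simp: equilibrium_def)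
  have A1: "i = i'" if "i < m" "0 < p i" "i' < m" "0 < p i'" for i i'
  proof (rule ccontr)
    assume ne: "i \<noteq> i'"
    have "\<And>j j'. j < m \<Longrightarrow> j' < m \<Longrightarrow> 0 < q j \<Longrightarrow> 0 < q j' \<Longrightarrow> j = j'"
      using degenerate_if_large_supports[OF eq that ne] nd by blast
    then obtain j where j: "j < m" "\<And>k. k < m \<Longrightarrow> q k = of_bool (k = j)"
      using mixed_singleton_support[OF mixed(2)] by metis
    have "A i j = A i' j" using degenerate_if_mixed_against_pure[OF equilibrium_transpose[OF eq] j that ne] by simp
    then have "degenerate_at A B i i' j j" using ne by (simp add: degenerate_at_def)
    then show False using nd that j by blast
  qed
  then obtain i where i: "i < m" "\<And>k. k < m \<Longrightarrow> p k = of_bool (k = i)"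
    using mixed_singleton_support[OF mixed(1)] by metis
  have "j = j'" if "j < m" "0 < q j" "j' < m" "0 < q j'" for j j'
  proof (rule ccontr)
    assume ne: "j \<noteq> j'"
    have "B i j = B i j'" using degenerate_if_mixed_against_pure[OF eq i that ne] .
    then have "degenerate_at A B i i j j'" using ne by (simp add: degenerate_at_def)
    then show False using nd that i by blast
  qed
  then obtain j where "j < m" "\<And>k. k < m \<Longrightarrow> q k = of_bool (k = j)"
    using mixed_singleton_support[OF mixed(2)] by metis
  with i that show ?thesis by blast
qed

lemma mixed_strategy_cong: "(\<And>i. i < m \<Longrightarrow> p i = p' i) \<Longrightarrow> mixed_strategy m p \<longleftrightarrow> mixed_strategy m p'"
  by (simp add: mixed_strategy_def)

lemma payoff_cong: "(\<And>i. i < m \<Longrightarrow> p i = p' i) \<Longrightarrow> (\<And>i. i < m \<Longrightarrow> q i = q' i) \<Longrightarrow>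
    (\<And>i j. i < m \<Longrightarrow> j < m \<Longrightarrow> A i j = A' i j) \<Longrightarrow> payoff m A p q = payoff m A' p' q'"
  by (simp add: payoff_def)

lemma equilibrium_cong:
  assumes "\<And>i. i < m \<Longrightarrow> p i = p' i" "\<And>i. i < m \<Longrightarrow> q i = q' i"
    "\<And>i j. i < m \<Longrightarrow> j < m \<Longrightarrow> A i j = A' i j" "\<And>i j. i < m \<Longrightarrow> j < m \<Longrightarrow> B i j = B' i j"
  shows "equilibrium m A B p q \<longleftrightarrow> equilibrium m A' B' p' q'"
proof -
  have "payoff m A x y = payoff m A' x y" "payoff m B x y = payoff m B' x y" for x y
    using assms by (auto intro!: payoff_cong)
  moreover have "payoff m A' p q = payoff m A' p' q'" "payoff m B' p q = payoff m B' p' q'"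
    using assms by (auto intro!: payoff_cong)
  ultimately show ?thesis
    unfolding equilibrium_def using assms mixed_strategy_cong[of m p p'] mixed_strategy_cong[of m q q']
    by simp
qed

section \<open>Fourier-Motzkin elimination\<close>

text \<open>One step is one round of arithmetic on all pairs. Negatives come from subtraction out of
  0, which also lets the levels increase. Division by zero yields 0, exactly as on the machine, so
  no side conditions arise.\<close>

primrec level :: "real set \<Rightarrow> nat \<Rightarrow> real set" where
  "level S 0 = S"
| "level S (Suc k) = (\<Union>a\<in>level S k. \<Union>b\<in>level S k. {a - b, a * b, a / b})"

lemma level_ops:
  assumes "a \<in> level S k" "b \<in> level S k"
  shows "a - b \<in> level S (Suc k)" "a * b \<in> level S (Suc k)" "a / b \<in> level S (Suc k)"
  using assms by auto

lemma zero_level: "0 \<in> S \<Longrightarrow> 0 \<in> level S k"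
  by (induction k) force+

declare level.simps(2) [simp del]

lemma level_mono:
  assumes "0 \<in> S" "k \<le> l" "x \<in> level S k"
  shows "x \<in> level S l"
  using assms(2)
proof (induction l rule: dec_induct)
  case (step l)
  then show ?case using level_ops(1)[OF step.IH zero_level[OF assms(1)]] by simp
qed (use assms in simp)

text \<open>The negated sum is what back substitution needs, and it costs just one subtraction per
  term.\<close>

lemma neg_sum_level:
  assumes "0 \<in> S" "\<And>i. i < n \<Longrightarrow> f i \<in> level S k"
  shows "- (\<Sum>i<n. f i) \<in> level S (k + n)"
  using assms(2)
proof (induction n)
  case 0
  then show ?case using zero_level[OF assms(1)] by simp
next
  case (Suc n)
  have "f n \<in> level S (k + n)" using level_mono[OF assms(1) _ Suc.prems] by simp
  then have "- (\<Sum>i<n. f i) - f n \<in> level S (Suc (k + n))" using level_ops(1) Suc by simp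
  then show ?case by simp
qed

text \<open>Linear systems are homogenised: coordinate 0 is the constant 1, coordinate 1 is the objective.\<close>

definition solution :: "nat \<Rightarrow> (nat \<Rightarrow> real) set \<Rightarrow> (nat \<Rightarrow> real) \<Rightarrow> bool" where
  "solution n C x \<longleftrightarrow> x 0 = 1 \<and> (\<forall>c\<in>C. 0 \<le> (\<Sum>i<n. c i * x i))"

text \<open>A row bounding coordinate \<open>n\<close> from below is combined with one bounding it
  from above; the multipliers \<open>c n\<close> and \<open>- d n\<close> are positive.
  Cross-multiplying avoids division, so new coefficients lie only two levels higher.\<close>

definition eliminate :: "nat \<Rightarrow> (nat \<Rightarrow> real) set \<Rightarrow> (nat \<Rightarrow> real) set" where
  "eliminate n C = {c\<in>C. c n = 0} \<union>
     (\<lambda>(c, d) i. c n * d i - d n * c i) ` ({c\<in>C. 0 < c n} \<times> {d\<in>C. d n < 0})"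

lemma solution_eliminate:
  assumes "solution (Suc n) C x"
  shows "solution n (eliminate n C) x"
  unfolding solution_def eliminate_def
proof (intro conjI ballI)
  show "x 0 = 1" using assms by (simp add: solution_def)
next
  have nn: "0 \<le> (\<Sum>i<n. c i * x i) + c n * x n" if "c \<in> C" for c using assms that by (simp add: solution_def)
  fix e assume "e \<in> {c\<in>C. c n = 0} \<union>
     (\<lambda>(c, d) i. c n * d i - d n * c i) ` ({c\<in>C. 0 < c n} \<times> {d\<in>C. d n < 0})"
  then consider "e \<in> C" "e n = 0" | c d where "c \<in> C" "0 < c n" "d \<in> C" "d n < 0" "e = (\<lambda>i. c n * d i - d n * c i)"
    by auto
  then show "0 \<le> (\<Sum>i<n. e i * x i)"
  proof cases
    case 1
    then show ?thesis using nn[of e] by simp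
  next
    case 2
    have "(\<Sum>i<n. e i * x i) = c n * (\<Sum>i<n. d i * x i) - d n * (\<Sum>i<n. c i * x i)"
      by (simp add: 2 left_diff_distrib sum_subtractf sum_distrib_left mult.assoc)
    also have "\<dots> = c n * ((\<Sum>i<n. d i * x i) + d n * x n) + (- d n) * ((\<Sum>i<n. c i * x i) + c n * x n)"
      by (simp add: algebra_simps)
    also have "\<dots> \<ge> 0"
      by (rule add_nonneg_nonneg; rule mult_nonneg_nonneg) (use 2 nn[of c] nn[of d] in auto)
    finally show ?thesis .
  qed
qed

text \<open>\<open>r\<close> turns rows into lower bounds (\<open>P\<close>) and upper bounds
  (\<open>Q\<close>), and the eliminated system says that no lower bound exceeds an upper one. The
  tightest lower bound is taken, failing that the tightest upper bound, failing that 0; so the value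
  is an explicit expression in the other coordinates.\<close>

lemma solution_extend:
  assumes fin: "finite C" and sol: "solution n (eliminate n C) x" and n: "0 < n"
  obtains t where "solution (Suc n) C (x(n := t))"
    "t = 0 \<or> (\<exists>c\<in>C. c n \<noteq> 0 \<and> t = - (\<Sum>i<n. c i * x i) / c n)"
proof -
  define r where "r c = - (\<Sum>i<n. c i * x i) / c n" for c
  define P where "P = {c\<in>C. 0 < c n}"
  define Q where "Q = {c\<in>C. c n < 0}"
  have PQ: "finite P" "finite Q" using fin by (auto simp: P_def Q_def)
  have le: "r c \<le> r d" if "c \<in> P" "d \<in> Q" for c d
  proof -
    have "(\<lambda>i. c n * d i - d n * c i) \<in> eliminate n C"
      using that by (auto simp: eliminate_def P_def Q_def)
    then have "0 \<le> (\<Sum>i<n. (c n * d i - d n * c i) * x i)" using sol by (auto simp: solution_def)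
    also have "\<dots> = c n * (\<Sum>i<n. d i * x i) - d n * (\<Sum>i<n. c i * x i)"
      by (simp add: left_diff_distrib sum_subtractf sum_distrib_left mult.assoc)
    finally show ?thesis using that by (simp add: r_def P_def Q_def divide_simps) (simp add: mult.commute)
  qed
  have upd: "(\<Sum>i<n. c i * (x(n := t)) i) = (\<Sum>i<n. c i * x i)" for c t
    by (intro sum.cong) auto
  have ok: "solution (Suc n) C (x(n := t))" if t: "\<And>c. c \<in> P \<Longrightarrow> r c \<le> t" "\<And>c. c \<in> Q \<Longrightarrow> t \<le> r c" for t
    unfolding solution_def
  proof (intro conjI ballI)
    show "(x(n := t)) 0 = 1" using sol n by (simp add: solution_def)
  next
    fix c assume c: "c \<in> C"
    consider "c n = 0" | "0 < c n" | "c n < 0" by linarith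
    then have "0 \<le> (\<Sum>i<n. c i * x i) + c n * t"
    proof cases
      case 1
      then show ?thesis using sol c by (simp add: solution_def eliminate_def)
    next
      case 2
      then have "r c \<le> t" using t c by (simp add: P_def)
      then show ?thesis using 2 by (simp add: r_def field_simps)
    next
      case 3
      then have "t \<le> r c" using t c by (simp add: Q_def)
      then show ?thesis using 3 by (simp add: r_def field_simps)
    qed
    then show "0 \<le> (\<Sum>i<Suc n. c i * (x(n := t)) i)" by (simp add: upd del: fun_upd_apply) simp
  qed
  show ?thesis
  proof (cases "P = {}")
    case False
    then have "Max (r ` P) \<in> r ` P" using PQ by simp
    moreover have "solution (Suc n) C (x(n := Max (r ` P)))"
      using False PQ le by (intro ok) auto
    ultimately show ?thesis using that by (force simp: r_def P_def)
  next
    case P: True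
    show ?thesis
    proof (cases "Q = {}")
      case False
      then have "Min (r ` Q) \<in> r ` Q" using PQ by simp
      moreover have "solution (Suc n) C (x(n := Min (r ` Q)))"
        using False P PQ by (intro ok) auto
      ultimately show ?thesis using that by (force simp: r_def Q_def)
    next
      case True
      then show ?thesis using that[of 0] ok[of 0] P by simp
    qed
  qed
qed

text \<open>The objective is eliminated last, so that its optimal value is read off a system in one unknown.\<close>

lemma optimal_solution_level:
  assumes S: "0 \<in> S" "1 \<in> S" and n: "2 \<le> n" and fin: "finite C"
    and coeff: "\<And>c i. c \<in> C \<Longrightarrow> i < n \<Longrightarrow> c i \<in> level S k"
    and sol: "solution n C z" and bdd: "\<And>x. solution n C x \<Longrightarrow> x 1 \<le> M"
  shows "\<exists>y. solution n C y \<and> z 1 \<le> y 1 \<and> (\<forall>i<n. y i \<in> level S (k + n * (n + 2)))"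
  using n fin coeff sol bdd
proof (induction n arbitrary: C k rule: dec_induct)
  case base
  have sum2: "(\<Sum>i<2. c i * x i) = c 0 * x 0 + c 1 * x 1" for c x :: "nat \<Rightarrow> real"
    by (simp add: numeral_2_eq_2)
  define Q where "Q = {c\<in>C. c 1 < 0}"
  have z: "z 0 = 1" "\<And>c. c \<in> C \<Longrightarrow> 0 \<le> c 0 + c 1 * z 1" using base(3) by (auto simp: solution_def sum2)
  have "Q \<noteq> {}"
  proof
    assume Q: "Q = {}"
    \<comment> \<open>Without an upper bound the objective could be raised past
      \<open>M\<close>.\<close>
    have "solution 2 C (z(1 := max (z 1) (M + 1)))"
      unfolding solution_def sum2
    proof (intro conjI ballI)
      fix c assume c: "c \<in> C"
      then have "0 \<le> c 1" using Q by (force simp: Q_def)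
      then have "c 1 * z 1 \<le> c 1 * max (z 1) (M + 1)" by (intro mult_left_mono) auto
      then show "0 \<le> c 0 * (z(1 := max (z 1) (M + 1))) 0 + c 1 * (z(1 := max (z 1) (M + 1))) 1"
        using z(1) z(2)[OF c] by simp
    qed (use z in simp)
    from base(4)[OF this] show False by simp
  qed
  define r where "r c = (0 - c 0) / c 1" for c :: "nat \<Rightarrow> real"
  define t where "t = Min (r ` Q)"
  have finQ: "finite Q" using base(1) by (simp add: Q_def)
  have t: "t \<in> r ` Q" unfolding t_def using finQ \<open>Q \<noteq> {}\<close> by (intro Min_in) auto
  have zt: "z 1 \<le> t" unfolding t_def using finQ \<open>Q \<noteq> {}\<close> z(2) by (force simp: Q_def r_def field_simps)
  have "solution 2 C (z(1 := t))"
    unfolding solution_def sum2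
  proof (intro conjI ballI)
    fix c assume c: "c \<in> C"
    have "0 \<le> c 0 + c 1 * t"
    proof (cases "c 1 < 0")
      case True
      then have "t \<le> r c" unfolding t_def using c finQ by (intro Min_le) (auto simp: Q_def)
      then show ?thesis using True by (simp add: r_def field_simps)
    next
      case False
      then have "c 1 * z 1 \<le> c 1 * t" using zt by (intro mult_left_mono) auto
      then show ?thesis using z(2)[OF c] by simp
    qed
    then show "0 \<le> c 0 * (z(1 := t)) 0 + c 1 * (z(1 := t)) 1" using z by simp
  qed (use z in simp)
  moreover have "t \<in> level S (k + 2)"
  proof -
    obtain c where c: "c \<in> C" "t = (0 - c 0) / c 1" using t by (auto simp: Q_def r_def)
    have "0 - c 0 \<in> level S (Suc k)" using base(2)[OF c(1)] zero_level[OF S(1)] by (intro level_ops) auto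
    moreover have "c 1 \<in> level S (Suc k)" using base(2)[OF c(1)] level_mono[OF S(1), of k "Suc k"] by simp
    ultimately show ?thesis using level_ops(3) c(2) by (metis add_2_eq_Suc')
  qed
  then have "\<forall>i<2. (z(1 := t)) i \<in> level S (k + 2 * (2 + 2))"
    using z(1) level_mono[OF S(1), of "k+2" "k + 2 * (2+2)" t] level_mono[OF S(1), of 0 "k + 2 * (2+2)" 1] S
    by (auto simp: less_2_cases_iff)
  moreover have "z 1 \<le> (z(1 := t)) 1" using zt by simp
  ultimately show ?case by blast
next
  case (step n)
  let ?C = "eliminate n C"
  have "finite ?C" using step.prems(1) by (simp add: eliminate_def)
  moreover have "e i \<in> level S (k + 2)" if "e \<in> ?C" "i < n" for e i
  proof -
    have lv: "c j \<in> level S k" if "c \<in> C" "j \<le> n" for c j using step.prems(2)[OF that(1)] that(2) by simp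
    from \<open>e \<in> ?C\<close> consider "e \<in> C" | c d where "c \<in> C" "d \<in> C" "e = (\<lambda>i. c n * d i - d n * c i)"
      by (auto simp: eliminate_def)
    then show ?thesis
    proof cases
      case 1
      then show ?thesis using level_mono[OF S(1), of k "k+2"] lv that by simp
    next
      case 2
      then have "c n * d i \<in> level S (Suc k)" "d n * c i \<in> level S (Suc k)" using lv that by (auto intro!: level_ops)
      then show ?thesis using level_ops(1)[of "c n * d i" S "Suc k" "d n * c i"] by (simp add: 2)
    qed
  qed
  moreover have "solution n ?C z" using step.prems(3) by (rule solution_eliminate)
  moreover have "x 1 \<le> M" if x: "solution n ?C x" for x
  proof -
    obtain t where "solution (Suc n) C (x(n := t))"
      using solution_extend[OF step.prems(1) x] step.hyps by auto
    from step.prems(4)[OF this] show ?thesis using step.hyps by simp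
  qed
  ultimately obtain y where y: "solution n ?C y" "z 1 \<le> y 1" "\<And>i. i < n \<Longrightarrow> y i \<in> level S (k + 2 + n * (n + 2))"
    using step.IH[of ?C "k + 2"] by blast
  define K where "K = k + 2 + n * (n + 2)"
  obtain t where t: "solution (Suc n) C (y(n := t))"
      "t = 0 \<or> (\<exists>c\<in>C. c n \<noteq> 0 \<and> t = - (\<Sum>i<n. c i * y i) / c n)"
    using solution_extend[OF step.prems(1) y(1)] step.hyps by auto
  \<comment> \<open>\<open>K\<close> includes the two levels of the elimination step. Back
    substitution adds one product, \<open>n\<close> subtractions and one quotient.\<close>
  have K: "K + n + 2 \<le> k + Suc n * (Suc n + 2)" using step.hyps by (simp add: K_def)
  have "t \<in> level S (K + n + 2)"
    using t(2)
  proof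
    assume "t = 0" then show ?thesis using zero_level[OF S(1)] by simp
  next
    assume "\<exists>c\<in>C. c n \<noteq> 0 \<and> t = - (\<Sum>i<n. c i * y i) / c n"
    then obtain c where c: "c \<in> C" "t = - (\<Sum>i<n. c i * y i) / c n" by blast
    have lc: "c i \<in> level S l" if "k \<le> l" "i \<le> n" for i l
      using level_mono[OF S(1) that(1)] step.prems(2)[OF c(1)] that by simp
    have "c i * y i \<in> level S (Suc K)" if "i < n" for i
      using lc[of K i] y(3)[of i] that by (intro level_ops) (auto simp: K_def)
    then have "- (\<Sum>i<n. c i * y i) \<in> level S (Suc K + n)" by (intro neg_sum_level S)
    then have "t \<in> level S (Suc (Suc K + n))" unfolding c(2) using lc[of "Suc K + n" n] by (intro level_ops) (auto simp: K_def)
    then show ?thesis by simp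
  qed
  then have tl: "t \<in> level S (k + Suc n * (Suc n + 2))" using level_mono[OF S(1) K] by blast
  have "y i \<in> level S (k + Suc n * (Suc n + 2))" if "i < n" for i
    using y(3)[OF that, folded K_def] by (rule level_mono[OF S(1), rotated]) (use K in linarith)
  with tl have "\<forall>i<Suc n. (y(n := t)) i \<in> level S (k + Suc n * (Suc n + 2))"
    by (auto simp: less_Suc_eq simp del: mult_Suc mult_Suc_right)
  moreover have "z 1 \<le> (y(n := t)) 1" using y step.hyps by simp
  ultimately show ?case using t(1) by blast
qed

text \<open>For a fixed support bound \<open>I\<close> and a set \<open>J\<close> of actions
  required to be best replies, strategy and value together form a polyhedron, on which the value is
  maximised. It is bounded because an action of \<open>J\<close> has the value as its payoff, an
  average of entries of \<open>M\<close>. Coefficients need one level for the negated entries, and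
  there are \<open>m + 2\<close> coordinates.\<close>

lemma best_reply_polytope_level:
  fixes M :: "nat \<Rightarrow> nat \<Rightarrow> real"
  assumes S: "0 \<in> S" "1 \<in> S" "\<And>i j. i < m \<Longrightarrow> j < m \<Longrightarrow> M i j \<in> S"
    and p: "mixed_strategy m p" "\<And>i. i < m \<Longrightarrow> i \<notin> I \<Longrightarrow> p i = 0"
    and v: "\<And>j. j < m \<Longrightarrow> (\<Sum>i<m. p i * M i j) \<le> v" "\<And>j. j \<in> J \<Longrightarrow> (\<Sum>i<m. p i * M i j) = v"
    and J: "J \<subseteq> {..<m}" "J \<noteq> {}"
  shows "\<exists>p' v'. mixed_strategy m p' \<and> (\<forall>i<m. i \<notin> I \<longrightarrow> p' i = 0) \<and>
    (\<forall>j<m. (\<Sum>i<m. p' i * M i j) \<le> v') \<and> (\<forall>j\<in>J. (\<Sum>i<m. p' i * M i j) = v') \<and> v \<le> v' \<and>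
    (\<forall>i<m. p' i \<in> level S (1 + (m + 2) * (m + 4)))"
proof -
  \<comment> \<open>Coordinate \<open>i + 2\<close> is the probability of action \<open>i\<close>.
    The rows express nonnegativity, vanishing outside \<open>I\<close>, total weight 1 as two
    inequalities, the value as upper bound of all payoffs, and the reverse bound on
    \<open>J\<close>.\<close>
  define C :: "(nat \<Rightarrow> real) set" where "C =
    (\<lambda>i l. of_bool (l = i + 2)) ` {..<m} \<union> (\<lambda>i l. - of_bool (l = i + 2)) ` {i. i < m \<and> i \<notin> I} \<union>
    {\<lambda>l. if l = 0 then -1 else if l = 1 then 0 else 1, \<lambda>l. if l = 0 then 1 else if l = 1 then 0 else -1} \<union>
    (\<lambda>j l. if l = 0 then 0 else if l = 1 then 1 else - M (l - 2) j) ` {..<m} \<union>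
    (\<lambda>j l. if l = 0 then 0 else if l = 1 then -1 else M (l - 2) j) ` J"
  have sum2: "(\<Sum>l<m + 2. c l * x l) = c 0 * x 0 + c 1 * x 1 + (\<Sum>i<m. c (i + 2) * x (i + 2))"
    for c x :: "nat \<Rightarrow> real"
    by (simp add: sum.lessThan_Suc_shift del: sum.lessThan_Suc)
  have unit: "(\<Sum>k<m. of_bool (k = i) * x k) = x i" if "i < m" for i and x :: "nat \<Rightarrow> real"
    using that by (subst sum.remove[of _ i]) auto
  have sol: "solution (m + 2) C x \<longleftrightarrow> x 0 = 1 \<and> (\<forall>i<m. 0 \<le> x (i + 2)) \<and> (\<forall>i<m. i \<notin> I \<longrightarrow> x (i + 2) \<le> 0) \<and>
      (\<Sum>i<m. x (i + 2)) = 1 \<and> (\<forall>j<m. (\<Sum>i<m. x (i + 2) * M i j) \<le> x 1) \<and> (\<forall>j\<in>J. x 1 \<le> (\<Sum>i<m. x (i + 2) * M i j))" for x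
    unfolding solution_def C_def ball_Un sum2
    by (auto simp: unit sum_negf mult.commute[of "M _ _"] simp del: of_bool_eq_iff)
  have fin: "finite C" using finite_subset[OF J(1)] by (simp add: C_def)
  have m1: "-1 \<in> level S 1" using level_ops(1)[of 0 S 0 1] S by simp
  have lv: "x \<in> level S 1" if "x \<in> S" for x using level_mono[OF S(1), of 0 1] that by simp
  have neg: "- x \<in> level S 1" if "x \<in> S" for x using level_ops(1)[of 0 S 0 x] S that by simp
  have coeff: "c l \<in> level S 1" if "c \<in> C" "l < m + 2" for c l
  proof -
    have "0 \<in> level S 1" "1 \<in> level S 1" using lv S by blast+
    moreover have "M i j \<in> level S 1" "- M i j \<in> level S 1" if "i < m" "j < m" for i j
      using lv neg S(3) that by blast+
    moreover have "j < m" if "j \<in> J" for j using J that by blast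
    moreover have "l - 2 < m" if "l \<noteq> 0" "l \<noteq> 1" using that \<open>l < m + 2\<close> by auto
    ultimately show ?thesis using that m1 unfolding C_def
      by (auto simp del: One_nat_def add_2_eq_Suc add_2_eq_Suc' simp: of_bool_def)
  qed
  define z where "z = (\<lambda>l::nat. if l = 0 then 1 else if l = 1 then v else p (l - 2))"
  have zsol: "solution (m + 2) C z" unfolding sol z_def using p v J by (auto simp: mixed_strategy_def)
  obtain j0 where j0: "j0 \<in> J" "j0 < m" using J by blast
  have bnd: "x 1 \<le> (\<Sum>i<m. \<bar>M i j0\<bar>)" if "solution (m + 2) C x" for x
  proof -
    have x: "mixed_strategy m (\<lambda>i. x (i + 2))" "x 1 \<le> (\<Sum>i<m. x (i + 2) * M i j0)"
      using that[unfolded sol] j0 by (auto simp: mixed_strategy_def)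
    have "M i j0 \<le> (\<Sum>i<m. \<bar>M i j0\<bar>)" if "i < m" for i
      using member_le_sum[of i "{..<m}" "\<lambda>i. \<bar>M i j0\<bar>"] that by auto
    then have "(\<Sum>i<m. x (i + 2) * M i j0) \<le> (\<Sum>i<m. \<bar>M i j0\<bar>)" by (rule sum_le_max[OF x(1)])
    with x(2) show ?thesis by linarith
  qed
  have "\<exists>y. solution (m + 2) C y \<and> z 1 \<le> y 1 \<and> (\<forall>i<m + 2. y i \<in> level S (1 + (m + 2) * (m + 2 + 2)))"
  proof (rule optimal_solution_level[where z = z and M = "\<Sum>i<m. \<bar>M i j0\<bar>"])
    show "c i \<in> level S 1" if "c \<in> C" "i < m + 2" for c i using that by (rule coeff)
    show "x 1 \<le> (\<Sum>i<m. \<bar>M i j0\<bar>)" if "solution (m + 2) C x" for x using that by (rule bnd)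
  qed (rule S fin zsol le_add2)+
  then obtain y where y: "solution (m + 2) C y" "z 1 \<le> y 1" "\<forall>i<m + 2. y i \<in> level S (1 + (m + 2) * (m + 2 + 2))"
    by blast
  show ?thesis
  proof (intro exI conjI allI impI ballI)
    show "mixed_strategy m (\<lambda>i. y (i + 2))" using y(1)[unfolded sol] by (simp add: mixed_strategy_def)
    show "y (i + 2) = 0" if "i < m" "i \<notin> I" for i
      using y(1)[unfolded sol] that by (meson antisym)
    show "(\<Sum>i<m. y (i + 2) * M i j) \<le> y 1" if "j < m" for j
      using y(1)[unfolded sol] that by blast
    show "(\<Sum>i<m. y (i + 2) * M i j) = y 1" if "j \<in> J" for j
      using y(1)[unfolded sol] that J(1) by (meson antisym lessThan_iff subsetD)
    show "v \<le> y 1" using y(2) by (simp add: z_def)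
    show "\<And>i. i < m \<Longrightarrow> y (i + 2) \<in> level S (1 + (m + 2) * (m + 4))" using y(3) by (simp add: numeral_eq_Suc)
  qed
qed

lemma mixed_nonempty_support: "mixed_strategy m p \<Longrightarrow> {i. i < m \<and> 0 < p i} \<noteq> {}"
  using sum_nonpos[of "{..<m}" p] unfolding mixed_strategy_def by fastforce

text \<open>With the supports fixed, the two values can be maximised independently of each other, and
  this preserves Pareto optimality.\<close>

lemma equilibrium_level:
  assumes S: "0 \<in> S" "1 \<in> S" "\<And>i j. i < m \<Longrightarrow> j < m \<Longrightarrow> A i j \<in> S" "\<And>i j. i < m \<Longrightarrow> j < m \<Longrightarrow> B i j \<in> S"
    and eq: "equilibrium m A B p q"
  shows "\<exists>p' q'. equilibrium m A B p' q' \<and>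
    (\<forall>i<m. p' i \<in> level S (1 + (m + 2) * (m + 4)) \<and> q' i \<in> level S (1 + (m + 2) * (m + 4)))"
proof -
  define I where "I = {i. i < m \<and> 0 < p i}"
  define J where "J = {j. j < m \<and> 0 < q j}"
  have mixed: "mixed_strategy m p" "mixed_strategy m q" using eq by (auto simp: equilibrium_def)
  have IJ: "I \<subseteq> {..<m}" "J \<subseteq> {..<m}" "I \<noteq> {}" "J \<noteq> {}"
    using mixed_nonempty_support mixed by (auto simp: I_def J_def)
  have off: "i < m \<Longrightarrow> i \<notin> I \<Longrightarrow> p i = 0" "i < m \<Longrightarrow> i \<notin> J \<Longrightarrow> q i = 0" for i
    using mixed by (force simp: I_def J_def mixed_strategy_def)+
  have le: "\<And>j. j < m \<Longrightarrow> (\<Sum>i<m. p i * B i j) \<le> payoff m B p q"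
      "\<And>i. i < m \<Longrightarrow> (\<Sum>j<m. q j * A i j) \<le> payoff m A p q"
    using eq by (auto simp: equilibrium_def)
  have val: "\<And>j. j \<in> J \<Longrightarrow> (\<Sum>i<m. p i * B i j) = payoff m B p q"
      "\<And>i. i \<in> I \<Longrightarrow> (\<Sum>j<m. q j * A i j) = payoff m A p q"
    using equilibrium_values[OF eq] by (auto simp: I_def J_def)
  obtain p' w where p': "mixed_strategy m p'" "\<And>i. i < m \<Longrightarrow> i \<notin> I \<Longrightarrow> p' i = 0"
      "\<And>j. j < m \<Longrightarrow> (\<Sum>i<m. p' i * B i j) \<le> w" "\<And>j. j \<in> J \<Longrightarrow> (\<Sum>i<m. p' i * B i j) = w"
      "payoff m B p q \<le> w" "\<And>i. i < m \<Longrightarrow> p' i \<in> level S (1 + (m + 2) * (m + 4))"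
    using best_reply_polytope_level[of S m B p I "payoff m B p q" J,
        OF S(1,2,4) mixed(1) off(1) le(1) val(1) IJ(2,4)] by blast
  obtain q' v where q': "mixed_strategy m q'" "\<And>i. i < m \<Longrightarrow> i \<notin> J \<Longrightarrow> q' i = 0"
      "\<And>i. i < m \<Longrightarrow> (\<Sum>j<m. q' j * A i j) \<le> v" "\<And>i. i \<in> I \<Longrightarrow> (\<Sum>j<m. q' j * A i j) = v"
      "payoff m A p q \<le> v" "\<And>i. i < m \<Longrightarrow> q' i \<in> level S (1 + (m + 2) * (m + 4))"
    using best_reply_polytope_level[of S m "\<lambda>i j. A j i" q J "payoff m A p q" I,
        OF S(1,2) S(3) mixed(2) off(2) le(2) val(2) IJ(1,3)] by blast
  \<comment> \<open>The new supports may be smaller than \<open>I\<close> and \<open>J\<close>;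
    inclusion is enough for the payoffs to equal the two maximal values.\<close>
  have "payoff m A p' q' = (\<Sum>i<m. p' i * v)"
    unfolding payoff_row
  proof (rule sum.cong[OF refl])
    show "p' i * (\<Sum>j<m. q' j * A i j) = p' i * v" if "i \<in> {..<m}" for i
      using p'(2)[of i] q'(4)[of i] that by (cases "i \<in> I") auto
  qed
  then have pv: "payoff m A p' q' = v" using p'(1) by (simp add: mixed_strategy_def sum_distrib_right[symmetric])
  have "payoff m B p' q' = (\<Sum>j<m. q' j * w)"
    unfolding payoff_col
  proof (rule sum.cong[OF refl])
    show "q' j * (\<Sum>i<m. p' i * B i j) = q' j * w" if "j \<in> {..<m}" for j
      using q'(2)[of j] p'(4)[of j] that by (cases "j \<in> J") auto
  qed
  then have pw: "payoff m B p' q' = w" using q'(1) by (simp add: mixed_strategy_def sum_distrib_right[symmetric])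
  have "equilibrium m A B p' q'"
    unfolding equilibrium_def pv pw
  proof (intro conjI)
    show "\<not> (\<exists>p'' q''. mixed_strategy m p'' \<and> mixed_strategy m q'' \<and> v < payoff m A p'' q'' \<and> w < payoff m B p'' q'')"
      using eq p'(5) q'(5) unfolding equilibrium_def by (meson le_less_trans)
  qed (use p' q' in auto)
  then show ?thesis using p'(6) q'(6) by blast
qed

section \<open>Random games are nondegenerate\<close>

text \<open>By Fubini coordinate \<open>x\<close> is integrated first: for fixed other coordinates
  at most one of its values satisfies \<open>P\<close>, and single points have measure zero.\<close>

lemma AE_PiM_not_determined_coordinate:
  fixes D :: "real measure"
  assumes D: "prob_space D" "sets D = sets borel" "\<And>r. emeasure D {r} = 0"
    and I: "finite I" "x \<in> I"
    and meas: "{w \<in> space (Pi\<^sub>M I (\<lambda>_. D)). P w} \<in> sets (Pi\<^sub>M I (\<lambda>_. D))"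
    and uniq: "\<And>w r r'. P (w(x := r)) \<Longrightarrow> P (w(x := r')) \<Longrightarrow> r = r'"
  shows "AE w in Pi\<^sub>M I (\<lambda>_. D). \<not> P w"
proof -
  interpret D: prob_space D by fact
  interpret product_sigma_finite "\<lambda>_. D" by standard
  let ?N = "{w \<in> space (Pi\<^sub>M I (\<lambda>_. D)). P w}"
  let ?J = "I - {x}"
  have J: "finite ?J" "x \<notin> ?J" "insert x ?J = I" using I by auto
  have "emeasure (Pi\<^sub>M I (\<lambda>_. D)) ?N = (\<integral>\<^sup>+w. indicator ?N w \<partial>Pi\<^sub>M (insert x ?J) (\<lambda>_. D))"
    using meas J by simp
  also have "\<dots> = (\<integral>\<^sup>+w. (\<integral>\<^sup>+r. indicator ?N (w(x := r)) \<partial>D) \<partial>Pi\<^sub>M ?J (\<lambda>_. D))"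
    using meas J by (intro product_nn_integral_insert) (auto intro!: borel_measurable_indicator)
  also have "\<dots> = (\<integral>\<^sup>+w. 0 \<partial>Pi\<^sub>M ?J (\<lambda>_. D))"
  proof (rule nn_integral_cong)
    fix w :: "'a \<Rightarrow> real"
    have null: "{r} \<in> null_sets D" for r using D by (auto simp: null_sets_def)
    obtain r0 where r0: "\<And>r. P (w(x := r)) \<Longrightarrow> r = r0" using uniq by metis
    have "AE r in D. r \<notin> {r0}" by (rule AE_not_in[OF null])
    then have "AE r in D. (indicator ?N (w(x := r)) :: ennreal) = 0"
      by eventually_elim (use r0 in \<open>auto simp: indicator_def\<close>)
    then show "(\<integral>\<^sup>+r. indicator ?N (w(x := r)) \<partial>D) = 0"
      by (subst nn_integral_cong_AE[where v = "\<lambda>_. 0"]) auto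
  qed
  also have "\<dots> = 0" by simp
  finally have "emeasure (Pi\<^sub>M I (\<lambda>_. D)) ?N = 0" .
  then show ?thesis using meas by (subst AE_iff_measurable) auto
qed

lemma AE_nondegenerate:
  assumes D: "prob_space D" "sets D = sets borel" "\<And>r. emeasure D {r} = 0"
  shows "AE w in perturbation D m. \<not> degenerate m (perturbed U w)"
proof -
  let ?I = "{1, 2::nat} \<times> {..<m} \<times> {..<m}"
  let ?M = "Pi\<^sub>M ?I (\<lambda>_. D)"
  have comp: "(\<lambda>w. w x) \<in> borel_measurable ?M" if "x \<in> ?I" for x
    using measurable_component_singleton[OF that, of "\<lambda>_. D"] measurable_cong_sets[OF refl D(2)] by blast
  have c: "(\<lambda>w. perturbed U w k i j) \<in> borel_measurable ?M" if "k \<in> {1,2}" "i < m" "j < m" for k i j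
    unfolding perturbed_def using that by (intro borel_measurable_add borel_measurable_const comp) auto
  note gen = AE_PiM_not_determined_coordinate[OF D, of ?I]
  have rows: "AE w in ?M. perturbed U w k i j \<noteq> perturbed U w k i' j'"
    if "k \<in> {1,2}" "i < m" "i' < m" "j < m" "j' < m" "(i, j) \<noteq> (i', j')" for k i j i' j'
  proof (rule gen[of "(k, i, j)"])
    show "{w \<in> space ?M. perturbed U w k i j = perturbed U w k i' j'} \<in> sets ?M"
      using that by (intro borel_measurable_eq c) auto
  qed (use that in \<open>auto simp: perturbed_def\<close>)
  \<comment> \<open>On the event that the leading difference is nonzero, collinearity is a linear
    equation for the entry \<open>(2, i, j')\<close> alone. The complementary event is already null
    by \<open>rows\<close>.\<close>
  have corner: "AE w in ?M. \<not> (perturbed U w 1 i' j - perturbed U w 1 i j \<noteq> 0 \<and>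
      (perturbed U w 1 i' j - perturbed U w 1 i j) * (perturbed U w 2 i j' - perturbed U w 2 i j) =
      (perturbed U w 1 i j' - perturbed U w 1 i j) * (perturbed U w 2 i' j - perturbed U w 2 i j))"
      (is "AE w in ?M. \<not> ?P w")
    if ij: "i < m" "i' < m" "j < m" "j' < m" "i \<noteq> i'" "j \<noteq> j'" for i j i' j'
  proof (rule gen[of "(2, i, j')"])
    have [measurable]: "(\<lambda>w. perturbed U w 1 i' j) \<in> borel_measurable ?M" "(\<lambda>w. perturbed U w 1 i j) \<in> borel_measurable ?M"
      "(\<lambda>w. perturbed U w 1 i j') \<in> borel_measurable ?M" "(\<lambda>w. perturbed U w 2 i' j) \<in> borel_measurable ?M"
      "(\<lambda>w. perturbed U w 2 i j) \<in> borel_measurable ?M" "(\<lambda>w. perturbed U w 2 i j') \<in> borel_measurable ?M"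
      by (rule c; use ij in simp)+
    have "{w \<in> space ?M. perturbed U w 1 i' j - perturbed U w 1 i j = 0} \<in> sets ?M"
      "{w \<in> space ?M. (perturbed U w 1 i' j - perturbed U w 1 i j) * (perturbed U w 2 i j' - perturbed U w 2 i j) =
        (perturbed U w 1 i j' - perturbed U w 1 i j) * (perturbed U w 2 i' j - perturbed U w 2 i j)} \<in> sets ?M"
      by (rule borel_measurable_eq; measurable)+
    from sets.Diff[OF this(2,1)] show "{w \<in> space ?M. ?P w} \<in> sets ?M"
      by (rule back_subst[where P = "\<lambda>X. X \<in> sets ?M"]) auto
  next
    fix w r r'
    assume "?P (w((2, i, j') := r))" "?P (w((2, i, j') := r'))"
    moreover have "r = r'" if "a \<noteq> 0" "a * (c + r - e) = x" "a * (c + r' - e) = x" for a c e x :: real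
    proof -
      have "c + r - e = c + r' - e" using that by (metis mult_cancel_left)
      then show ?thesis by simp
    qed
    note this[of "U 1 i' j + w (1, i', j) - (U 1 i j + w (1, i, j))" "U 2 i j'" "U 2 i j + w (2, i, j)"
      "(U 1 i j' + w (1, i, j') - (U 1 i j + w (1, i, j))) * (U 2 i' j + w (2, i', j) - (U 2 i j + w (2, i, j)))"]
    ultimately show "r = r'" using ij by (simp add: perturbed_def)
  qed (use ij in auto)
  have "AE w in ?M. \<not> degenerate_at (perturbed U w 1) (perturbed U w 2) i i' j j'"
    if ij: "i < m" "i' < m" "j < m" "j' < m" for i i' j j'
  proof -
    have rows': "AE w in ?M. i \<noteq> i' \<longrightarrow> perturbed U w k i j \<noteq> perturbed U w k i' j"
      "AE w in ?M. j \<noteq> j' \<longrightarrow> perturbed U w k i j \<noteq> perturbed U w k i j'" if "k \<in> {1,2}" for k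
      using rows[OF that, of i i' j j] rows[OF that, of i i j j'] ij by auto
    have corner': "AE w in ?M. i \<noteq> i' \<and> j \<noteq> j' \<longrightarrow> \<not> (perturbed U w 1 i' j - perturbed U w 1 i j \<noteq> 0 \<and>
      (perturbed U w 1 i' j - perturbed U w 1 i j) * (perturbed U w 2 i j' - perturbed U w 2 i j) =
      (perturbed U w 1 i j' - perturbed U w 1 i j) * (perturbed U w 2 i' j - perturbed U w 2 i j))"
      using corner[OF ij] by (cases "i \<noteq> i' \<and> j \<noteq> j'") auto
    have one: "1 \<in> {1, 2::nat}" and two: "2 \<in> {1, 2::nat}" by auto
    from rows'[OF one] rows'[OF two] corner' show ?thesis
      by eventually_elim (unfold degenerate_at_def, metis eq_iff_diff_eq_0)
  qed
  then have "AE w in ?M. \<forall>i\<in>{..<m}. \<forall>i'\<in>{..<m}. \<forall>j\<in>{..<m}. \<forall>j'\<in>{..<m}.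
      \<not> degenerate_at (perturbed U w 1) (perturbed U w 2) i i' j j'"
    by (intro AE_finite_allI) auto
  then show ?thesis unfolding perturbation_def by eventually_elim (auto simp: degenerate_def)
qed

lemma uniform_noise_atomless:
  assumes "0 < \<sigma>"
  shows "prob_space (uniform_noise \<sigma>)" "sets (uniform_noise \<sigma>) = sets borel" "emeasure (uniform_noise \<sigma>) {r} = 0"
proof -
  show "prob_space (uniform_noise \<sigma>)"
    unfolding uniform_noise_def using assms by (intro prob_space_uniform_measure) auto
  show "sets (uniform_noise \<sigma>) = sets borel" by (simp add: uniform_noise_def)
  have "emeasure lborel ({-\<sigma>..\<sigma>} \<inter> {r}) = 0"
    by (rule emeasure_eq_0[of "{r}"]) auto
  then show "emeasure (uniform_noise \<sigma>) {r} = 0"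
    unfolding uniform_noise_def by (subst emeasure_uniform_measure) auto
qed

lemma gaussian_noise_atomless:
  assumes "0 < \<sigma>"
  shows "prob_space (gaussian_noise \<sigma>)" "sets (gaussian_noise \<sigma>) = sets borel" "emeasure (gaussian_noise \<sigma>) {r} = 0"
proof -
  show "prob_space (gaussian_noise \<sigma>)"
    unfolding gaussian_noise_def using assms by (rule prob_space_normal_density)
  show "sets (gaussian_noise \<sigma>) = sets borel" by (simp add: gaussian_noise_def)
  have "emeasure (gaussian_noise \<sigma>) {r} = (\<integral>\<^sup>+x. ennreal (normal_density 0 \<sigma> x) * indicator {r} x \<partial>lborel)"
    unfolding gaussian_noise_def by (subst emeasure_density) auto
  also have "\<dots> = (\<integral>\<^sup>+x. 0 \<partial>(lborel :: real measure))"
    by (intro nn_integral_cong_AE eventually_mono[OF AE_lborel_singleton[of r]]) auto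
  finally show "emeasure (gaussian_noise \<sigma>) {r} = 0" by simp
qed

lemma prob_space_perturbation: "prob_space D \<Longrightarrow> prob_space (perturbation D m)"
  unfolding perturbation_def by (intro prob_space_PiM)

section \<open>Loop programs\<close>

lemma upd_simps [simp]:
  "nats (nats_upd a i j x s) b k l = (if b = a \<and> k = i \<and> l = j then x else nats s b k l)"
  "reals (reals_upd a i j y s) b k l = (if b = a \<and> k = i \<and> l = j then y else reals s b k l)"
  "reals (nats_upd a i j x s) = reals s" "nats (reals_upd a i j y s) = nats s"
  by (auto simp: nats_upd_def reals_upd_def)

lemma upd_other [simp]:
  "b \<noteq> a \<Longrightarrow> nats (nats_upd a i j x s) b = nats s b"
  "b \<noteq> a \<Longrightarrow> reals (reals_upd a i j y s) b = reals s b"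
  by (auto simp: nats_upd_def reals_upd_def)

lemma state_eqI:
  fixes s t :: state
  shows "(\<And>a i j. nats s a i j = nats t a i j) \<Longrightarrow> (\<And>a i j. reals s a i j = reals t a i j) \<Longrightarrow> s = t"
  by (cases s, cases t) (auto intro!: ext)

text \<open>A language with counted loops in place of while loops: its meaning \<open>sem\<close>
  and its running time \<open>cost\<close> are total recursive functions, and
  \<open>exec_compile\<close> transfers both to the machine.\<close>

datatype prog = Nop
  | NSet nat nexp nexp nexp
  | RSet nat nexp nexp rexp
  | Then prog prog
  | Test bexp prog prog
  | For nat nexp prog

abbreviation nvar :: "nat \<Rightarrow> nexp" where
  "nvar v \<equiv> NElem v (NConst 0) (NConst 0)"

primrec compile :: "prog \<Rightarrow> com" where
  "compile Nop = Skip"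
| "compile (NSet a i j e) = NAssign a i j e"
| "compile (RSet a i j e) = RAssign a i j e"
| "compile (Then P Q) = Seq (compile P) (compile Q)"
| "compile (Test b P Q) = Cond b (compile P) (compile Q)"
| "compile (For v e P) = Seq (NAssign v (NConst 0) (NConst 0) (NConst 0))
     (While (NLess (nvar v) e)
       (Seq (compile P) (NAssign v (NConst 0) (NConst 0) (NPlus (nvar v) (NConst 1)))))"

definition iter :: "nat \<Rightarrow> (state \<Rightarrow> state) \<Rightarrow> state \<Rightarrow> nat \<Rightarrow> state" where
  "iter v f s k = ((\<lambda>t. nats_upd v 0 0 (nats (f t) v 0 0 + 1) (f t)) ^^ k) (nats_upd v 0 0 0 s)"

primrec sem :: "prog \<Rightarrow> state \<Rightarrow> state" where
  "sem Nop s = s"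
| "sem (NSet a i j e) s = nats_upd a (nval i s) (nval j s) (nval e s) s"
| "sem (RSet a i j e) s = reals_upd a (nval i s) (nval j s) (rval e s) s"
| "sem (Then P Q) s = sem Q (sem P s)"
| "sem (Test b P Q) s = (if bval b s then sem P s else sem Q s)"
| "sem (For v e P) s = iter v (sem P) s (nval e s)"

primrec nmods :: "prog \<Rightarrow> nat set" where
  "nmods Nop = {}"
| "nmods (NSet a i j e) = {a}"
| "nmods (RSet a i j e) = {}"
| "nmods (Then P Q) = nmods P \<union> nmods Q"
| "nmods (Test b P Q) = nmods P \<union> nmods Q"
| "nmods (For v e P) = insert v (nmods P)"

primrec rmods :: "prog \<Rightarrow> nat set" where
  "rmods Nop = {}"
| "rmods (NSet a i j e) = {}"
| "rmods (RSet a i j e) = {a}"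
| "rmods (Then P Q) = rmods P \<union> rmods Q"
| "rmods (Test b P Q) = rmods P \<union> rmods Q"
| "rmods (For v e P) = rmods P"

primrec nreads :: "nexp \<Rightarrow> nat set" where
  "nreads (NConst n) = {}"
| "nreads (NElem a i j) = insert a (nreads i \<union> nreads j)"
| "nreads (NPlus d e) = nreads d \<union> nreads e"
| "nreads (NMinus d e) = nreads d \<union> nreads e"

text \<open>\<open>sem\<close> evaluates a loop bound once, the compiled loop before every pass. The
  two agree if the body leaves the counter alone and the bound reads neither the counter nor
  anything that the body changes.\<close>

primrec wf_loops :: "prog \<Rightarrow> bool" where
  "wf_loops Nop \<longleftrightarrow> True"
| "wf_loops (NSet a i j e) \<longleftrightarrow> True"
| "wf_loops (RSet a i j e) \<longleftrightarrow> True"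
| "wf_loops (Then P Q) \<longleftrightarrow> wf_loops P \<and> wf_loops Q"
| "wf_loops (Test b P Q) \<longleftrightarrow> wf_loops P \<and> wf_loops Q"
| "wf_loops (For v e P) \<longleftrightarrow> v \<notin> nmods P \<and> nreads e \<inter> insert v (nmods P) = {} \<and> wf_loops P"

lemma nval_cong: "(\<And>a. a \<in> nreads e \<Longrightarrow> nats s a = nats t a) \<Longrightarrow> nval e s = nval e t"
  by (induction e) auto

lemma iter_0: "iter v f s 0 = nats_upd v 0 0 0 s"
  by (simp add: iter_def)

lemma iter_Suc: "iter v f s (Suc k) = nats_upd v 0 0 (nats (f (iter v f s k)) v 0 0 + 1) (f (iter v f s k))"
  by (simp add: iter_def)

lemma iter_frame:
  assumes "\<And>t. nats (f t) a = nats t a" "a \<noteq> v"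
  shows "nats (iter v f s k) a = nats s a"
  by (induction k) (simp_all add: iter_0 iter_Suc assms)

lemma iter_frame_reals:
  assumes "\<And>t. reals (f t) a = reals t a"
  shows "reals (iter v f s k) a = reals s a"
  by (induction k) (simp_all add: iter_0 iter_Suc assms)

lemma iter_var:
  assumes "\<And>t. nats (f t) v = nats t v"
  shows "nats (iter v f s k) v 0 0 = k"
  by (induction k) (simp_all add: iter_0 iter_Suc assms)

lemma sem_frame [simp]: "a \<notin> nmods P \<Longrightarrow> nats (sem P s) a = nats s a"
  by (induction P arbitrary: s) (auto intro!: iter_frame)

lemma sem_frame_reals [simp]: "a \<notin> rmods P \<Longrightarrow> reals (sem P s) a = reals s a"
  by (induction P arbitrary: s) (auto intro!: iter_frame_reals)

lemma iter_sem_Suc: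
  "v \<notin> nmods P \<Longrightarrow> iter v (sem P) s (Suc k) = nats_upd v 0 0 (Suc k) (sem P (iter v (sem P) s k))"
  by (simp add: iter_Suc iter_var)

lemma nval_iter:
  assumes "wf_loops (For v e P)"
  shows "nval e (iter v (sem P) s k) = nval e s"
proof (rule nval_cong)
  fix a assume "a \<in> nreads e"
  then show "nats (iter v (sem P) s k) a = nats s a" using assms by (intro iter_frame sem_frame) auto
qed

text \<open>For a loop, 4 pays for the initial assignment and \<open>4 + ncost e\<close> for the
  final failing test; each pass pays the test again and 8 for the increment.\<close>

primrec cost :: "prog \<Rightarrow> state \<Rightarrow> nat" where
  "cost Nop s = 1"
| "cost (NSet a i j e) s = 1 + ncost i + ncost j + ncost e"
| "cost (RSet a i j e) s = 1 + ncost i + ncost j + rcost e"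
| "cost (Then P Q) s = cost P s + cost Q (sem P s)"
| "cost (Test b P Q) s = bcost b + (if bval b s then cost P s else cost Q s)"
| "cost (For v e P) s =
     4 + (4 + ncost e) + (\<Sum>k<nval e s. 12 + ncost e + cost P (iter v (sem P) s k))"

lemma exec_compile: "wf_loops P \<Longrightarrow> exec (compile P) s (cost P s) (sem P s)"
proof (induction P arbitrary: s)
  case Nop
  show ?case unfolding compile.simps cost.simps sem.simps by (rule exec.Skip)
next
  case NSet
  show ?case using exec.NAssign by simp
next
  case RSet
  show ?case using exec.RAssign by simp
next
  case (Then P Q)
  then show ?case by (auto intro: exec.Seq)
next
  case (Test b P Q)
  then show ?case by (auto intro: exec.CondTrue exec.CondFalse)
next
  case (For v e P)
  let ?it = "iter v (sem P) s" and ?n = "nval e s"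
  let ?b = "NLess (nvar v) e"
  let ?c = "Seq (compile P) (NAssign v (NConst 0) (NConst 0) (NPlus (nvar v) (NConst 1)))"
  have v: "v \<notin> nmods P" and wf: "wf_loops P" using For.prems by auto
  have var: "nats (?it k) v 0 0 = k" for k using v by (intro iter_var sem_frame)
  have bound: "nval e (?it k) = ?n" for k by (rule nval_iter[OF For.prems])
  have body: "exec ?c (?it k) (cost P (?it k) + 8) (?it (Suc k))" for k
  proof -
    have "exec (NAssign v (NConst 0) (NConst 0) (NPlus (nvar v) (NConst 1))) (sem P (?it k)) 8 (?it (Suc k))"
      using exec.NAssign[of v "NConst 0" "NConst 0" "NPlus (nvar v) (NConst 1)" "sem P (?it k)"]
      by (simp add: iter_Suc numeral_eq_Suc)
    then show ?thesis by (intro exec.Seq[OF For.IH[OF wf]])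
  qed
  \<comment> \<open>Induction on the number \<open>j\<close> of passes still to come, since
    \<open>exec.WhileTrue\<close> peels off the first pass.\<close>
  have loop: "j \<le> ?n \<Longrightarrow> exec (While ?b ?c) (?it (?n - j))
      ((4 + ncost e) + (\<Sum>k\<in>{?n - j..<?n}. 12 + ncost e + cost P (?it k))) (?it ?n)" for j
  proof (induction j)
    case 0
    have "\<not> bval ?b (?it ?n)" by (simp add: var bound)
    from exec.WhileFalse[OF this, of ?c] show ?case by (simp add: numeral_eq_Suc)
  next
    case (Suc j)
    let ?k = "?n - Suc j"
    have k: "?k < ?n" "Suc ?k = ?n - j" using Suc.prems by auto
    have "bval ?b (?it ?k)" using k by (simp add: var bound)
    from exec.WhileTrue[OF this body, of "(4 + ncost e) + (\<Sum>k\<in>{?n - j..<?n}. 12 + ncost e + cost P (?it k))"]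
    have "exec (While ?b ?c) (?it ?k) (bcost ?b + (cost P (?it ?k) + 8) +
        ((4 + ncost e) + (\<Sum>k\<in>{?n - j..<?n}. 12 + ncost e + cost P (?it k)))) (?it ?n)"
      using Suc k by simp
    moreover have "(\<Sum>k\<in>{?k..<?n}. 12 + ncost e + cost P (?it k)) =
        (12 + ncost e + cost P (?it ?k)) + (\<Sum>k\<in>{?n - j..<?n}. 12 + ncost e + cost P (?it k))"
      using k by (simp add: sum.atLeast_Suc_lessThan[of ?k ?n])
    ultimately show ?case by (simp add: algebra_simps)
  qed
  have "exec (NAssign v (NConst 0) (NConst 0) (NConst 0)) s 4 (?it 0)"
    using exec.NAssign[of v "NConst 0" "NConst 0" "NConst 0" s] by (simp add: iter_0 numeral_eq_Suc)
  moreover have "exec (While ?b ?c) (?it 0) ((4 + ncost e) + (\<Sum>k\<in>{0..<?n}. 12 + ncost e + cost P (?it k))) (?it ?n)"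
    using loop[of ?n] by simp
  ultimately have "exec (Seq (NAssign v (NConst 0) (NConst 0) (NConst 0)) (While ?b ?c)) s
      (4 + ((4 + ncost e) + (\<Sum>k\<in>{0..<?n}. 12 + ncost e + cost P (?it k)))) (?it ?n)"
    by (rule exec.Seq)
  then show ?case by (simp only: compile.simps cost.simps sem.simps atLeast0LessThan add.assoc)
qed

section \<open>Polynomial cost of loops bounded by the number of actions\<close>

primrec flat_loops :: "prog \<Rightarrow> bool" where
  "flat_loops Nop \<longleftrightarrow> True"
| "flat_loops (NSet a i j e) \<longleftrightarrow> True"
| "flat_loops (RSet a i j e) \<longleftrightarrow> True"
| "flat_loops (Then P Q) \<longleftrightarrow> flat_loops P \<and> flat_loops Q"
| "flat_loops (Test b P Q) \<longleftrightarrow> flat_loops P \<and> flat_loops Q"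
| "flat_loops (For v e P) \<longleftrightarrow> e = nvar 0 \<and> flat_loops P"

lemma cost_polynomial:
  assumes "flat_loops P" "0 \<notin> nmods P"
  shows "\<exists>K d. \<forall>s. cost P s \<le> K * (nats s 0 0 0 + 1) ^ d"
  using assms
proof (induction P)
  case Nop
  show ?case by (intro exI[of _ 1] exI[of _ 0]) simp
next
  case (NSet a i j e)
  show ?case by (intro exI[of _ "1 + ncost i + ncost j + ncost e"] exI[of _ 0]) simp
next
  case (RSet a i j e)
  show ?case by (intro exI[of _ "1 + ncost i + ncost j + rcost e"] exI[of _ 0]) simp
next
  case (Then P Q)
  then obtain K d L e where P: "\<And>s. cost P s \<le> K * (nats s 0 0 0 + 1) ^ d"
    and Q: "\<And>s. cost Q s \<le> L * (nats s 0 0 0 + 1) ^ e" by auto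
  have "cost (Then P Q) s \<le> (K + L) * (nats s 0 0 0 + 1) ^ (d + e)" for s
  proof -
    have "cost P s \<le> K * (nats s 0 0 0 + 1) ^ (d + e)"
      by (rule order_trans[OF P]) (intro mult_left_mono power_increasing; simp)
    moreover have "cost Q (sem P s) \<le> L * (nats s 0 0 0 + 1) ^ (d + e)"
    proof -
      have "nats (sem P s) 0 0 0 = nats s 0 0 0" using Then.prems by simp
      then show ?thesis using Q[of "sem P s"] power_increasing[of e "d + e" "nats s 0 0 0 + 1"]
        by (metis add_leD2 le_add2 mult_le_mono2 order_refl order_trans)
    qed
    ultimately show ?thesis by (simp add: distrib_right)
  qed
  then show ?case by blast
next
  case (Test b P Q)
  then obtain K d L e where P: "\<And>s. cost P s \<le> K * (nats s 0 0 0 + 1) ^ d"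
    and Q: "\<And>s. cost Q s \<le> L * (nats s 0 0 0 + 1) ^ e" by auto
  have "cost (Test b P Q) s \<le> (bcost b + K + L) * (nats s 0 0 0 + 1) ^ (d + e)" for s
  proof -
    have "cost P s \<le> K * (nats s 0 0 0 + 1) ^ (d + e)"
      by (rule order_trans[OF P]) (intro mult_left_mono power_increasing; simp)
    moreover have "cost Q s \<le> L * (nats s 0 0 0 + 1) ^ (d + e)"
      by (intro order_trans[OF Q] mult_left_mono power_increasing) auto
    moreover have "bcost b \<le> bcost b * (nats s 0 0 0 + 1) ^ (d + e)" by simp
    moreover have "cost (Test b P Q) s = bcost b + cost P s \<or> cost (Test b P Q) s = bcost b + cost Q s" by simp
    ultimately show ?thesis unfolding distrib_right by linarith
  qed
  then show ?case by blast
next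
  case (For v e P)
  then obtain K d where P: "\<And>s. cost P s \<le> K * (nats s 0 0 0 + 1) ^ d" by auto
  \<comment> \<open>With \<open>ncost e = 3\<close> the loop costs 11 outside and 15 per pass
    besides the body, and \<open>11 + 15 * m \<le> 26 * (m + 1)\<close>.\<close>
  have "cost (For v e P) s \<le> (26 + K) * (nats s 0 0 0 + 1) ^ (d + 1)" for s
  proof -
    let ?m = "nats s 0 0 0"
    have m: "nats (iter v (sem P) s k) 0 0 0 = ?m" for k
      using For.prems by (subst iter_frame) auto
    have e: "nval e s = ?m" "ncost e = 3" using For.prems by auto
    have "cost (For v e P) s \<le> 11 + (\<Sum>k<?m. 15 + K * (?m + 1) ^ d)"
    proof -
      have "cost P (iter v (sem P) s k) \<le> K * (?m + 1) ^ d" for k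
        using P[of "iter v (sem P) s k"] unfolding m .
      then have "(\<Sum>k<?m. 15 + cost P (iter v (sem P) s k)) \<le> (\<Sum>k<?m. 15 + K * (?m + 1) ^ d)"
        by (intro sum_mono add_left_mono)
      then show ?thesis unfolding cost.simps e by simp
    qed
    also have "\<dots> = 11 + ?m * 15 + K * (?m * (?m + 1) ^ d)" by (simp add: algebra_simps)
    also have "\<dots> \<le> 26 * (?m + 1) + K * ((?m + 1) * (?m + 1) ^ d)"
      by (intro add_mono mult_left_mono mult_right_mono) auto
    also have "26 * (?m + 1) \<le> 26 * ((?m + 1) * (?m + 1) ^ d)"
      using mult_le_mono2[of 1 "(?m + 1) ^ d" "?m + 1"] by (intro mult_le_mono2) simp
    finally show ?thesis by (simp add: distrib_right)
  qed
  then show ?case by blast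
qed

section \<open>Invariants, accumulation and existential tests\<close>

definition agree :: "nat set \<Rightarrow> nat set \<Rightarrow> state \<Rightarrow> state \<Rightarrow> bool" where
  "agree X Y s t \<longleftrightarrow> (\<forall>a. a \<notin> X \<longrightarrow> nats t a = nats s a) \<and> (\<forall>a. a \<notin> Y \<longrightarrow> reals t a = reals s a)"

text \<open>The index of \<open>I\<close> counts completed passes. The hypothesis
  \<open>agree\<close> supplies every frame condition in the step, so invariants mention only what
  the loop changes.\<close>

lemma For_invariant:
  assumes wf: "wf_loops (For v e P)"
    and base: "I 0 (nats_upd v 0 0 0 s)"
    and step: "\<And>k t. k < nval e s \<Longrightarrow> nats t v 0 0 = k \<Longrightarrow> agree (insert v (nmods P)) (rmods P) s t \<Longrightarrow>
      I k t \<Longrightarrow> I (Suc k) (nats_upd v 0 0 (Suc k) (sem P t))"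
  shows "I (nval e s) (sem (For v e P) s)"
proof -
  have v: "v \<notin> nmods P" using wf by simp
  have "k \<le> nval e s \<Longrightarrow> I k (iter v (sem P) s k)" for k
  proof (induction k)
    case 0
    then show ?case using base by (simp add: iter_0)
  next
    case (Suc k)
    have "agree (insert v (nmods P)) (rmods P) s (iter v (sem P) s k)"
      by (auto simp: agree_def intro!: iter_frame iter_frame_reals)
    then show ?case using Suc step[of k "iter v (sem P) s k"] v by (simp add: iter_sem_Suc iter_var)
  qed
  then show ?thesis by simp
qed

text \<open>The arbitrary \<open>y\<close> in the assumption says that the summand does not depend
  on the accumulator being updated.\<close>

lemma sem_For_sum:
  assumes v: "v \<noteq> 0" "v \<notin> nreads i" "v \<notin> nreads j"
    and r: "\<And>k y. rval r (reals_upd a (nval i s) (nval j s) y (nats_upd v 0 0 k s)) = F k"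
  shows "sem (For v (nvar 0) (RSet a i j (RPlus (RElem a i j) r))) s =
    reals_upd a (nval i s) (nval j s)
      (reals s a (nval i s) (nval j s) + (\<Sum>k<nats s 0 0 0. F k)) (nats_upd v 0 0 (nats s 0 0 0) s)"
proof -
  have ij: "nval i (nats_upd v 0 0 n t) = nval i t" "nval j (nats_upd v 0 0 n t) = nval j t" for n t
    by (rule nval_cong; rule upd_other; use v in blast)+
  have ij2: "nval e (reals_upd b k l y t) = nval e t" for e b k l y t by (rule nval_cong) simp
  define g where "g k = reals s a (nval i s) (nval j s) + (\<Sum>l<k. F l)" for k
  let ?P = "RSet a i j (RPlus (RElem a i j) r)"
  have "iter v (sem ?P) s n = reals_upd a (nval i s) (nval j s) (g n) (nats_upd v 0 0 n s)" for n
  proof (induction n)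
    case 0
    show ?case by (rule state_eqI) (auto simp: iter_0 g_def)
  next
    case (Suc n)
    then show ?case
      unfolding iter_Suc Suc by (intro state_eqI) (auto simp: ij ij2 g_def r)
  qed
  then show ?thesis by (simp add: g_def)
qed

fun tests :: "nat list \<Rightarrow> bexp \<Rightarrow> nat \<Rightarrow> prog" where
  "tests [] b f = Test b (NSet f (NConst 0) (NConst 0) (NConst 1)) Nop"
| "tests (v # vs) b f = For v (nvar 0) (tests vs b f)"

fun some_index :: "nat list \<Rightarrow> (state \<Rightarrow> bool) \<Rightarrow> state \<Rightarrow> bool" where
  "some_index [] Q s = Q s"
| "some_index (v # vs) Q s = (\<exists>i<nats s 0 0 0. some_index vs Q (nats_upd v 0 0 i s))"

definition agree_scalars :: "nat set \<Rightarrow> state \<Rightarrow> state \<Rightarrow> bool" where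
  "agree_scalars X s t \<longleftrightarrow> reals s = reals t \<and>
     (\<forall>a i j. a \<notin> X \<or> (i, j) \<noteq> (0, 0) \<longrightarrow> nats s a i j = nats t a i j)"

text \<open>Inside nested loops the state differs from a fresh assignment of the counters by stale
  inner counters and possibly a raised flag. Stale counters are overwritten before use and
  \<open>Q\<close> ignores the flag.\<close>

lemma some_index_agree:
  assumes Q: "\<And>s n. Q (nats_upd f 0 0 n s) = Q s" and "0 \<notin> insert f (set vs)"
    "agree_scalars (insert f (set vs)) s t"
  shows "some_index vs Q s = some_index vs Q t"
  using assms(2-)
proof (induction vs arbitrary: s t)
  case Nil
  have "t = nats_upd f 0 0 (nats t f 0 0) s"
    using Nil by (intro state_eqI) (auto simp: agree_scalars_def)
  then show ?case using Q by (metis some_index.simps(1))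
next
  case (Cons v vs)
  have "agree_scalars (insert f (set vs)) (nats_upd v 0 0 i s) (nats_upd v 0 0 i t)" for i
    using Cons.prems by (auto simp: agree_scalars_def)
  then have "some_index vs Q (nats_upd v 0 0 i s) = some_index vs Q (nats_upd v 0 0 i t)" for i
    using Cons by auto
  moreover have "nats s 0 0 0 = nats t 0 0 0" using Cons.prems by (auto simp: agree_scalars_def)
  ultimately show ?case by simp
qed

lemma mods_tests [simp]: "nmods (tests vs b f) = insert f (set vs)" "rmods (tests vs b f) = {}"
  by (induction vs) auto

lemma flat_tests [simp]: "flat_loops (tests vs b f)"
  by (induction vs) auto

lemma wf_tests [simp]: "distinct (f # 0 # vs) \<Longrightarrow> wf_loops (tests vs b f)"
  by (induction vs) auto

lemma sem_tests:
  assumes Q: "\<And>s n. bval b (nats_upd f 0 0 n s) = bval b s" and "distinct (f # 0 # vs)"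
  shows "agree_scalars (insert f (set vs)) s (sem (tests vs b f) s) \<and>
    (nats (sem (tests vs b f) s) f 0 0 \<noteq> 0 \<longleftrightarrow> nats s f 0 0 \<noteq> 0 \<or> some_index vs (bval b) s)"
  using assms(2)
proof (induction vs arbitrary: s)
  case Nil
  show ?case by (auto simp: agree_scalars_def)
next
  case (Cons v vs)
  note d = Cons.prems
  have wf: "wf_loops (For v (nvar 0) (tests vs b f))"
    using d wf_tests[of f "v # vs" b] by simp
  have "(\<lambda>k t. agree_scalars (insert f (set (v # vs))) s t \<and>
     (nats t f 0 0 \<noteq> 0 \<longleftrightarrow> nats s f 0 0 \<noteq> 0 \<or> (\<exists>i<k. some_index vs (bval b) (nats_upd v 0 0 i s))))
     (nval (nvar 0) s) (sem (For v (nvar 0) (tests vs b f)) s)"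
  proof (rule For_invariant[OF wf], goal_cases)
    case 1
    then show ?case using d by (auto simp: agree_scalars_def)
  next
    case (2 k t)
    let ?u = "sem (tests vs b f) t"
    have IH: "agree_scalars (insert f (set vs)) t ?u"
      "nats ?u f 0 0 \<noteq> 0 \<longleftrightarrow> nats t f 0 0 \<noteq> 0 \<or> some_index vs (bval b) t"
      using Cons.IH[of t] d by auto
    have "agree_scalars (insert f (set vs)) t (nats_upd v 0 0 k s)"
      using 2 by (auto simp: agree_scalars_def)
    then have "some_index vs (bval b) t = some_index vs (bval b) (nats_upd v 0 0 k s)"
      using d by (intro some_index_agree[of "bval b" f vs t "nats_upd v 0 0 k s", OF Q]) auto
    with 2(4) IH(2) have "nats ?u f 0 0 \<noteq> 0 \<longleftrightarrow>
        nats s f 0 0 \<noteq> 0 \<or> (\<exists>i<Suc k. some_index vs (bval b) (nats_upd v 0 0 i s))"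
      by (simp add: Ex_less_Suc disj_ac)
    moreover have "agree_scalars (insert f (set (v # vs))) s (nats_upd v 0 0 (Suc k) ?u)"
      using 2(4) IH(1) by (simp add: agree_scalars_def)
    moreover have "f \<noteq> v" using d by auto
    ultimately show ?case by simp
  qed
  then show ?case by simp
qed

section \<open>Checking a profile\<close>

abbreviation BOr :: "bexp \<Rightarrow> bexp \<Rightarrow> bexp" where
  "BOr b c \<equiv> BNot (BAnd (BNot b) (BNot c))"

abbreviation REq :: "rexp \<Rightarrow> rexp \<Rightarrow> bexp" where
  "REq d e \<equiv> BAnd (BNot (RLess d e)) (BNot (RLess e d))"

abbreviation NNeq :: "nexp \<Rightarrow> nexp \<Rightarrow> bexp" where
  "NNeq d e \<equiv> BOr (NLess d e) (NLess e d)"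

abbreviation RPos :: "rexp \<Rightarrow> bexp" where
  "RPos e \<equiv> RLess (RConst 0) e"

definition seg_test :: "rexp \<Rightarrow> rexp \<Rightarrow> rexp \<Rightarrow> rexp \<Rightarrow> bexp" where
  "seg_test a b a' b' =
     BOr (BAnd (RPos a) (RPos a')) (BOr (BAnd (RPos b) (RPos b'))
       (BOr (BAnd (RPos a) (BAnd (RPos b') (RLess (RTimes b a') (RTimes a b'))))
            (BAnd (RPos b) (BAnd (RPos a') (RLess (RTimes a b') (RTimes b a'))))))"

lemma bval_seg_test: "bval (seg_test a b a' b') s \<longleftrightarrow> seg_pos (rval a s) (rval b s) (rval a' s) (rval b' s)"
  by (auto simp: seg_test_def seg_pos_def)

definition vertex_exp :: "(nat \<Rightarrow> nat \<Rightarrow> rexp) \<Rightarrow> (nat \<Rightarrow> nat \<Rightarrow> rexp) \<Rightarrow> rexp" where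
  "vertex_exp f g =
     (let x = RMinus (RMinus (RPlus (RTimes (f 0 0) (g 1 1)) (RTimes (f 1 0) (g 0 1)))
                (RTimes (f 0 1) (g 1 0))) (RTimes (f 1 1) (g 0 0));
          y = RMinus (RTimes (f 0 0) (g 0 1)) (RTimes (f 0 1) (g 0 0));
          z = RMinus (RTimes (f 1 0) (g 1 1)) (RTimes (f 1 1) (g 1 0))
      in RDiv (RMinus (RTimes (RConst 2) y) x) (RTimes (RConst 2) (RPlus (RMinus y x) z)))"

lemma rval_vertex_exp: "rval (vertex_exp f g) s = block_vertex (\<lambda>k l. rval (f k l) s) (\<lambda>k l. rval (g k l) s)"
  by (simp add: vertex_exp_def block_vertex_def Let_def)

definition block_test :: "(nat \<Rightarrow> nat \<Rightarrow> rexp) \<Rightarrow> (nat \<Rightarrow> nat \<Rightarrow> rexp) \<Rightarrow> bexp" where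
  "block_test f g =
     (let c = vertex_exp f g;
          mix = (\<lambda>d e. RPlus (RTimes (RMinus (RConst 1) c) d) (RTimes c e))
      in BOr (seg_test (f 0 0) (f 0 1) (g 0 0) (g 0 1)) (BOr (seg_test (f 1 0) (f 1 1) (g 1 0) (g 1 1))
        (BOr (seg_test (f 0 0) (f 1 0) (g 0 0) (g 1 0)) (BOr (seg_test (f 0 1) (f 1 1) (g 0 1) (g 1 1))
          (BAnd (RPos c) (BAnd (RLess c (RConst 1))
            (seg_test (mix (f 0 0) (f 1 0)) (mix (f 0 1) (f 1 1)) (mix (g 0 0) (g 1 0)) (mix (g 0 1) (g 1 1)))))))))"

lemma bval_block_test:
  "bval (block_test f g) s \<longleftrightarrow> block_pos (\<lambda>k l. rval (f k l) s) (\<lambda>k l. rval (g k l) s)"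
  by (simp add: block_test_def block_pos_def Let_def bval_seg_test rval_vertex_exp)

text \<open>Memory layout. Naturals: 0 holds \<open>m\<close>, 1 the flag raised by a failed check, 2 the flag for success,
  3 the number of rows of the table, 4 a snapshot of it, 5 to 8 action or row indices, 9 and 10
  row indices, 11 and 12 round counters, 13 a column index.
  Reals: rows 1 and 2 of array 0 hold the candidate profile, arrays 1 and 2 the game, array 3 the table of
  candidate strategies, rows 1 and 2 of array 4 the payoffs of the actions against the candidate,
  and column 0 of array 5 the two payoffs and the two total weights of the candidate.\<close>

definition total :: "nat \<Rightarrow> nat \<Rightarrow> rexp \<Rightarrow> prog" where
  "total k v e = Then (RSet 5 (NConst k) (NConst 0) (RConst 0))
     (For v (nvar 0) (RSet 5 (NConst k) (NConst 0) (RPlus (RElem 5 (NConst k) (NConst 0)) e)))"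

definition row_totals :: "nat \<Rightarrow> rexp \<Rightarrow> prog" where
  "row_totals k e = For 5 (nvar 0) (Then (RSet 4 (NConst k) (nvar 5) (RConst 0))
     (For 6 (nvar 0) (RSet 4 (NConst k) (nvar 5) (RPlus (RElem 4 (NConst k) (nvar 5)) e))))"

abbreviation weight :: "nat \<Rightarrow> nat \<Rightarrow> rexp" where
  "weight k v \<equiv> RElem 0 (NConst k) (nvar v)"

abbreviation scalar :: "nat \<Rightarrow> rexp" where
  "scalar k \<equiv> RElem 5 (NConst k) (NConst 0)"

abbreviation action_payoff :: "nat \<Rightarrow> rexp" where
  "action_payoff k \<equiv> RElem 4 (NConst k) (nvar 5)"

definition block_entry :: "nat \<Rightarrow> nat \<Rightarrow> nat \<Rightarrow> rexp" where
  "block_entry a k l = RMinus (RElem a (nvar (if k = 0 then 5 else 6)) (nvar (if l = 0 then 7 else 8))) (scalar a)"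

definition failure :: bexp where
  "failure = BOr (RLess (weight 1 5) (RConst 0)) (BOr (RLess (weight 2 5) (RConst 0))
     (BOr (BNot (REq (scalar 3) (RConst 1))) (BOr (BNot (REq (scalar 4) (RConst 1)))
     (BOr (RLess (scalar 1) (action_payoff 1)) (BOr (RLess (scalar 2) (action_payoff 2))
       (block_test (block_entry 1) (block_entry 2)))))))"

definition prepare :: prog where
  "prepare = Then (total 3 5 (weight 1 5)) (Then (total 4 5 (weight 2 5))
     (Then (row_totals 1 (RTimes (weight 2 6) (RElem 1 (nvar 5) (nvar 6))))
     (Then (row_totals 2 (RTimes (weight 1 6) (RElem 2 (nvar 6) (nvar 5))))
     (Then (total 1 5 (RTimes (weight 1 5) (action_payoff 1)))
       (total 2 5 (RTimes (weight 2 5) (action_payoff 2)))))))"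

abbreviation reset :: "nat \<Rightarrow> prog" where
  "reset v \<equiv> NSet v (NConst 0) (NConst 0) (NConst 0)"

abbreviation raise :: "nat \<Rightarrow> prog" where
  "raise v \<equiv> NSet v (NConst 0) (NConst 0) (NConst 1)"

definition check :: prog where
  "check = Then prepare (Then (reset 1) (tests [5, 6, 7, 8] failure 1))"

lemma mods_prepare [simp]: "nmods prepare = {5, 6}" "rmods prepare = {4, 5}"
  by (auto simp: prepare_def total_def row_totals_def)

lemma mods_check [simp]: "nmods check = {1, 5, 6, 7, 8}" "rmods check = {4, 5}"
  by (auto simp: check_def)

lemma loops_check [simp]: "wf_loops check" "flat_loops check"
  by (auto simp: check_def prepare_def total_def row_totals_def)

lemma sem_total:
  assumes "v \<noteq> 0" "\<And>l y. rval e (reals_upd 5 k 0 y (nats_upd v 0 0 l s)) = F l"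
  shows "sem (total k v e) s = reals_upd 5 k 0 (\<Sum>l<nats s 0 0 0. F l) (nats_upd v 0 0 (nats s 0 0 0) s)"
proof -
  have eq: "reals_upd 5 k 0 y (nats_upd v 0 0 l (reals_upd 5 k 0 z s)) = reals_upd 5 k 0 y (nats_upd v 0 0 l s)"
    for y z l by (rule state_eqI) auto
  show ?thesis
    unfolding total_def sem.simps(3,4)
    by (subst sem_For_sum[where F = F]) (use assms in \<open>simp_all add: eq\<close>)
qed

lemma sem_row_totals:
  assumes e: "\<And>t i j. agree {5, 6} {4} s t \<Longrightarrow> nats t 5 0 0 = i \<Longrightarrow> nats t 6 0 0 = j \<Longrightarrow> rval e t = F i j"
  shows "(\<forall>i<nats s 0 0 0. reals (sem (row_totals k e) s) 4 k i = (\<Sum>j<nats s 0 0 0. F i j)) \<and>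
    (\<forall>l. l \<noteq> k \<longrightarrow> reals (sem (row_totals k e) s) 4 l = reals s 4 l)"
proof -
  let ?m = "nats s 0 0 0"
  have "(\<lambda>n t. (\<forall>i<n. reals t 4 k i = (\<Sum>j<?m. F i j)) \<and> (\<forall>l. l \<noteq> k \<longrightarrow> reals t 4 l = reals s 4 l))
     (nval (nvar 0) s) (sem (row_totals k e) s)"
    unfolding row_totals_def
  proof (rule For_invariant, goal_cases)
    case (3 n t)
    have ag: "agree {5, 6} {4} s t" using 3 by (simp add: insert_commute)
    then have m: "nats t 0 0 0 = ?m" by (simp add: agree_def)
    let ?t = "reals_upd 4 k n 0 t"
    have "sem (For 6 (nvar 0) (RSet 4 (NConst k) (nvar 5) (RPlus (RElem 4 (NConst k) (nvar 5)) e))) ?t =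
       reals_upd 4 k n (\<Sum>j<?m. F n j) (nats_upd 6 0 0 ?m ?t)"
    proof (subst sem_For_sum[where F = "F n"], goal_cases)
      case (4 j y)
      show ?case
        by (rule e) (use ag 3 in \<open>auto simp: agree_def\<close>)
    qed (use 3 m in auto)
    then show ?case using 3 by (auto simp: less_Suc_eq fun_eq_iff)
  qed auto
  then show ?thesis by simp
qed

lemma sem_prepare:
  fixes s :: state
  defines "m \<equiv> nats s 0 0 0" and "p \<equiv> reals s 0 1" and "q \<equiv> reals s 0 2"
    and "t \<equiv> sem prepare s"
  shows "reals t 5 1 0 = payoff m (reals s 1) p q" "reals t 5 2 0 = payoff m (reals s 2) p q"
    "reals t 5 3 0 = (\<Sum>i<m. p i)" "reals t 5 4 0 = (\<Sum>i<m. q i)"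
    "i < m \<Longrightarrow> reals t 4 1 i = (\<Sum>j<m. q j * reals s 1 i j)"
    "i < m \<Longrightarrow> reals t 4 2 i = (\<Sum>j<m. p j * reals s 2 j i)"
proof -
  define s1 where "s1 = sem (total 3 5 (weight 1 5)) s"
  define s2 where "s2 = sem (total 4 5 (weight 2 5)) s1"
  define s3 where "s3 = sem (row_totals 1 (RTimes (weight 2 6) (RElem 1 (nvar 5) (nvar 6)))) s2"
  define s4 where "s4 = sem (row_totals 2 (RTimes (weight 1 6) (RElem 2 (nvar 6) (nvar 5)))) s3"
  define s5 where "s5 = sem (total 1 5 (RTimes (weight 1 5) (action_payoff 1))) s4"
  have t: "t = sem (total 2 5 (RTimes (weight 2 5) (action_payoff 2))) s5"
    by (simp add: t_def prepare_def s5_def s4_def s3_def s2_def s1_def)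
  have s1: "s1 = reals_upd 5 3 0 (\<Sum>i<m. p i) (nats_upd 5 0 0 m s)"
    unfolding s1_def m_def by (rule sem_total) (auto simp: p_def)
  have s2: "s2 = reals_upd 5 4 0 (\<Sum>i<m. q i) (nats_upd 5 0 0 m s1)"
    unfolding s2_def by (subst sem_total[where F = q]) (auto simp: q_def s1 m_def)
  have f3: "nats s3 0 = nats s2 0" "reals s3 0 = reals s2 0" "reals s3 1 = reals s2 1" "reals s3 2 = reals s2 2" "reals s3 5 = reals s2 5"
    unfolding s3_def by (rule sem_frame sem_frame_reals; simp add: row_totals_def)+
  have f4: "nats s4 0 = nats s3 0" "reals s4 0 = reals s3 0" "reals s4 1 = reals s3 1" "reals s4 2 = reals s3 2" "reals s4 5 = reals s3 5"
    unfolding s4_def by (rule sem_frame sem_frame_reals; simp add: row_totals_def)+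
  have m2: "nats s2 0 0 0 = m" by (simp add: s2 s1 m_def)
  have r2: "reals s2 0 = reals s 0" "reals s2 1 = reals s 1" "reals s2 2 = reals s 2" by (simp_all add: s2 s1)
  have s3: "\<forall>i<m. reals s3 4 1 i = (\<Sum>j<m. q j * reals s 1 i j)"
    unfolding s3_def m2[symmetric]
    by (rule sem_row_totals[THEN conjunct1]) (auto simp: agree_def r2 q_def simp del: One_nat_def)
  have m3: "nats s3 0 0 0 = m" by (simp add: f3 m2)
  have "(\<forall>i<nats s3 0 0 0. reals s4 4 2 i = (\<Sum>j<nats s3 0 0 0. p j * reals s 2 j i)) \<and>
      (\<forall>l. l \<noteq> 2 \<longrightarrow> reals s4 4 l = reals s3 4 l)"
    unfolding s4_def by (rule sem_row_totals) (auto simp: agree_def f3 r2 p_def simp del: One_nat_def)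
  then have s4: "\<forall>i<m. reals s4 4 2 i = (\<Sum>j<m. p j * reals s 2 j i)" "reals s4 4 1 = reals s3 4 1"
    by (simp_all add: m3)
  have s5: "s5 = reals_upd 5 1 0 (\<Sum>i<m. p i * reals s4 4 1 i) (nats_upd 5 0 0 m s4)"
    unfolding s5_def by (subst sem_total[where F = "\<lambda>i. p i * reals s4 4 1 i"]) (auto simp: p_def m2 r2 f3 f4)
  have t': "t = reals_upd 5 2 0 (\<Sum>i<m. q i * reals s4 4 2 i) (nats_upd 5 0 0 m s5)"
    unfolding t by (subst sem_total[where F = "\<lambda>i. q i * reals s4 4 2 i"]) (auto simp: q_def m2 r2 f3 f4 s5)
  show "reals t 5 1 0 = payoff m (reals s 1) p q" unfolding payoff_row using s3 s4 by (simp add: t' s5)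
  show "reals t 5 2 0 = payoff m (reals s 2) p q" unfolding payoff_col using s4 by (simp add: t' s5)
  show "reals t 5 3 0 = (\<Sum>i<m. p i)" "reals t 5 4 0 = (\<Sum>i<m. q i)" by (simp_all add: t' s5 f3 f4 s2 s1)
  show "i < m \<Longrightarrow> reals t 4 1 i = (\<Sum>j<m. q j * reals s 1 i j)"
    "i < m \<Longrightarrow> reals t 4 2 i = (\<Sum>j<m. p j * reals s 2 j i)"
    using s3 s4 by (simp_all add: t' s5)
qed

text \<open>All conditions are put under one fourfold quantifier to match the four nested loops of
  \<open>check\<close>; \<open>i\<close> doubles as action of either agent and as row of a block.
  With \<open>m = 0\<close> no index would exist to expose a failure.\<close>

lemma equilibrium_iff_blocks:
  assumes "0 < m"
  shows "equilibrium m A B p q \<longleftrightarrow>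
    \<not> (\<exists>i<m. \<exists>i'<m. \<exists>j<m. \<exists>j'<m. p i < 0 \<or> q i < 0 \<or> (\<Sum>i<m. q i) \<noteq> 1 \<or> (\<Sum>i<m. p i) \<noteq> 1 \<or>
      payoff m A p q < (\<Sum>j<m. q j * A i j) \<or> payoff m B p q < (\<Sum>j<m. p j * B j i) \<or>
      block_pos (sub_block A (payoff m A p q) i i' j j') (sub_block B (payoff m B p q) i i' j j'))"
    (is "_ \<longleftrightarrow> \<not> ?R")
proof
  assume eq: "equilibrium m A B p q"
  show "\<not> ?R"
  proof
    assume ?R
    then obtain i i' j j' where ij: "i < m" "i' < m" "j < m" "j' < m"
      and bad: "p i < 0 \<or> q i < 0 \<or> (\<Sum>i<m. q i) \<noteq> 1 \<or> (\<Sum>i<m. p i) \<noteq> 1 \<or>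
      payoff m A p q < (\<Sum>j<m. q j * A i j) \<or> payoff m B p q < (\<Sum>j<m. p j * B j i) \<or>
      block_pos (sub_block A (payoff m A p q) i i' j j') (sub_block B (payoff m B p q) i i' j j')"
      by blast
    have "\<not> block_pos (sub_block A (payoff m A p q) i i' j j') (sub_block B (payoff m B p q) i i' j j')"
      using eq ij unfolding equilibrium_def dominated_iff by simp
    moreover have "0 \<le> p i" "0 \<le> q i" "(\<Sum>i<m. q i) = 1" "(\<Sum>i<m. p i) = 1"
      "(\<Sum>j<m. q j * A i j) \<le> payoff m A p q" "(\<Sum>j<m. p j * B j i) \<le> payoff m B p q"
      using eq ij by (simp_all add: equilibrium_def mixed_strategy_def)
    ultimately show False using bad by (simp only: not_less[symmetric]) simp
  qed
next
  assume n: "\<not> ?R"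
  have N: "0 \<le> p i \<and> 0 \<le> q i \<and> (\<Sum>i<m. q i) = 1 \<and> (\<Sum>i<m. p i) = 1 \<and>
      (\<Sum>j<m. q j * A i j) \<le> payoff m A p q \<and> (\<Sum>j<m. p j * B j i) \<le> payoff m B p q"
    if "i < m" for i
    using n that assms by (meson not_le)
  show "equilibrium m A B p q"
    unfolding equilibrium_def dominated_iff unfolding mixed_strategy_def
  proof (intro conjI allI impI)
    show "\<not> (\<exists>i<m. \<exists>i'<m. \<exists>j<m. \<exists>j'<m.
        block_pos (sub_block A (payoff m A p q) i i' j j') (sub_block B (payoff m B p q) i i' j j'))"
      using n by blast
  qed (use N assms in blast)+
qed

lemma sem_check:
  fixes s :: state
  assumes m: "0 < nats s 0 0 0"
  shows "nats (sem check s) 1 0 0 = 0 \<longleftrightarrow>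
    equilibrium (nats s 0 0 0) (reals s 1) (reals s 2) (reals s 0 1) (reals s 0 2)"
proof -
  define t where "t = nats_upd 1 0 0 0 (sem prepare s)"
  let ?m = "nats s 0 0 0" and ?p = "reals s 0 1" and ?q = "reals s 0 2"
  have fr: "nats t 0 = nats s 0" "reals t 0 = reals s 0" "reals t 1 = reals s 1" "reals t 2 = reals s 2"
    by (simp_all add: t_def)
  have vals: "reals t 5 1 0 = payoff ?m (reals s 1) ?p ?q" "reals t 5 2 0 = payoff ?m (reals s 2) ?p ?q"
    "reals t 5 3 0 = (\<Sum>i<?m. ?p i)" "reals t 5 4 0 = (\<Sum>i<?m. ?q i)"
    "i < ?m \<Longrightarrow> reals t 4 1 i = (\<Sum>j<?m. ?q j * reals s 1 i j)"
    "i < ?m \<Longrightarrow> reals t 4 2 i = (\<Sum>j<?m. ?p j * reals s 2 j i)" for i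
    using sem_prepare[where s = s] by (simp_all add: t_def)
  have bv: "bval failure u \<longleftrightarrow> reals u 0 1 (nats u 5 0 0) < 0 \<or> reals u 0 2 (nats u 5 0 0) < 0 \<or>
      reals u 5 3 0 \<noteq> 1 \<or> reals u 5 4 0 \<noteq> 1 \<or> reals u 5 1 0 < reals u 4 1 (nats u 5 0 0) \<or>
      reals u 5 2 0 < reals u 4 2 (nats u 5 0 0) \<or>
      block_pos (sub_block (reals u 1) (reals u 5 1 0) (nats u 5 0 0) (nats u 6 0 0) (nats u 7 0 0) (nats u 8 0 0))
        (sub_block (reals u 2) (reals u 5 2 0) (nats u 5 0 0) (nats u 6 0 0) (nats u 7 0 0) (nats u 8 0 0))" for u
  proof -
    have "(\<lambda>k l. rval (block_entry a k l) u) =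
        sub_block (reals u a) (reals u 5 a 0) (nats u 5 0 0) (nats u 6 0 0) (nats u 7 0 0) (nats u 8 0 0)" for a
      by (auto simp: block_entry_def sub_block_def fun_eq_iff)
    then show ?thesis unfolding failure_def by (auto simp: bval_block_test)
  qed
  have "nats (sem check s) 1 0 0 \<noteq> 0 \<longleftrightarrow> some_index [5, 6, 7, 8] (bval failure) t"
    using sem_tests[of failure 1 "[5, 6, 7, 8]" t] by (simp add: check_def t_def bv)
  also have "\<dots> \<longleftrightarrow> \<not> equilibrium ?m (reals s 1) (reals s 2) ?p ?q"
    unfolding equilibrium_iff_blocks[OF m] by (simp add: bv fr vals cong: conj_cong del: One_nat_def)
  finally show ?thesis by blast
qed

definition degeneracy :: bexp where
  "degeneracy =
     (let entry = (\<lambda>a i j. RElem a (nvar i) (nvar j)) in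
      BOr (BAnd (NNeq (nvar 5) (nvar 6)) (BOr (REq (entry 1 5 7) (entry 1 6 7)) (REq (entry 2 5 7) (entry 2 6 7))))
     (BOr (BAnd (NNeq (nvar 7) (nvar 8)) (BOr (REq (entry 1 5 7) (entry 1 5 8)) (REq (entry 2 5 7) (entry 2 5 8))))
       (BAnd (BAnd (NNeq (nvar 5) (nvar 6)) (NNeq (nvar 7) (nvar 8)))
         (REq (RTimes (RMinus (entry 1 6 7) (entry 1 5 7)) (RMinus (entry 2 5 8) (entry 2 5 7)))
              (RTimes (RMinus (entry 1 5 8) (entry 1 5 7)) (RMinus (entry 2 6 7) (entry 2 5 7)))))))"

definition check_degenerate :: prog where
  "check_degenerate = Then (reset 1) (tests [5, 6, 7, 8] degeneracy 1)"

lemma mods_check_degenerate [simp]: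
  "nmods check_degenerate = {1, 5, 6, 7, 8}" "rmods check_degenerate = {}"
  "wf_loops check_degenerate" "flat_loops check_degenerate"
  by (auto simp: check_degenerate_def)

lemma sem_check_degenerate:
  "nats (sem check_degenerate s) 1 0 0 \<noteq> 0 \<longleftrightarrow> degenerate (nats s 0 0 0) (reals s)"
proof -
  have eq: "x = y \<longleftrightarrow> \<not> x < y \<and> \<not> y < x" for x y :: real by auto
  have neq: "x \<noteq> y \<longleftrightarrow> x < y \<or> y < x" for x y :: nat by auto
  have bv: "bval degeneracy u \<longleftrightarrow>
      degenerate_at (reals u 1) (reals u 2) (nats u 5 0 0) (nats u 6 0 0) (nats u 7 0 0) (nats u 8 0 0)" for u
    by (simp add: degeneracy_def degenerate_at_def Let_def neq eq)
  have "nats (sem check_degenerate s) 1 0 0 \<noteq> 0 \<longleftrightarrow> some_index [5, 6, 7, 8] (bval degeneracy) (nats_upd 1 0 0 0 s)"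
    using sem_tests[of degeneracy 1 "[5, 6, 7, 8]" "nats_upd 1 0 0 0 s"] by (simp add: check_degenerate_def bv)
  also have "\<dots> \<longleftrightarrow> degenerate (nats s 0 0 0) (reals s)"
    by (simp add: bv degenerate_def)
  finally show ?thesis .
qed

section \<open>Exhaustive search\<close>

definition load_candidate :: prog where
  "load_candidate = For 13 (nvar 0)
     (Then (RSet 0 (NConst 1) (nvar 13) (RElem 3 (nvar 9) (nvar 13)))
       (RSet 0 (NConst 2) (nvar 13) (RElem 3 (nvar 10) (nvar 13))))"

text \<open>The loops cannot be left early. The guard makes later candidates a no-op after a
  success, which protects the profile stored in array 0.\<close>

definition try_candidate :: prog where
  "try_candidate = Test (NLess (nvar 2) (NConst 1))
     (Then load_candidate (Then check (Test (NLess (nvar 1) (NConst 1)) (raise 2) Nop))) Nop"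

text \<open>The bound is \<open>m\<close> for the pure profiles, where the table holds the unit
  vectors, and the length of the table for the exhaustive search.\<close>

definition search :: "nexp \<Rightarrow> prog" where
  "search e = For 9 e (For 10 e try_candidate)"

lemma mods_search [simp]:
  "nmods load_candidate = {13}" "rmods load_candidate = {0}"
  "nmods try_candidate = {1, 2, 5, 6, 7, 8, 13}" "rmods try_candidate = {0, 4, 5}"
  "nmods (search e) = {1, 2, 5, 6, 7, 8, 9, 10, 13}" "rmods (search e) = {0, 4, 5}"
  by (auto simp: load_candidate_def try_candidate_def search_def)

lemma loops_search [simp]:
  "wf_loops try_candidate" "flat_loops try_candidate"
  "nreads e \<inter> {1, 2, 5, 6, 7, 8, 9, 10, 13} = {} \<Longrightarrow> wf_loops (search e)"
  "flat_loops (search (nvar 0))"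
  by (auto simp: load_candidate_def try_candidate_def search_def)

lemma sem_load_candidate:
  assumes "i < nats s 0 0 0"
  shows "reals (sem load_candidate s) 0 1 i = reals s 3 (nats s 9 0 0) i"
    "reals (sem load_candidate s) 0 2 i = reals s 3 (nats s 10 0 0) i"
proof -
  have "(\<lambda>k t. \<forall>i<k. reals t 0 1 i = reals s 3 (nats s 9 0 0) i \<and> reals t 0 2 i = reals s 3 (nats s 10 0 0) i)
     (nval (nvar 0) s) (sem load_candidate s)"
    unfolding load_candidate_def
    by (rule For_invariant) (auto simp: agree_def less_Suc_eq)
  then show "reals (sem load_candidate s) 0 1 i = reals s 3 (nats s 9 0 0) i"
    "reals (sem load_candidate s) 0 2 i = reals s 3 (nats s 10 0 0) i"
    using assms by auto
qed

definition state_equilibrium :: "state \<Rightarrow> (nat \<Rightarrow> real) \<Rightarrow> (nat \<Rightarrow> real) \<Rightarrow> bool" where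
  "state_equilibrium s = equilibrium (nats s 0 0 0) (reals s 1) (reals s 2)"

definition found_ok :: "state \<Rightarrow> bool" where
  "found_ok s \<longleftrightarrow> (nats s 2 0 0 \<noteq> 0 \<longrightarrow> state_equilibrium s (reals s 0 1) (reals s 0 2))"

lemma found_ok_upd [simp]: "v \<noteq> 0 \<Longrightarrow> v \<noteq> 2 \<Longrightarrow> found_ok (nats_upd v i j x s) = found_ok s"
  by (simp add: found_ok_def state_equilibrium_def)

lemma state_equilibrium_sem [simp]:
  "0 \<notin> nmods P \<Longrightarrow> {1, 2} \<inter> rmods P = {} \<Longrightarrow> state_equilibrium (sem P s) = state_equilibrium s"
  by (simp add: state_equilibrium_def)

lemma sem_try_candidate:
  assumes m: "0 < nats s 0 0 0" and ok: "found_ok s"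
  shows "found_ok (sem try_candidate s)"
    "nats (sem try_candidate s) 2 0 0 = 0 \<Longrightarrow> nats s 2 0 0 = 0 \<and>
      \<not> state_equilibrium s (reals s 3 (nats s 9 0 0)) (reals s 3 (nats s 10 0 0))"
proof -
  define t where "t = sem check (sem load_candidate s)"
  have t: "nats t 0 = nats s 0" "nats t 2 = nats s 2" "reals t 1 = reals s 1" "reals t 2 = reals s 2"
    "reals t 0 = reals (sem load_candidate s) 0"
    by (simp_all add: t_def)
  have load: "i < nats s 0 0 0 \<Longrightarrow> reals t 0 1 i = reals s 3 (nats s 9 0 0) i"
    "i < nats s 0 0 0 \<Longrightarrow> reals t 0 2 i = reals s 3 (nats s 10 0 0) i" for i
    by (simp_all add: t sem_load_candidate del: One_nat_def)
  have "nats t 1 0 0 = 0 \<longleftrightarrow> state_equilibrium s (reals t 0 1) (reals t 0 2)"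
    unfolding t_def state_equilibrium_def using sem_check[of "sem load_candidate s"] m by (simp del: One_nat_def)
  moreover have "state_equilibrium s (reals t 0 1) (reals t 0 2) \<longleftrightarrow>
      state_equilibrium s (reals s 3 (nats s 9 0 0)) (reals s 3 (nats s 10 0 0))"
    unfolding state_equilibrium_def by (rule equilibrium_cong) (auto simp: load simp del: One_nat_def)
  ultimately have eq: "nats t 1 0 0 = 0 \<longleftrightarrow> state_equilibrium s (reals t 0 1) (reals t 0 2)"
    "nats t 1 0 0 = 0 \<longleftrightarrow> state_equilibrium s (reals s 3 (nats s 9 0 0)) (reals s 3 (nats s 10 0 0))" by simp_all
  have sem: "sem try_candidate s = (if nats s 2 0 0 = 0 then if nats t 1 0 0 = 0 then nats_upd 2 0 0 1 t else t else s)"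
    by (simp add: try_candidate_def t_def)
  show "found_ok (sem try_candidate s)"
    unfolding sem using ok eq(1) by (auto simp: found_ok_def state_equilibrium_def t simp del: One_nat_def)
  show "nats (sem try_candidate s) 2 0 0 = 0 \<Longrightarrow> nats s 2 0 0 = 0 \<and>
      \<not> state_equilibrium s (reals s 3 (nats s 9 0 0)) (reals s 3 (nats s 10 0 0))"
    unfolding sem using eq(2) by (auto split: if_splits)
qed

lemma sem_search:
  assumes m: "0 < nats s 0 0 0" and ok: "found_ok s" and e: "nreads e \<inter> {1, 2, 5, 6, 7, 8, 9, 10, 13} = {}"
  defines "t \<equiv> sem (search e) s"
  shows "found_ok t" "nats t 2 0 0 = 0 \<Longrightarrow> a < nval e s \<Longrightarrow> b < nval e s \<Longrightarrow>
    \<not> state_equilibrium s (reals s 3 a) (reals s 3 b)"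
proof -
  have ne: "nval e u = nval e s" if "agree {1, 2, 5, 6, 7, 8, 9, 10, 13} {0, 4, 5} s u" for u
  proof (rule nval_cong)
    fix a assume "a \<in> nreads e"
    then have "a \<notin> {1, 2, 5, 6, 7, 8, 9, 10, 13}" using e by blast
    then show "nats u a = nats s a" using that unfolding agree_def by blast
  qed
  define n where "n = nval e s"
  have "(\<lambda>k t. found_ok t \<and> (nats t 2 0 0 = 0 \<longrightarrow>
      (\<forall>a<k. \<forall>b<n. \<not> state_equilibrium s (reals s 3 a) (reals s 3 b)))) (nval e s) (sem (search e) s)"
    unfolding search_def
  proof (rule For_invariant, goal_cases)
    case 1
    show ?case using loops_search(3)[OF e] by (simp add: search_def)
  next
    case 2
    show ?case using ok by simp
  next
    case (3 k t)
    have ag: "agree {1, 2, 5, 6, 7, 8, 9, 10, 13} {0, 4, 5} s t"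
      using 3(3) by (auto simp: agree_def)
    have wf: "wf_loops (For 10 e try_candidate)" using loops_search(3)[OF e] by (simp add: search_def)
    have "(\<lambda>l u. found_ok u \<and> (nats u 2 0 0 = 0 \<longrightarrow> nats t 2 0 0 = 0 \<and>
      (\<forall>b<l. \<not> state_equilibrium s (reals s 3 k) (reals s 3 b)))) (nval e t) (sem (For 10 e try_candidate) t)"
    proof (rule For_invariant[OF wf], goal_cases)
      case 1
      then show ?case using 3 by simp
    next
      case (2 l u)
      have fr: "nats u 0 = nats s 0" "reals u 1 = reals s 1" "reals u 2 = reals s 2" "reals u 3 = reals s 3"
        "nats u 9 0 0 = k" "nats u 10 0 0 = l"
        using 2 3 by (auto simp: agree_def)
      have "0 < nats u 0 0 0" "found_ok u" using fr m 2 by auto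
      from sem_try_candidate[OF this] have
        "found_ok (sem try_candidate u)" "nats (sem try_candidate u) 2 0 0 = 0 \<longrightarrow> nats u 2 0 0 = 0 \<and>
         \<not> state_equilibrium s (reals s 3 k) (reals s 3 l)"
        by (auto simp: fr state_equilibrium_def simp del: One_nat_def)
      then show ?case using 2(4) by (auto simp: less_Suc_eq)
    qed
    then show ?case using 3(4) unfolding ne[OF ag] n_def[symmetric] by (auto simp: less_Suc_eq)
  qed
  then show "found_ok t" "nats t 2 0 0 = 0 \<Longrightarrow> a < nval e s \<Longrightarrow> b < nval e s \<Longrightarrow>
    \<not> state_equilibrium s (reals s 3 a) (reals s 3 b)"
    unfolding t_def n_def by auto
qed

text \<open>The table only grows, so closing it under arithmetic is expressed by inclusions.\<close>

definition has_row :: "state \<Rightarrow> (nat \<Rightarrow> real) \<Rightarrow> bool" where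
  "has_row s x \<longleftrightarrow> (\<exists>r<nats s 3 0 0. \<forall>h<nats s 0 0 0. reals s 3 r h = x h)"

definition extends :: "state \<Rightarrow> state \<Rightarrow> bool" where
  "extends s t \<longleftrightarrow> nats t 0 = nats s 0 \<and> nats s 3 0 0 \<le> nats t 3 0 0 \<and>
     (\<forall>r<nats s 3 0 0. reals t 3 r = reals s 3 r)"

lemma extends_refl [simp]: "extends s s"
  by (simp add: extends_def)

lemma extends_trans: "extends s t \<Longrightarrow> extends t u \<Longrightarrow> extends s u"
  by (auto simp: extends_def)

lemma extends_upd [simp]: "v \<noteq> 0 \<Longrightarrow> v \<noteq> 3 \<Longrightarrow> extends s (nats_upd v i j x t) = extends s t"
  by (simp add: extends_def)

lemma has_row_upd [simp]: "v \<noteq> 0 \<Longrightarrow> v \<noteq> 3 \<Longrightarrow> has_row (nats_upd v i j x t) z = has_row t z"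
  by (simp add: has_row_def)

lemma has_row_extends: "extends s t \<Longrightarrow> has_row s x \<Longrightarrow> has_row t x"
  unfolding extends_def has_row_def by (metis order_less_le_trans)

text \<open>Copies the row selected by counter 5 to the end of the table and replaces the entry in
  the column selected by counter 7. \<open>e\<close> is evaluated after the copy, which is harmless
  as long as the operand rows lie below the new one.\<close>

definition append_row :: "rexp \<Rightarrow> prog" where
  "append_row e = Then (For 13 (nvar 0) (RSet 3 (nvar 3) (nvar 13) (RElem 3 (nvar 5) (nvar 13))))
     (Then (RSet 3 (nvar 3) (nvar 7) e) (NSet 3 (NConst 0) (NConst 0) (NPlus (nvar 3) (NConst 1))))"

definition append_rows :: prog where
  "append_rows = (let x = RElem 3 (nvar 5) (nvar 7); y = RElem 3 (nvar 6) (nvar 8)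
     in Then (append_row (RMinus x y)) (Then (append_row (RTimes x y)) (append_row (RDiv x y))))"

text \<open>The table grows during the pass, so both row loops run up to the snapshot of its length;
  counter 3 itself would violate \<open>wf_loops\<close> and keep moving the bound.\<close>

definition round_pass :: prog where
  "round_pass = Then (NSet 4 (NConst 0) (NConst 0) (nvar 3))
     (For 5 (nvar 4) (For 6 (nvar 4) (For 7 (nvar 0) (For 8 (nvar 0) append_rows))))"

lemma mods_rows [simp]:
  "nmods (append_row e) = {3, 13}" "rmods (append_row e) = {3}" "wf_loops (append_row e)"
  "nmods append_rows = {3, 13}" "rmods append_rows = {3}" "wf_loops append_rows"
  "nmods round_pass = {3, 4, 5, 6, 7, 8, 13}" "rmods round_pass = {3}" "wf_loops round_pass"
  by (auto simp: append_row_def append_rows_def round_pass_def Let_def)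

lemma sem_append_row:
  assumes e: "\<And>t. (\<forall>a. a \<noteq> 13 \<longrightarrow> nats t a = nats s a) \<Longrightarrow>
      (\<forall>r. r \<noteq> nats s 3 0 0 \<longrightarrow> reals t 3 r = reals s 3 r) \<Longrightarrow> rval e t = y"
  defines "t \<equiv> sem (append_row e) s" and "r0 \<equiv> nats s 3 0 0"
  shows "nats t 3 0 0 = r0 + 1" "r \<noteq> r0 \<Longrightarrow> reals t 3 r = reals s 3 r"
    "nats s 5 0 0 \<noteq> r0 \<Longrightarrow> h < nats s 0 0 0 \<Longrightarrow>
      reals t 3 r0 h = (if h = nats s 7 0 0 then y else reals s 3 (nats s 5 0 0) h)"
proof -
  let ?P = "For 13 (nvar 0) (RSet 3 (nvar 3) (nvar 13) (RElem 3 (nvar 5) (nvar 13)))"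
  define u where "u = sem ?P s"
  have "(\<lambda>k u. (\<forall>r. r \<noteq> r0 \<longrightarrow> reals u 3 r = reals s 3 r) \<and>
      (nats s 5 0 0 \<noteq> r0 \<longrightarrow> (\<forall>h<k. reals u 3 r0 h = reals s 3 (nats s 5 0 0) h)))
     (nval (nvar 0) s) (sem ?P s)"
    by (rule For_invariant) (auto simp: agree_def less_Suc_eq r0_def fun_eq_iff)
  then have u: "\<And>r. r \<noteq> r0 \<Longrightarrow> reals u 3 r = reals s 3 r"
    "nats s 5 0 0 \<noteq> r0 \<Longrightarrow> h < nats s 0 0 0 \<Longrightarrow> reals u 3 r0 h = reals s 3 (nats s 5 0 0) h" for h
    by (auto simp: u_def)
  have un: "\<forall>a. a \<noteq> 13 \<longrightarrow> nats u a = nats s a" unfolding u_def by (intro allI impI sem_frame) simp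
  have "rval e u = y" using un u(1) by (intro e) (auto simp: r0_def)
  moreover have "t = sem (Then (RSet 3 (nvar 3) (nvar 7) e)
      (NSet 3 (NConst 0) (NConst 0) (NPlus (nvar 3) (NConst 1)))) u"
    unfolding t_def append_row_def u_def by (simp only: sem.simps(4))
  ultimately have t: "t = nats_upd 3 0 0 (r0 + 1) (reals_upd 3 r0 (nats s 7 0 0) y u)"
    using un by (simp add: r0_def)
  show "nats t 3 0 0 = r0 + 1" by (simp add: t)
  show "r \<noteq> r0 \<Longrightarrow> reals t 3 r = reals s 3 r" using u(1)[of r] by (simp add: t fun_eq_iff)
  show "nats s 5 0 0 \<noteq> r0 \<Longrightarrow> h < nats s 0 0 0 \<Longrightarrow>
      reals t 3 r0 h = (if h = nats s 7 0 0 then y else reals s 3 (nats s 5 0 0) h)"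
    using u(2)[of h] by (simp add: t)
qed

lemma append_row_extends:
  fixes op :: "real \<Rightarrow> real \<Rightarrow> real"
  assumes op: "\<And>s. rval e s = op (reals s 3 (nats s 5 0 0) (nats s 7 0 0)) (reals s 3 (nats s 6 0 0) (nats s 8 0 0))"
    and r: "nats s 5 0 0 < nats s 3 0 0" "nats s 6 0 0 < nats s 3 0 0"
  shows "extends s (sem (append_row e) s)"
    "has_row (sem (append_row e) s) ((reals s 3 (nats s 5 0 0))(nats s 7 0 0 :=
       op (reals s 3 (nats s 5 0 0) (nats s 7 0 0)) (reals s 3 (nats s 6 0 0) (nats s 8 0 0))))"
proof -
  define y where "y = op (reals s 3 (nats s 5 0 0) (nats s 7 0 0)) (reals s 3 (nats s 6 0 0) (nats s 8 0 0))"
  have e: "rval e t = y"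
    if "\<forall>a. a \<noteq> 13 \<longrightarrow> nats t a = nats s a" "\<forall>r. r \<noteq> nats s 3 0 0 \<longrightarrow> reals t 3 r = reals s 3 r" for t
  proof -
    have "nats t 5 = nats s 5" "nats t 6 = nats s 6" "nats t 7 = nats s 7" "nats t 8 = nats s 8"
      by (rule that(1)[rule_format]; simp)+
    moreover have "reals t 3 (nats s 5 0 0) = reals s 3 (nats s 5 0 0)"
      "reals t 3 (nats s 6 0 0) = reals s 3 (nats s 6 0 0)"
      by (rule that(2)[rule_format]; use r in simp)+
    ultimately show ?thesis by (simp only: op y_def)
  qed
  define t where "t = sem (append_row e) s"
  have A: "nats t 3 0 0 = nats s 3 0 0 + 1" "\<And>r. r \<noteq> nats s 3 0 0 \<Longrightarrow> reals t 3 r = reals s 3 r"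
    "\<And>h. h < nats s 0 0 0 \<Longrightarrow> reals t 3 (nats s 3 0 0) h = (if h = nats s 7 0 0 then y else reals s 3 (nats s 5 0 0) h)"
  proof -
    show "nats t 3 0 0 = nats s 3 0 0 + 1" unfolding t_def by (rule sem_append_row(1)[where y = y]) (rule e)
    show "reals t 3 r = reals s 3 r" if "r \<noteq> nats s 3 0 0" for r
      unfolding t_def by (rule sem_append_row(2)[where y = y]) (rule e that; assumption)+
    show "reals t 3 (nats s 3 0 0) h = (if h = nats s 7 0 0 then y else reals s 3 (nats s 5 0 0) h)"
      if "h < nats s 0 0 0" for h
      unfolding t_def by (rule sem_append_row(3)) (rule e that less_imp_neq r; assumption?)+
  qed
  have n0: "nats t 0 = nats s 0" by (simp add: t_def)
  show "extends s (sem (append_row e) s)"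
    unfolding extends_def t_def[symmetric] using A(1,2) n0 by simp
  show "has_row (sem (append_row e) s) ((reals s 3 (nats s 5 0 0))(nats s 7 0 0 :=
       op (reals s 3 (nats s 5 0 0) (nats s 7 0 0)) (reals s 3 (nats s 6 0 0) (nats s 8 0 0))))"
    unfolding has_row_def t_def[symmetric] y_def[symmetric]
  proof (intro exI conjI allI impI)
    show "nats s 3 0 0 < nats t 3 0 0" using A(1) by simp
    fix h assume "h < nats t 0 0 0"
    then show "reals t 3 (nats s 3 0 0) h = ((reals s 3 (nats s 5 0 0))(nats s 7 0 0 := y)) h"
      using A(3)[of h] n0 by simp
  qed
qed

definition row_ops :: "(nat \<Rightarrow> real) \<Rightarrow> (nat \<Rightarrow> real) \<Rightarrow> nat \<Rightarrow> nat \<Rightarrow> (nat \<Rightarrow> real) set" where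
  "row_ops x y i j = {x(i := x i - y j), x(i := x i * y j), x(i := x i / y j)}"

lemma sem_append_rows:
  assumes r: "nats s 5 0 0 < nats s 3 0 0" "nats s 6 0 0 < nats s 3 0 0"
    and i: "nats s 7 0 0 < nats s 0 0 0" "nats s 8 0 0 < nats s 0 0 0"
  shows "extends s (sem append_rows s)"
    "z \<in> row_ops (reals s 3 (nats s 5 0 0)) (reals s 3 (nats s 6 0 0)) (nats s 7 0 0) (nats s 8 0 0) \<Longrightarrow>
      has_row (sem append_rows s) z"
proof -
  let ?x = "RElem 3 (nvar 5) (nvar 7)" and ?y = "RElem 3 (nvar 6) (nvar 8)"
  let ?T = "\<lambda>op s. (reals s 3 (nats s 5 0 0))(nats s 7 0 0 :=
       op (reals s 3 (nats s 5 0 0) (nats s 7 0 0)) (reals s 3 (nats s 6 0 0) (nats s 8 0 0)))"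
  define s1 where "s1 = sem (append_row (RMinus ?x ?y)) s"
  define s2 where "s2 = sem (append_row (RTimes ?x ?y)) s1"
  define s3 where "s3 = sem (append_row (RDiv ?x ?y)) s2"
  have s3: "sem append_rows s = s3" by (simp add: append_rows_def Let_def s3_def s2_def s1_def)
  have same: "has_row u (?T op s') = has_row u (?T op s)"
    if "extends s s'" "nats u 0 = nats s 0" "nats s' 5 = nats s 5" "nats s' 6 = nats s 6" "nats s' 7 = nats s 7" "nats s' 8 = nats s 8"
    for u s' and op :: "real \<Rightarrow> real \<Rightarrow> real"
    using that r i by (auto simp: has_row_def extends_def)
  have e1: "extends s s1" "has_row s1 (?T (-) s)"
    unfolding s1_def by (rule append_row_extends[OF _ r]; simp)+
  have v1: "nats s1 5 = nats s 5" "nats s1 6 = nats s 6" "nats s1 7 = nats s 7" "nats s1 8 = nats s 8" "nats s1 0 = nats s 0"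
    by (simp_all add: s1_def)
  have r1: "nats s1 5 0 0 < nats s1 3 0 0" "nats s1 6 0 0 < nats s1 3 0 0" using r e1(1) v1 by (auto simp: extends_def)
  have e2: "extends s1 s2" "has_row s2 (?T (*) s1)"
    unfolding s2_def by (rule append_row_extends[OF _ r1]; simp)+
  have v2: "nats s2 5 = nats s 5" "nats s2 6 = nats s 6" "nats s2 7 = nats s 7" "nats s2 8 = nats s 8" "nats s2 0 = nats s 0"
    by (simp_all add: s2_def v1)
  have r2: "nats s2 5 0 0 < nats s2 3 0 0" "nats s2 6 0 0 < nats s2 3 0 0" using r1 e2(1) v1 v2 by (auto simp: extends_def)
  have e3: "extends s2 s3" "has_row s3 (?T (/) s2)"
    unfolding s3_def by (rule append_row_extends[OF _ r2]; simp)+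
  have v3: "nats s3 0 = nats s 0" by (simp add: s3_def v2)
  have e12: "extends s s2" using extends_trans[OF e1(1) e2(1)] .
  show "extends s (sem append_rows s)" unfolding s3 using extends_trans[OF e12 e3(1)] .
  have "has_row s3 (?T (-) s)" using has_row_extends[OF e3(1)] has_row_extends[OF e2(1)] e1(2) by blast
  moreover have "has_row s3 (?T (*) s)"
    using has_row_extends[OF e3(1) e2(2)] same[OF e1(1) v3 v1(1-4), of "(*)"] by blast
  moreover have "has_row s3 (?T (/) s)"
    using e3(2) same[OF e12 v3 v2(1-4), of "(/)"] by blast
  ultimately show "z \<in> row_ops (reals s 3 (nats s 5 0 0)) (reals s 3 (nats s 6 0 0)) (nats s 7 0 0) (nats s 8 0 0) \<Longrightarrow>
      has_row (sem append_rows s) z"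
    unfolding s3 row_ops_def by auto
qed

text \<open>A row written in pass \<open>r\<close> survives because every later pass only extends
  the table. \<open>C\<close> is the context in which the body is known to do so; the lemma is used
  once for each of the four nested loops.\<close>

lemma For_hit:
  assumes wf: "wf_loops (For v e P)" and v: "v \<noteq> 0" "v \<noteq> 3"
    and ext: "\<And>t. C t \<Longrightarrow> nats t v 0 0 < nval e s \<Longrightarrow> extends t (sem P t)"
    and C: "\<And>t. agree (insert v (nmods P)) (rmods P) s t \<Longrightarrow> extends s t \<Longrightarrow> C t"
  shows "extends s (sem (For v e P) s)"
    "(\<And>t. agree (insert v (nmods P)) (rmods P) s t \<Longrightarrow> extends s t \<Longrightarrow> nats t v 0 0 = r \<Longrightarrow> has_row (sem P t) z) \<Longrightarrow>
      r < nval e s \<Longrightarrow> has_row (sem (For v e P) s) z"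
proof -
  have ext_iter: "extends s (nats_upd v 0 0 (Suc k) (sem P t))"
    if "k < nval e s" "nats t v 0 0 = k" "agree (insert v (nmods P)) (rmods P) s t" "extends s t" for k t
    using that v extends_trans[OF that(4) ext[OF C[OF that(3,4)]]] by simp
  show "extends s (sem (For v e P) s)"
    by (rule For_invariant[where I = "\<lambda>k t. extends s t", OF wf]) (use v ext_iter in auto)
  assume hit: "\<And>t. agree (insert v (nmods P)) (rmods P) s t \<Longrightarrow> extends s t \<Longrightarrow> nats t v 0 0 = r \<Longrightarrow> has_row (sem P t) z"
    and r: "r < nval e s"
  have "(\<lambda>k t. extends s t \<and> (r < k \<longrightarrow> has_row t z)) (nval e s) (sem (For v e P) s)"
  proof (rule For_invariant[OF wf], goal_cases)
    case 1
    show ?case using v by simp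
  next
    case (2 k t)
    have "has_row (sem P t) z" if "r < Suc k"
    proof (cases "k = r")
      case True
      then show ?thesis using hit 2 by blast
    next
      case False
      then have "has_row t z" using 2 that by simp
      then show ?thesis using has_row_extends ext[OF C[OF 2(3)]] 2 by blast
    qed
    then show ?case using ext_iter[OF 2(1-3)] 2(4) v by simp
  qed
  then show "has_row (sem (For v e P) s) z" using r by simp
qed

lemma sem_columns_pass:
  fixes s :: state
  assumes r: "nats s 5 0 0 < nats s 3 0 0" "nats s 6 0 0 < nats s 3 0 0" "nats s 7 0 0 < nats s 0 0 0"
  defines "t \<equiv> sem (For 8 (nvar 0) append_rows) s"
  shows "extends s t" "l < nats s 0 0 0 \<Longrightarrow>
    z \<in> row_ops (reals s 3 (nats s 5 0 0)) (reals s 3 (nats s 6 0 0)) (nats s 7 0 0) l \<Longrightarrow> has_row t z"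
proof -
  let ?C = "\<lambda>u. agree {3, 8, 13} {3} s u \<and> extends s u"
  have ctx: "nats u 5 0 0 < nats u 3 0 0" "nats u 6 0 0 < nats u 3 0 0" "nats u 7 0 0 < nats u 0 0 0"
    "nats u 0 = nats s 0" "nats u 5 = nats s 5" "nats u 6 = nats s 6" "nats u 7 = nats s 7"
    "reals u 3 (nats s 5 0 0) = reals s 3 (nats s 5 0 0)" "reals u 3 (nats s 6 0 0) = reals s 3 (nats s 6 0 0)"
    if "?C u" for u
    using that r by (auto simp: agree_def extends_def)
  have wf: "wf_loops (For 8 (nvar 0) append_rows)" by simp
  have ext: "extends u (sem append_rows u)" if "?C u" "nats u 8 0 0 < nval (nvar 0) s" for u
    by (rule sem_append_rows(1)) (use ctx[OF that(1)] that(2) in simp_all)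
  have C: "?C u" if "agree (insert 8 (nmods append_rows)) (rmods append_rows) s u" "extends s u" for u
    using that by (simp add: insert_commute)
  note hit = For_hit[where C = ?C, OF wf _ _ ext C]
  show "extends s t" unfolding t_def by (rule hit(1)) auto
  assume l: "l < nats s 0 0 0" and z: "z \<in> row_ops (reals s 3 (nats s 5 0 0)) (reals s 3 (nats s 6 0 0)) (nats s 7 0 0) l"
  show "has_row t z" unfolding t_def
  proof (rule hit(2)[where r = l])
    fix u assume u: "agree (insert 8 (nmods append_rows)) (rmods append_rows) s u" "extends s u" "nats u 8 0 0 = l"
    note c = ctx[OF C[OF u(1,2)]]
    show "has_row (sem append_rows u) z"
      by (rule sem_append_rows(2)) (use c u(3) l z in simp_all)
  qed (use l in auto)
qed

lemma sem_entry_pass: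
  fixes s :: state
  assumes r: "nats s 5 0 0 < nats s 3 0 0" "nats s 6 0 0 < nats s 3 0 0"
  defines "P \<equiv> For 8 (nvar 0) append_rows"
  defines "t \<equiv> sem (For 7 (nvar 0) P) s"
  shows "extends s t" "k < nats s 0 0 0 \<Longrightarrow> l < nats s 0 0 0 \<Longrightarrow>
    z \<in> row_ops (reals s 3 (nats s 5 0 0)) (reals s 3 (nats s 6 0 0)) k l \<Longrightarrow> has_row t z"
proof -
  let ?C = "\<lambda>u. agree {3, 7, 8, 13} {3} s u \<and> extends s u"
  have ctx: "nats u 5 0 0 < nats u 3 0 0" "nats u 6 0 0 < nats u 3 0 0"
    "nats u 0 = nats s 0" "nats u 5 = nats s 5" "nats u 6 = nats s 6"
    "reals u 3 (nats s 5 0 0) = reals s 3 (nats s 5 0 0)" "reals u 3 (nats s 6 0 0) = reals s 3 (nats s 6 0 0)"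
    if "?C u" for u
    using that r by (auto simp: agree_def extends_def)
  have wf: "wf_loops (For 7 (nvar 0) P)" by (simp add: P_def)
  have ext: "extends u (sem P u)" if "?C u" "nats u 7 0 0 < nval (nvar 0) s" for u
    unfolding P_def by (rule sem_columns_pass(1)) (use ctx[OF that(1)] that(2) in simp_all)
  have C: "?C u" if "agree (insert 7 (nmods P)) (rmods P) s u" "extends s u" for u
    using that by (simp add: insert_commute P_def)
  note hit = For_hit[where C = ?C, OF wf _ _ ext C]
  show "extends s t" unfolding t_def by (rule hit(1)) auto
  assume kl: "k < nats s 0 0 0" "l < nats s 0 0 0" and z: "z \<in> row_ops (reals s 3 (nats s 5 0 0)) (reals s 3 (nats s 6 0 0)) k l"
  show "has_row t z" unfolding t_def
  proof (rule hit(2)[where r = k])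
    fix u assume u: "agree (insert 7 (nmods P)) (rmods P) s u" "extends s u" "nats u 7 0 0 = k"
    note c = ctx[OF C[OF u(1,2)]]
    show "has_row (sem P u) z"
      unfolding P_def by (rule sem_columns_pass(2)[where l = l]) (use c u(3) kl z in simp_all)
  qed (use kl in auto)
qed

lemma sem_second_row_pass:
  fixes s :: state
  assumes r: "nats s 5 0 0 < nats s 3 0 0" "nats s 4 0 0 \<le> nats s 3 0 0"
  defines "P \<equiv> For 7 (nvar 0) (For 8 (nvar 0) append_rows)"
  defines "t \<equiv> sem (For 6 (nvar 4) P) s"
  shows "extends s t" "b < nats s 4 0 0 \<Longrightarrow> k < nats s 0 0 0 \<Longrightarrow> l < nats s 0 0 0 \<Longrightarrow>
    z \<in> row_ops (reals s 3 (nats s 5 0 0)) (reals s 3 b) k l \<Longrightarrow> has_row t z"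
proof -
  let ?C = "\<lambda>u. agree {3, 6, 7, 8, 13} {3} s u \<and> extends s u"
  have ctx: "nats u 5 0 0 < nats u 3 0 0" "nats s 4 0 0 \<le> nats u 3 0 0"
    "nats u 0 = nats s 0" "nats u 5 = nats s 5"
    "reals u 3 (nats s 5 0 0) = reals s 3 (nats s 5 0 0)" "b < nats s 4 0 0 \<Longrightarrow> reals u 3 b = reals s 3 b"
    if "?C u" for u b
    using that r by (auto simp: agree_def extends_def)
  have wf: "wf_loops (For 6 (nvar 4) P)" by (simp add: P_def)
  have ext: "extends u (sem P u)" if "?C u" "nats u 6 0 0 < nval (nvar 4) s" for u
    unfolding P_def by (rule sem_entry_pass(1)) (use ctx[OF that(1)] that(2) in simp_all)
  have C: "?C u" if "agree (insert 6 (nmods P)) (rmods P) s u" "extends s u" for u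
    using that by (simp add: insert_commute P_def)
  note hit = For_hit[where C = ?C, OF wf _ _ ext C]
  show "extends s t" unfolding t_def by (rule hit(1)) auto
  assume b: "b < nats s 4 0 0" and kl: "k < nats s 0 0 0" "l < nats s 0 0 0"
    and z: "z \<in> row_ops (reals s 3 (nats s 5 0 0)) (reals s 3 b) k l"
  show "has_row t z" unfolding t_def
  proof (rule hit(2)[where r = b])
    fix u assume u: "agree (insert 6 (nmods P)) (rmods P) s u" "extends s u" "nats u 6 0 0 = b"
    note c = ctx[OF C[OF u(1,2)]]
    show "has_row (sem P u) z"
      unfolding P_def by (rule sem_entry_pass(2)[where k = k and l = l]) (use c u(3) kl b z in simp_all)
  qed (use b in auto)
qed

lemma sem_round_pass:
  fixes s :: state
  shows "extends s (sem round_pass s)"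
    "a < nats s 3 0 0 \<Longrightarrow> b < nats s 3 0 0 \<Longrightarrow> k < nats s 0 0 0 \<Longrightarrow> l < nats s 0 0 0 \<Longrightarrow>
      z \<in> row_ops (reals s 3 a) (reals s 3 b) k l \<Longrightarrow> has_row (sem round_pass s) z"
proof -
  define P where "P = For 6 (nvar 4) (For 7 (nvar 0) (For 8 (nvar 0) append_rows))"
  define s' where "s' = nats_upd 4 0 0 (nats s 3 0 0) s"
  have sem: "sem round_pass s = sem (For 5 (nvar 4) P) s'" by (simp add: round_pass_def P_def s'_def)
  have s': "nats s' 0 = nats s 0" "nats s' 3 = nats s 3" "nats s' 4 0 0 = nats s 3 0 0" "reals s' = reals s"
    by (simp_all add: s'_def)
  let ?C = "\<lambda>u. agree {3, 5, 6, 7, 8, 13} {3} s' u \<and> extends s' u"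
  have ctx: "nats s' 3 0 0 \<le> nats u 3 0 0" "nats u 4 = nats s' 4"
    "nats u 0 = nats s 0" "b < nats s 3 0 0 \<Longrightarrow> reals u 3 b = reals s 3 b"
    if "?C u" for u b
    using that s' by (auto simp: agree_def extends_def)
  have wf: "wf_loops (For 5 (nvar 4) P)" by (simp add: P_def)
  have ext: "extends u (sem P u)" if "?C u" "nats u 5 0 0 < nval (nvar 4) s'" for u
    unfolding P_def by (rule sem_second_row_pass(1)) (use ctx[OF that(1)] that(2) s' in simp_all)
  have C: "?C u" if "agree (insert 5 (nmods P)) (rmods P) s' u" "extends s' u" for u
    using that by (simp add: insert_commute P_def)
  note hit = For_hit[where C = ?C, OF wf _ _ ext C]
  have "extends s' (sem round_pass s)" unfolding sem by (rule hit(1)) auto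
  then show "extends s (sem round_pass s)" by (simp add: extends_def s')
  assume ab: "a < nats s 3 0 0" "b < nats s 3 0 0" and kl: "k < nats s 0 0 0" "l < nats s 0 0 0"
    and z: "z \<in> row_ops (reals s 3 a) (reals s 3 b) k l"
  show "has_row (sem round_pass s) z" unfolding sem
  proof (rule hit(2)[where r = a])
    fix u assume u: "agree (insert 5 (nmods P)) (rmods P) s' u" "extends s' u" "nats u 5 0 0 = a"
    note c = ctx[OF C[OF u(1,2)]]
    show "has_row (sem P u) z"
      unfolding P_def by (rule sem_second_row_pass(2)[where b = b and k = k and l = l])
        (use c(1-3) c(4)[of a] c(4)[of b] u(3) kl ab z s' in simp_all)
  qed (use ab s' in auto)
qed

section \<open>Rounds on the table versus levels of arithmetic\<close>

definition close_rows :: "nat \<Rightarrow> (nat \<Rightarrow> real) set \<Rightarrow> (nat \<Rightarrow> real) set" where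
  "close_rows m V = V \<union> (\<Union>x\<in>V. \<Union>y\<in>V. \<Union>i\<in>{..<m}. \<Union>j\<in>{..<m}. row_ops x y i j)"

definition contains :: "state \<Rightarrow> (nat \<Rightarrow> real) set \<Rightarrow> bool" where
  "contains s V \<longleftrightarrow> (\<forall>x\<in>V. has_row s x)"

lemma contains_upd [simp]: "v \<noteq> 0 \<Longrightarrow> v \<noteq> 3 \<Longrightarrow> contains (nats_upd v i j x t) V = contains t V"
  by (simp add: contains_def)

lemma row_ops_cong:
  assumes "z \<in> row_ops x y i j" "\<And>h. h < m \<Longrightarrow> x' h = x h" "\<And>h. h < m \<Longrightarrow> y' h = y h" "i < m" "j < m"
  shows "\<exists>z'\<in>row_ops x' y' i j. \<forall>h<m. z' h = z h"
  using assms by (auto simp: row_ops_def)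

lemma contains_round_pass:
  assumes "contains s V"
  shows "contains (sem round_pass s) (close_rows (nats s 0 0 0) V)"
  unfolding contains_def close_rows_def
proof
  let ?m = "nats s 0 0 0" and ?t = "sem round_pass s"
  have m: "nats ?t 0 = nats s 0" by simp
  fix z assume "z \<in> V \<union> (\<Union>x\<in>V. \<Union>y\<in>V. \<Union>i\<in>{..<?m}. \<Union>j\<in>{..<?m}. row_ops x y i j)"
  then consider "z \<in> V" | x y i j where "x \<in> V" "y \<in> V" "i < ?m" "j < ?m" "z \<in> row_ops x y i j" by blast
  then show "has_row ?t z"
  proof cases
    case 1
    then show ?thesis using assms has_row_extends[OF sem_round_pass(1)] by (simp add: contains_def)
  next
    case 2
    obtain a where a: "a < nats s 3 0 0" "\<And>h. h < ?m \<Longrightarrow> reals s 3 a h = x h"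
      using assms 2(1) by (auto simp: contains_def has_row_def)
    obtain b where b: "b < nats s 3 0 0" "\<And>h. h < ?m \<Longrightarrow> reals s 3 b h = y h"
      using assms 2(2) by (auto simp: contains_def has_row_def)
    obtain z' where z': "z' \<in> row_ops (reals s 3 a) (reals s 3 b) i j" "\<forall>h<?m. z' h = z h"
      using row_ops_cong[OF 2(5) a(2) b(2) 2(3,4)] by blast
    have "has_row ?t z'" using sem_round_pass(2)[OF a(1) b(1) 2(3,4) z'(1)] .
    then show ?thesis using z'(2) by (simp add: has_row_def m)
  qed
qed

text \<open>The number \<open>(m + 4)\<^sup>2\<close> of rounds suffices for the \<open>1 + (m + 2) (m + 4)\<close> levels of
  \<open>equilibrium_level\<close> plus \<open>m + 1\<close> rounds to assemble a vector from its coordinates.\<close>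

definition rounds :: prog where
  "rounds = (let e = NPlus (nvar 0) (NConst 4) in For 11 e (For 12 e round_pass))"

lemma mods_rounds [simp]:
  "nmods rounds = {3, 4, 5, 6, 7, 8, 11, 12, 13}" "rmods rounds = {3}" "wf_loops rounds"
  by (auto simp: rounds_def Let_def)

lemma contains_rounds:
  assumes "contains s V" and m: "m = nats s 0 0 0"
  shows "contains (sem rounds s) ((close_rows m ^^ ((m + 4) * (m + 4))) V)"
proof -
  let ?e = "NPlus (nvar 0) (NConst 4)"
  define n where "n = m + 4"
  have ne: "nval ?e u = n" if "nats u 0 = nats s 0" for u using that m by (simp add: n_def)
  have "(\<lambda>k t. contains t ((close_rows m ^^ (k * n)) V)) (nval ?e s) (sem rounds s)"
    unfolding rounds_def Let_def
  proof (rule For_invariant, goal_cases)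
    case (3 k t)
    have t0: "nats t 0 = nats s 0" using 3(3) by (simp add: agree_def)
    have "(\<lambda>l u. contains u ((close_rows m ^^ (k * n + l)) V)) (nval ?e t) (sem (For 12 ?e round_pass) t)"
    proof (rule For_invariant, goal_cases)
      case (3 l u)
      have "nats u 0 0 0 = m" using 3(3) t0 m by (simp add: agree_def)
      then show ?case using contains_round_pass[OF 3(4)] by simp
    qed (use 3 in auto)
    then show ?case unfolding ne[OF t0] by (simp add: add.commute)
  qed (use assms in auto)
  then show ?thesis unfolding ne[OF refl] by (simp add: n_def)
qed

lemma close_rows_mono: "k \<le> l \<Longrightarrow> (close_rows m ^^ k) V \<subseteq> (close_rows m ^^ l) V"
proof (induction l rule: dec_induct)
  case (step l)
  then show ?case by (auto simp: close_rows_def)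
qed simp

lemma close_rowsI:
  "x \<in> V \<Longrightarrow> y \<in> V \<Longrightarrow> i < m \<Longrightarrow> j < m \<Longrightarrow> z \<in> row_ops x y i j \<Longrightarrow> z \<in> close_rows m V"
  unfolding close_rows_def by blast

text \<open>The result of an operation overwrites its first operand in place, so each level costs
  one round even though the table stores whole rows.\<close>

lemma row_with_level_entry:
  assumes "a \<in> level {x i |x i. x \<in> V \<and> i < m} k"
  shows "\<exists>x\<in>(close_rows m ^^ k) V. \<exists>i<m. x i = a"
  using assms
proof (induction k arbitrary: a)
  case 0
  then show ?case by auto
next
  case (Suc k)
  then obtain b c where bc: "b \<in> level {x i |x i. x \<in> V \<and> i < m} k" "c \<in> level {x i |x i. x \<in> V \<and> i < m} k"
      "a \<in> {b - c, b * c, b / c}" by (auto simp: level.simps(2))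
  obtain x i where x: "x \<in> (close_rows m ^^ k) V" "i < m" "x i = b" using Suc.IH[OF bc(1)] by blast
  obtain y j where y: "y \<in> (close_rows m ^^ k) V" "j < m" "y j = c" using Suc.IH[OF bc(2)] by blast
  have "x(i := a) \<in> row_ops x y i j" using bc(3) x(3) y(3) by (auto simp: row_ops_def)
  then have "x(i := a) \<in> (close_rows m ^^ Suc k) V" using close_rowsI[OF x(1) y(1) x(2) y(2)] by simp
  then show ?case using x(2) by (intro bexI[of _ "x(i := a)"]) auto
qed

text \<open>Starting from the zero row, the coordinates are written one per round, each by
  subtracting \<open>- v j\<close> from 0; the additional round makes these negatives
  available.\<close>

lemma row_of_level_entries:
  assumes m: "0 < m" and V: "(\<lambda>_. 0) \<in> V" and v: "\<And>i. i < m \<Longrightarrow> v i \<in> level {x i |x i. x \<in> V \<and> i < m} k"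
  shows "\<exists>x\<in>(close_rows m ^^ (k + 1 + m)) V. \<forall>i<m. x i = v i"
proof -
  let ?S = "{x i |x i. x \<in> V \<and> i < m}"
  have zero: "0 \<in> ?S" using m V by force
  have "j \<le> m \<Longrightarrow> \<exists>x\<in>(close_rows m ^^ (k + 1 + j)) V. \<forall>i<m. x i = (if i < j then v i else 0)" for j
  proof (induction j)
    case 0
    have "(\<lambda>_. 0) \<in> (close_rows m ^^ (k + 1)) V" using close_rows_mono[of 0 "k + 1" m V] V by auto
    then show ?case by (intro bexI[of _ "\<lambda>_. 0"]) auto
  next
    case (Suc j)
    then obtain x where x: "x \<in> (close_rows m ^^ (k + 1 + j)) V" "\<And>i. i < m \<Longrightarrow> x i = (if i < j then v i else 0)"
      by auto
    have "0 - v j \<in> level ?S (Suc k)" using Suc.prems by (intro level_ops zero_level zero v) auto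
    then obtain y l where y: "y \<in> (close_rows m ^^ Suc k) V" "l < m" "y l = 0 - v j"
      using row_with_level_entry by blast
    have "y \<in> (close_rows m ^^ (k + 1 + j)) V" using y(1) close_rows_mono[of "Suc k" "k + 1 + j" m V] by auto
    then have "x(j := x j - y l) \<in> (close_rows m ^^ Suc (k + 1 + j)) V"
      using close_rowsI[OF x(1) _ _ y(2), of y j "x(j := x j - y l)"] Suc.prems by (simp add: row_ops_def)
    moreover have "\<forall>i<m. (x(j := x j - y l)) i = (if i < Suc j then v i else 0)"
      using x(2) y(3) Suc.prems by (auto simp: less_Suc_eq)
    ultimately show ?case by (intro bexI[of _ "x(j := x j - y l)"]) auto
  qed
  from this[of m] show ?thesis by auto
qed

section \<open>The complete solver\<close>

definition unit_rows :: prog where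
  "unit_rows = For 5 (nvar 0) (RSet 3 (nvar 5) (nvar 5) (RConst 1))"

text \<open>Rows below \<open>m\<close> keep the unit vectors, the next two blocks of
  \<open>m\<close> rows receive the two games, and row \<open>3 * m\<close>, never written, supplies
  the zero vector; hence the length \<open>3 * m + 1\<close>.\<close>

definition fill_table :: prog where
  "fill_table = Then
     (For 5 (nvar 0) (For 6 (nvar 0)
       (Then (RSet 3 (NPlus (nvar 0) (nvar 5)) (nvar 6) (RElem 1 (nvar 5) (nvar 6)))
         (RSet 3 (NPlus (nvar 0) (NPlus (nvar 0) (nvar 5))) (nvar 6) (RElem 2 (nvar 5) (nvar 6))))))
     (NSet 3 (NConst 0) (NConst 0) (NPlus (nvar 0) (NPlus (nvar 0) (NPlus (nvar 0) (NConst 1)))))"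

definition exhaustive :: prog where
  "exhaustive = Then fill_table (Then rounds (search (nvar 3)))"

text \<open>The exhaustive branch runs only if no pure profile succeeded and the game is degenerate.
  The last assignment overwrites \<open>m\<close> by the success flag, as the output format
  requires.\<close>

definition solver :: prog where
  "solver = Then unit_rows (Then (search (nvar 0))
     (Then (Test (NLess (nvar 2) (NConst 1))
         (Then check_degenerate (Test (NLess (NConst 0) (nvar 1)) exhaustive Nop)) Nop)
       (NSet 0 (NConst 0) (NConst 0) (nvar 2))))"

lemma mods_fill [simp]:
  "nmods unit_rows = {5}" "rmods unit_rows = {3}" "nmods fill_table = {3, 5, 6}" "rmods fill_table = {3}"
  "wf_loops unit_rows" "flat_loops unit_rows" "wf_loops fill_table" "wf_loops exhaustive" "wf_loops solver"
  by (auto simp: unit_rows_def fill_table_def exhaustive_def solver_def)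

lemma sem_unit_rows:
  assumes "reals s 3 = (\<lambda>i j. 0)"
  shows "reals (sem unit_rows s) 3 i j = of_bool (i = j \<and> i < nats s 0 0 0)"
proof -
  have "(\<lambda>k t. \<forall>i j. reals t 3 i j = of_bool (i = j \<and> i < k)) (nval (nvar 0) s) (sem unit_rows s)"
    unfolding unit_rows_def by (rule For_invariant) (use assms in \<open>auto simp: less_Suc_eq\<close>)
  then show ?thesis by simp
qed

lemma sem_fill_table:
  fixes s :: state
  defines "m \<equiv> nats s 0 0 0" and "t \<equiv> sem fill_table s"
  shows "nats t 3 0 0 = 3 * m + 1"
    "i < m \<Longrightarrow> j < m \<Longrightarrow> reals t 3 (m + i) j = reals s 1 i j"
    "i < m \<Longrightarrow> j < m \<Longrightarrow> reals t 3 (2 * m + i) j = reals s 2 i j"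
    "r < m \<or> r = 3 * m \<Longrightarrow> reals t 3 r = reals s 3 r"
proof -
  let ?Q = "Then (RSet 3 (NPlus (nvar 0) (nvar 5)) (nvar 6) (RElem 1 (nvar 5) (nvar 6)))
         (RSet 3 (NPlus (nvar 0) (NPlus (nvar 0) (nvar 5))) (nvar 6) (RElem 2 (nvar 5) (nvar 6)))"
  define good where "good t i j \<longleftrightarrow> reals t 3 (m + i) j = reals s 1 i j \<and> reals t 3 (2 * m + i) j = reals s 2 i j"
    for t :: state and i j
  define same where "same t \<longleftrightarrow> (\<forall>r. r < m \<or> r = 3 * m \<longrightarrow> reals t 3 r = reals s 3 r)" for t :: state
  let ?P = "For 5 (nvar 0) (For 6 (nvar 0) ?Q)"
  have "(\<lambda>k t. same t \<and> (\<forall>i<k. \<forall>j<m. good t i j)) (nval (nvar 0) s) (sem ?P s)"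
  proof (rule For_invariant[where I = "\<lambda>k t. same t \<and> (\<forall>i<k. \<forall>j<m. good t i j)"
        and v = 5 and e = "nvar 0" and P = "For 6 (nvar 0) ?Q" and s = s], goal_cases)
    case (3 k t)
    have t: "nats t 0 0 0 = m" "k < m" "reals t 1 = reals s 1" "reals t 2 = reals s 2"
      using 3 by (auto simp: agree_def m_def)
    have "(\<lambda>l u. same u \<and> (\<forall>i<k. \<forall>j<m. good u i j) \<and> (\<forall>j<l. good u k j)) (nval (nvar 0) t) (sem (For 6 (nvar 0) ?Q) t)"
    proof (rule For_invariant[where I = "\<lambda>l u. same u \<and> (\<forall>i<k. \<forall>j<m. good u i j) \<and> (\<forall>j<l. good u k j)"
          and v = 6 and e = "nvar 0" and P = ?Q and s = t], goal_cases)
      case (3 l u)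
      have u: "nats u 0 0 0 = m" "nats u 5 0 0 = k" "nats u 6 0 0 = l" "reals u 1 = reals s 1" "reals u 2 = reals s 2" "l < m"
        using 3(1-3) t \<open>nats t 5 0 0 = k\<close> by (auto simp: agree_def)
      let ?u = "nats_upd 6 0 0 (Suc l) (sem ?Q u)"
      have r: "reals ?u 3 i j = (if i = 2 * m + k \<and> j = l then reals s 2 k l else
          if i = m + k \<and> j = l then reals s 1 k l else reals u 3 i j)" for i j
        using u by simp
      have "same ?u" unfolding same_def
      proof (intro allI impI)
        fix r' assume "r' < m \<or> r' = 3 * m"
        then have "r' \<noteq> 2 * m + k" "r' \<noteq> m + k" "reals u 3 r' = reals s 3 r'"
          using t(2) 3(4) by (auto simp: same_def)
        then show "reals ?u 3 r' = reals s 3 r'" by (intro ext) (simp only: r simp_thms if_False)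
      qed
      moreover have "good ?u i j" if "good u i j \<or> (i = k \<and> j = l)" "i < m" for i j
        using that u t(2) unfolding good_def r by auto
      ultimately show ?case using 3(4) t(2) by (auto simp: less_Suc_eq)
    qed (use 3(4) in \<open>auto simp: same_def good_def\<close>)
    then show ?case using t by (auto simp: less_Suc_eq same_def good_def)
  qed (auto simp: same_def good_def)
  moreover have t: "t = nats_upd 3 0 0 (m + (m + (m + 1))) (sem ?P s)"
  proof -
    have "nats (sem ?P s) 0 = nats s 0" by (rule sem_frame) simp
    then show ?thesis unfolding t_def fill_table_def sem.simps(4) by (simp add: m_def del: sem.simps(6))
  qed
  ultimately show "nats t 3 0 0 = 3 * m + 1"
    "i < m \<Longrightarrow> j < m \<Longrightarrow> reals t 3 (m + i) j = reals s 1 i j"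
    "i < m \<Longrightarrow> j < m \<Longrightarrow> reals t 3 (2 * m + i) j = reals s 2 i j"
    "r < m \<or> r = 3 * m \<Longrightarrow> reals t 3 r = reals s 3 r"
    by (auto simp: m_def same_def good_def simp del: sem.simps)
qed

lemma sem_exhaustive:
  fixes s :: state
  assumes m: "0 < nats s 0 0 0" and ok: "found_ok s"
    and rows: "\<And>i j. reals s 3 i j = of_bool (i = j \<and> i < nats s 0 0 0)"
  shows "found_ok (sem exhaustive s)"
    "nats (sem exhaustive s) 2 0 0 = 0 \<Longrightarrow> \<not> state_equilibrium s p q"
proof -
  define m where "m = nats s 0 0 0"
  define t where "t = sem fill_table s"
  define u where "u = sem rounds t"
  have sem: "sem exhaustive s = sem (search (nvar 3)) u" by (simp add: exhaustive_def t_def u_def)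
  have fr: "nats t 0 = nats s 0" "nats u 0 = nats s 0" "nats u 2 = nats s 2" "reals u 0 = reals s 0"
    "reals u 1 = reals s 1" "reals u 2 = reals s 2"
    by (simp_all add: t_def u_def)
  have eq: "state_equilibrium u = state_equilibrium s" by (simp add: u_def t_def)
  have ok': "found_ok u" using ok by (simp add: found_ok_def fr eq del: One_nat_def)
  have u0: "0 < nats u 0 0 0" using m fr by simp
  note search = sem_search[OF u0 ok', of "nvar 3", folded sem]
  show "found_ok (sem exhaustive s)" by (rule search(1)) simp
  assume none: "nats (sem exhaustive s) 2 0 0 = 0"
  have none: "\<not> state_equilibrium s (reals u 3 a) (reals u 3 b)" if "a < nats u 3 0 0" "b < nats u 3 0 0" for a b
    using search(2)[OF _ none, of a b] that by (simp add: eq)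
  let ?A = "reals s 1" and ?B = "reals s 2"
  define V where "V = insert (\<lambda>_. 0) ((\<lambda>i j. of_bool (i = j)) ` {..<m} \<union> ?A ` {..<m} \<union> ?B ` {..<m})"
  have T: "nats t 3 0 0 = 3 * m + 1" "i < m \<Longrightarrow> j < m \<Longrightarrow> reals t 3 (m + i) j = ?A i j"
    "i < m \<Longrightarrow> j < m \<Longrightarrow> reals t 3 (2 * m + i) j = ?B i j"
    "r < m \<or> r = 3 * m \<Longrightarrow> reals t 3 r = reals s 3 r" for i j r
    using sem_fill_table[where s = s] unfolding t_def m_def by blast+
  have tm: "nats t 0 0 0 = m" by (simp add: fr m_def)
  have "has_row t (\<lambda>_. 0)"
    unfolding has_row_def by (intro exI[of _ "3 * m"]) (use T rows in \<open>auto simp: m_def\<close>)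
  moreover have "has_row t (\<lambda>j. of_bool (i = j))" if "i < m" for i
    unfolding has_row_def by (intro exI[of _ i]) (use T rows that in \<open>auto simp: m_def\<close>)
  moreover have "has_row t (?A i)" if "i < m" for i
    unfolding has_row_def tm by (intro exI[of _ "m + i"]) (use T that in auto)
  moreover have "has_row t (?B i)" if "i < m" for i
    unfolding has_row_def tm by (intro exI[of _ "2 * m + i"]) (use T that in auto)
  ultimately have "contains t V" unfolding contains_def V_def by blast
  then have cu: "contains u ((close_rows m ^^ ((m + 4) * (m + 4))) V)"
    unfolding u_def using contains_rounds tm by metis
  let ?S = "{x i |x i. x \<in> V \<and> i < m}"
  have m0: "0 < m" using m by (simp add: m_def)
  have S: "0 \<in> ?S" "1 \<in> ?S" "i < m \<Longrightarrow> j < m \<Longrightarrow> ?A i j \<in> ?S" "i < m \<Longrightarrow> j < m \<Longrightarrow> ?B i j \<in> ?S" for i j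
  proof -
    have mem: "x i \<in> ?S" if "x \<in> V" "i < m" for x i using that by blast
    show "0 \<in> ?S" using mem[of "\<lambda>_. 0" 0] m0 by (simp add: V_def)
    have "(\<lambda>j. of_bool (0 = j)) \<in> (\<lambda>i j. of_bool (i = j) :: real) ` {..<m}"
      using m0 by (intro image_eqI[of _ _ 0]) auto
    then have "(\<lambda>j. of_bool (0 = j)) \<in> V" unfolding V_def by blast
    from mem[OF this m0] show "1 \<in> ?S" by (simp only: simp_thms of_bool_eq)
    show "?A i j \<in> ?S" "?B i j \<in> ?S" if "i < m" "j < m"
      by (rule mem; use that in \<open>simp add: V_def\<close>)+
  qed
  have row: "\<exists>r<nats u 3 0 0. \<forall>i<m. reals u 3 r i = v i"
    if lv: "\<And>i. i < m \<Longrightarrow> v i \<in> level ?S (1 + (m + 2) * (m + 4))" for v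
  proof -
    have V0: "(\<lambda>_. 0) \<in> V" by (simp add: V_def)
    obtain x where x: "x \<in> (close_rows m ^^ (1 + (m + 2) * (m + 4) + 1 + m)) V" "\<forall>i<m. x i = v i"
      using row_of_level_entries[OF m0 V0, of v "1 + (m + 2) * (m + 4)", OF lv] by blast
    have "1 + (m + 2) * (m + 4) + 1 + m \<le> (m + 4) * (m + 4)" by (simp add: algebra_simps)
    then have "x \<in> (close_rows m ^^ ((m + 4) * (m + 4))) V" using x(1) close_rows_mono by blast
    then have "has_row u x" using cu by (simp add: contains_def)
    then show ?thesis using x(2) fr by (auto simp: has_row_def m_def)
  qed
  show "\<not> state_equilibrium s p q"
  proof
    assume "state_equilibrium s p q"
    then obtain p' q' where pq: "equilibrium m ?A ?B p' q'"
        "\<And>i. i < m \<Longrightarrow> p' i \<in> level ?S (1 + (m + 2) * (m + 4))"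
        "\<And>i. i < m \<Longrightarrow> q' i \<in> level ?S (1 + (m + 2) * (m + 4))"
      using equilibrium_level[where m = m and A = ?A and B = ?B and p = p and q = q, OF S] unfolding state_equilibrium_def m_def[symmetric] by blast
    obtain a where a: "a < nats u 3 0 0" "\<forall>i<m. reals u 3 a i = p' i" using row[of p', OF pq(2)] by blast
    obtain b where b: "b < nats u 3 0 0" "\<forall>i<m. reals u 3 b i = q' i" using row[of q', OF pq(3)] by blast
    have "equilibrium m ?A ?B (reals u 3 a) (reals u 3 b) = equilibrium m ?A ?B p' q'"
      by (rule equilibrium_cong) (use a b in auto)
    then show False using none[OF a(1) b(1)] pq(1) by (simp add: state_equilibrium_def m_def)
  qed
qed

lemma sem_solver:
  fixes s :: state
  defines "t \<equiv> sem solver s"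
  assumes m: "0 < nats s 0 0 0" and init: "reals s 3 = (\<lambda>i j. 0)" "nats s 2 0 0 = 0"
  shows "nats t 0 0 0 \<noteq> 0 \<Longrightarrow> state_equilibrium s (reals t 0 1) (reals t 0 2)"
    "nats t 0 0 0 = 0 \<Longrightarrow> \<not> state_equilibrium s p q"
proof -
  define m where "m = nats s 0 0 0"
  define s1 where "s1 = sem unit_rows s"
  define s2 where "s2 = sem (search (nvar 0)) s1"
  define s3 where "s3 = sem check_degenerate s2"
  define s4 where "s4 = (if nats s2 2 0 0 = 0 then if nats s3 1 0 0 \<noteq> 0 then sem exhaustive s3 else s3 else s2)"
  have t: "t = nats_upd 0 0 0 (nats s4 2 0 0) s4"
    by (simp add: t_def solver_def s4_def s3_def s2_def s1_def)
  have fr: "nats s1 0 = nats s 0" "nats s2 0 = nats s 0" "nats s3 0 = nats s 0" "nats s1 2 = nats s 2"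
    "reals s2 3 = reals s1 3" "reals s3 = reals s2" "reals s2 1 = reals s 1" "reals s2 2 = reals s 2"
    "nats s3 2 = nats s2 2"
    by (simp_all add: s1_def s2_def s3_def fun_eq_iff)
  have eq: "state_equilibrium s1 = state_equilibrium s" "state_equilibrium s2 = state_equilibrium s"
    "state_equilibrium s3 = state_equilibrium s"
    by (simp_all add: s1_def s2_def s3_def)
  have rows: "reals s1 3 i j = of_bool (i = j \<and> i < m)" for i j
    unfolding s1_def m_def by (rule sem_unit_rows[OF init(1)])
  have m1: "0 < nats s1 0 0 0" "0 < nats s3 0 0 0" using m fr by simp_all
  have ok1: "found_ok s1" using init fr by (simp add: found_ok_def)
  note search = sem_search[OF m1(1) ok1, of "nvar 0", folded s2_def]
  have ok2: "found_ok s2" by (rule search(1)) simp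
  have pure: "\<not> state_equilibrium s (reals s1 3 a) (reals s1 3 b)" if "nats s2 2 0 0 = 0" "a < m" "b < m" for a b
    using search(2)[OF _ that(1), of a b] that fr by (simp add: eq m_def)
  have ok3: "found_ok s3" using ok2 by (simp add: found_ok_def fr eq del: One_nat_def)
  have rows3: "reals s3 3 i j = of_bool (i = j \<and> i < nats s3 0 0 0)" for i j
    using rows fr by (simp add: m_def)
  note ex = sem_exhaustive[OF m1(2) ok3 rows3]
  have eq4: "state_equilibrium s4 = state_equilibrium s"
    using eq unfolding s4_def by (auto simp: exhaustive_def)
  have ok4: "found_ok s4" unfolding s4_def using ex(1) ok2 ok3 by simp
  show "nats t 0 0 0 \<noteq> 0 \<Longrightarrow> state_equilibrium s (reals t 0 1) (reals t 0 2)"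
    using ok4 by (simp add: t found_ok_def eq4)
  assume "nats t 0 0 0 = 0"
  then have n4: "nats s4 2 0 0 = 0" by (simp add: t)
  then have n2: "nats s2 2 0 0 = 0" by (auto simp: s4_def split: if_splits)
  show "\<not> state_equilibrium s p q"
  proof (cases "nats s3 1 0 0 = 0")
    case False
    then have "nats (sem exhaustive s3) 2 0 0 = 0" using n4 n2 by (simp add: s4_def)
    from ex(2)[OF this] show ?thesis by (simp add: eq)
  next
    case True
    then have "\<not> degenerate m (reals s2)"
      using sem_check_degenerate[of s2] fr by (simp add: s3_def m_def)
    \<comment> \<open>Nondegeneracy makes every equilibrium pure, and the first search has refuted
      all pure profiles.\<close>
    then have nd: "\<not> (\<exists>i<m. \<exists>i'<m. \<exists>j<m. \<exists>j'<m. degenerate_at (reals s 1) (reals s 2) i i' j j')"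
      unfolding degenerate_def fr .
    show ?thesis
    proof
      assume "state_equilibrium s p q"
      then have e: "equilibrium m (reals s 1) (reals s 2) p q" by (simp add: state_equilibrium_def m_def)
      obtain i j where ij: "i < m" "j < m" "\<And>k. k < m \<Longrightarrow> p k = of_bool (k = i)" "\<And>k. k < m \<Longrightarrow> q k = of_bool (k = j)"
        using equilibrium_pure[OF e nd] by blast
      have "equilibrium m (reals s 1) (reals s 2) (reals s1 3 i) (reals s1 3 j) = equilibrium m (reals s 1) (reals s 2) p q"
        by (rule equilibrium_cong) (use ij rows in auto)
      then show False using pure[OF n2 ij(1,2)] e by (simp add: state_equilibrium_def m_def)
    qed
  qed
qed

section \<open>Correctness on all inputs and expected running time\<close>

lemma degenerate_cong:
  assumes "\<And>k i j. k \<in> {1, 2} \<Longrightarrow> i < m \<Longrightarrow> j < m \<Longrightarrow> U k i j = W k i j"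
  shows "degenerate m U = degenerate m W"
  unfolding degenerate_def degenerate_at_def using assms by (simp cong: conj_cong)

lemma input_state_simps:
  "nats (input_state m U) 0 0 0 = m" "nats (input_state m U) 2 0 0 = 0" "reals (input_state m U) 3 = (\<lambda>i j. 0)"
  "k \<in> {1, 2} \<Longrightarrow> i < m \<Longrightarrow> j < m \<Longrightarrow> reals (input_state m U) k i j = U k i j"
  by (auto simp: input_state_def fun_eq_iff)

lemma solver_solves: "solves (compile solver) find_strong_Nash"
  unfolding solves_def
proof (intro allI impI exI conjI)
  fix m :: nat and U :: game
  assume m: "0 < m"
  let ?s = "input_state m U"
  let ?t = "sem solver ?s"
  show "exec (compile solver) ?s (cost solver ?s) ?t" by (rule exec_compile) simp
  have eq: "state_equilibrium ?s p q = equilibrium m (U 1) (U 2) p q" for p q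
    unfolding state_equilibrium_def by (subst input_state_simps, rule equilibrium_cong) (auto simp: input_state_simps(4))
  have "0 < nats ?s 0 0 0" using m by (simp add: input_state_simps)
  note sol = sem_solver[OF this input_state_simps(3,2), unfolded eq]
  show "find_strong_Nash m U (output_of ?t)"
  proof (cases "nats ?t 0 0 0 = 0")
    case True
    then show ?thesis using sol(2) by (simp add: find_strong_Nash_def output_of_def strong_Nash_equilibrium)
  next
    case False
    then show ?thesis using sol(1) by (simp add: find_strong_Nash_def output_of_def strong_Nash_equilibrium)
  qed
qed

lemma cost_solver_nondegenerate:
  "\<exists>K d. \<forall>m U. \<not> degenerate m U \<longrightarrow> cost solver (input_state m U) \<le> K * (m + 1) ^ d"
proof -
  let ?P = "Then unit_rows (Then (search (nvar 0)) check_degenerate)"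
  have "flat_loops ?P" "0 \<notin> nmods ?P" by simp_all
  then obtain K d where P: "\<And>s. cost ?P s \<le> K * (nats s 0 0 0 + 1) ^ d"
    using cost_polynomial by blast
  have "cost solver (input_state m U) \<le> (K + 20) * (m + 1) ^ d" if nd: "\<not> degenerate m U" for m U
  proof -
    define s where "s = input_state m U"
    define s2 where "s2 = sem (search (nvar 0)) (sem unit_rows s)"
    have "reals s2 1 = reals s 1" "reals s2 2 = reals s 2" "nats s2 0 = nats s 0" by (simp_all add: s2_def)
    then have "degenerate (nats s2 0 0 0) (reals s2) = degenerate m U"
      by (auto intro!: degenerate_cong simp: s_def input_state_simps simp del: One_nat_def)
    then have nd': "nats (sem check_degenerate s2) 1 0 0 = 0" using nd sem_check_degenerate[of s2] by simp
    \<comment> \<open>Beyond \<open>?P\<close> there are at most two tests, one empty branch and the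
      final assignment, costing 5 + 5 + 1 + 6 = 17 units.\<close>
    have "cost solver s \<le> cost ?P s + 20"
      using nd' by (simp add: solver_def s2_def)
    also have "cost ?P s \<le> K * (m + 1) ^ d" using P[of s] by (simp add: s_def input_state_simps)
    finally have "cost solver s \<le> K * (m + 1) ^ d + 20 * 1" by simp
    also have "\<dots> \<le> K * (m + 1) ^ d + 20 * (m + 1) ^ d" by (intro add_left_mono mult_left_mono) auto
    finally show ?thesis by (simp add: s_def distrib_right)
  qed
  then show ?thesis by blast
qed

lemma running_time_le: "exec c s n t \<Longrightarrow> running_time c s \<le> of_nat n"
  unfolding running_time_def by (rule INF_lower) auto

text \<open>Nondegeneracy holds almost surely, so one deterministic polynomial bounds the running
  time almost everywhere and hence the expectation, uniformly in \<open>U\<close>.\<close>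

lemma solver_smoothed_polynomial:
  assumes noise: "\<And>\<sigma>. 0 < \<sigma> \<Longrightarrow> prob_space (noise \<sigma>)" "\<And>\<sigma>. 0 < \<sigma> \<Longrightarrow> sets (noise \<sigma>) = sets borel"
    "\<And>\<sigma> r. 0 < \<sigma> \<Longrightarrow> emeasure (noise \<sigma>) {r} = 0"
  shows "smoothed_polynomial_time noise (compile solver)"
  unfolding smoothed_polynomial_time_def
proof (intro allI impI)
  fix \<sigma> :: real assume \<sigma>: "0 < \<sigma> \<and> \<sigma> < 1"
  obtain K d where K: "\<And>m U. \<not> degenerate m U \<Longrightarrow> cost solver (input_state m U) \<le> K * (m + 1) ^ d"
    using cost_solver_nondegenerate by blast
  define f where "f m = real (K * (m + 1) ^ d)" for m
  have time: "smoothed_time (noise \<sigma>) (compile solver) m U \<le> ennreal (f m)" for m U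
  proof -
    interpret prob_space "perturbation (noise \<sigma>) m" using noise \<sigma> by (intro prob_space_perturbation) auto
    have "AE w in perturbation (noise \<sigma>) m. \<not> degenerate m (perturbed U w)"
      using noise \<sigma> by (intro AE_nondegenerate) auto
    then have "AE w in perturbation (noise \<sigma>) m.
        running_time (compile solver) (input_state m (perturbed U w)) \<le> ennreal (f m)"
    proof eventually_elim
      case (elim w)
      have "running_time (compile solver) (input_state m (perturbed U w)) \<le> of_nat (cost solver (input_state m (perturbed U w)))"
        by (rule running_time_le[OF exec_compile]) simp
      also have "\<dots> \<le> of_nat (K * (m + 1) ^ d)" using K[OF elim] by (intro of_nat_mono)
      also have "\<dots> = ennreal (f m)" unfolding f_def by (simp only: ennreal_of_nat_eq_real_of_nat)
      finally show ?case .
    qed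
    then have "smoothed_time (noise \<sigma>) (compile solver) m U \<le> (\<integral>\<^sup>+w. ennreal (f m) \<partial>perturbation (noise \<sigma>) m)"
      unfolding smoothed_time_def by (rule nn_integral_mono_AE)
    also have "\<dots> = ennreal (f m)" by (simp add: emeasure_space_1)
    finally show ?thesis .
  qed
  \<comment> \<open>The exponent \<open>real d + 1\<close> is positive even for
    \<open>d = 0\<close>, and any positive power of the inverse of \<sigma> may be inserted because
    it is at least 1.\<close>
  have bigo: "f \<in> O(\<lambda>m. 1 * real m powr (real d + 1) * \<sigma> powr (- 1))"
  proof (rule bigoI[where c = "real K * 2 ^ d"], rule eventually_mono[OF eventually_ge_at_top[of 1]])
    fix m :: nat assume m: "1 \<le> m"
    have "f m = real K * (real m + 1) ^ d" by (simp add: f_def add.commute)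
    also have "\<dots> \<le> real K * (2 * real m) ^ d" using m by (intro mult_left_mono power_mono) auto
    also have "\<dots> = real K * 2 ^ d * real m powr real d" using m by (simp add: power_mult_distrib powr_realpow)
    also have "\<dots> \<le> real K * 2 ^ d * (real m powr (real d + 1) * \<sigma> powr (- 1))"
    proof (rule mult_left_mono)
      have "1 \<le> \<sigma> powr (- 1)" using \<sigma> by (simp add: powr_minus one_le_inverse)
      moreover have "real m powr real d \<le> real m powr (real d + 1)" using m by (intro powr_mono) auto
      ultimately show "real m powr real d \<le> real m powr (real d + 1) * \<sigma> powr (- 1)"
        using mult_mono[of "real m powr real d" "real m powr (real d + 1)" 1 "\<sigma> powr (- 1)"] by simp
    qed simp
    finally show "norm (f m) \<le> real K * 2 ^ d * norm (1 * real m powr (real d + 1) * \<sigma> powr (- 1))"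
      by (simp add: f_def abs_mult)
  qed
  show "\<exists>c>0. \<exists>k1>0. \<exists>k2>0. \<exists>f.
      (\<forall>m>0. \<forall>U. smoothed_time (noise \<sigma>) (compile solver) m U \<le> ennreal (f m)) \<and>
      f \<in> O(\<lambda>m. c * real m powr k1 * \<sigma> powr (- k2))"
    by (intro exI[of _ 1] exI[of _ "real d + 1"] exI[of _ f] conjI) (use time bigo in auto)
qed

theorem theorem5p1: "in_smoothed_P find_strong_Nash"
  unfolding in_smoothed_P_def
proof (intro exI conjI)
  show "solves (compile solver) find_strong_Nash" by (rule solver_solves)
  show "smoothed_polynomial_time uniform_noise (compile solver)"
    by (rule solver_smoothed_polynomial) (rule uniform_noise_atomless; assumption)+
  show "smoothed_polynomial_time gaussian_noise (compile solver)"
    by (rule solver_smoothed_polynomial) (rule gaussian_noise_atomless; assumption)+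
qed

end
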